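(* (a) A hypoenergetic tree of order $n$ with maximum degree $\Delta \leq 3$ exists if and only if $n \in \{1,3,4,7\}$, and for each of these values of $n$ there is exactly one such tree (up to isomorphism). (b) For every integer $\Delta \geq 4$ and every integer $n \geq \Delta+1$, there exists a hypoenergetic tree of order $n$ with maximum degree $\Delta$.
   Context: All graphs are finite and simple. The eigenvalues of a graph $G$ are the eigenvalues $\lambda_1,\dots,\lambda_n$ of its adjacency matrix, and the energy of $G$ is $E(G)=\sum_{i=1}^n |\lambda_i|$. A connected graph $G$ with $n$ vertices is called hypoenergetic if $E(G)<n$. $\Delta$ denotes the maximum vertex degree. *)

theory Defs
  imports "Jordan_Normal_Form.Char_Poly"
begin

definition simple_graph :: "nat \<Rightarrow> (nat \<Rightarrow> nat \<Rightarrow> bool) \<Rightarrow> bool" where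
  "simple_graph n E \<longleftrightarrow> (\<forall>u v. E u v \<longrightarrow> u < n \<and> v < n \<and> u \<noteq> v \<and> E v u)"

definition edges :: "nat \<Rightarrow> (nat \<Rightarrow> nat \<Rightarrow> bool) \<Rightarrow> nat set set" where
  "edges n E = {{u, v} | u v. u < n \<and> v < n \<and> E u v}"

definition connected_graph :: "nat \<Rightarrow> (nat \<Rightarrow> nat \<Rightarrow> bool) \<Rightarrow> bool" where
  "connected_graph n E \<longleftrightarrow> (\<forall>u v. u < n \<longrightarrow> v < n \<longrightarrow> E\<^sup>*\<^sup>* u v)"

definition is_tree :: "nat \<Rightarrow> (nat \<Rightarrow> nat \<Rightarrow> bool) \<Rightarrow> bool" where
  "is_tree n E \<longleftrightarrow> simple_graph n E \<and> n \<ge> 1 \<and> connected_graph n E \<and> card (edges n E) = n - 1"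

definition degree :: "nat \<Rightarrow> (nat \<Rightarrow> nat \<Rightarrow> bool) \<Rightarrow> nat \<Rightarrow> nat" where
  "degree n E v = card {u. u < n \<and> E v u}"

definition max_degree :: "nat \<Rightarrow> (nat \<Rightarrow> nat \<Rightarrow> bool) \<Rightarrow> nat" where
  "max_degree n E = Max (degree n E ` {0..<n})"

definition adj_matrix :: "nat \<Rightarrow> (nat \<Rightarrow> nat \<Rightarrow> bool) \<Rightarrow> real mat" where
  "adj_matrix n E = mat n n (\<lambda>(i, j). if E i j then 1 else 0)"

definition energy :: "nat \<Rightarrow> (nat \<Rightarrow> nat \<Rightarrow> bool) \<Rightarrow> real" where
  "energy n E = (let p = char_poly (map_mat complex_of_real (adj_matrix n E)) in
     (\<Sum>a\<in>{a. poly p a = 0}. real (order a p) * cmod a))"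

definition hypoenergetic :: "nat \<Rightarrow> (nat \<Rightarrow> nat \<Rightarrow> bool) \<Rightarrow> bool" where
  "hypoenergetic n E \<longleftrightarrow> simple_graph n E \<and> connected_graph n E \<and> energy n E < real n"

definition graph_iso :: "nat \<Rightarrow> (nat \<Rightarrow> nat \<Rightarrow> bool) \<Rightarrow> (nat \<Rightarrow> nat \<Rightarrow> bool) \<Rightarrow> bool" where
  "graph_iso n E E' \<longleftrightarrow> (\<exists>f. bij_betw f {0..<n} {0..<n} \<and>
      (\<forall>u<n. \<forall>v<n. E u v \<longleftrightarrow> E' (f u) (f v)))"

end

theory Submission
  imports
    Defs
    "Jordan_Normal_Form.Schur_Decomposition"
    "HOL-Analysis.L2_Norm"
    "HOL-Library.Tree"
begin

text \<open>
  The energy of a graph is the trace norm of its adjacency matrix \<open>A\<close>. So it is at least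
  \<open>tr (A B)\<close> for every contraction \<open>B\<close>, and it is at most \<open>2 * (\<Sum>v. |t v|)\<close> whenever
  \<open>A\<close> is the sum of the matrices with \<open>t v\<close> in row and column \<open>v\<close>, that is, whenever the graph is
  covered by weighted stars. A star with \<open>k\<close> edges costs \<open>2 * sqrt k\<close> and contributes \<open>k\<close> new
  vertices, so gluing stars with mostly at least four edges yields hypoenergetic trees.

  Conversely, block diagonal contractions show that cutting an edge does not increase the energy.
  Let a tree of maximum degree at most 3 be a smallest counterexample. Then every edge cuts off
  one of the four exceptional trees, and walking away from the exceptional sides leads
  to a vertex all of whose branches are exceptional. This leaves finitely many
  trees. Explicit integer matrices settle the small ones, and the others follow by cutting off
  small pieces such as a cherry, a path with 3 vertices, which loses only \<open>3 - 2 * sqrt 2\<close>.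
\<close>

section \<open>Diagonalization of Hermitian matrices\<close>

text \<open>Bounds are carried as certificates \<open>energy_lb\<close>, traces against
  contractions, instead of energies: a certificate makes sense on any finite vertex set, adds up
  over a cut, and is checked by rational arithmetic without computing an eigenvalue. The obstacle to
  a plain induction over cuts is that an exceptional piece has energy strictly below its order, so a
  cut producing one loses something. With maximum degree 3, an end of the cut edge has at most two
  neighbours in its own piece. An exceptional piece is therefore entered only at a vertex of degree
  at most 2, which gives six kinds of branch and, with the absent one, 84 multisets of three
  branches. Most of these reduce to smaller ones. Shrinking a path entered at its end, or a complete
  binary tree entered at a leaf, to a single vertex removes 2 or 6 vertices of energy at least 2 or
  6, without loss. Cutting off a cherry or a complete binary tree entered at its root loses 18/100
  in the rational bounds, as 3 - 282/100 = 7 - 682/100. The base certificates carry enough surplus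
  to pay for the cuts made later.\<close>

abbreviation dagger :: "complex mat \<Rightarrow> complex mat" where
  "dagger M \<equiv> map_mat cnj (transpose_mat M)"

lemma dagger_mult:
  assumes "M \<in> carrier_mat m k" "N \<in> carrier_mat k n"
  shows "dagger (M * N) = dagger N * dagger M"
  by (rule eq_matI) (use assms in \<open>auto simp: scalar_prod_def mult.commute\<close>)

lemma dagger_four_block_mat:
  assumes "M1 \<in> carrier_mat a a" "M2 \<in> carrier_mat a b" "M3 \<in> carrier_mat b a" "M4 \<in> carrier_mat b b"
  shows "dagger (four_block_mat M1 M2 M3 M4)
    = four_block_mat (dagger M1) (dagger M3) (dagger M2) (dagger M4)"
  by (rule eq_matI) (use assms in auto)

text \<open>Gram-Schmidt, started on a basis with head \<open>v\<close>, keeps \<open>v\<close> and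
  makes the vectors orthogonal without normalizing them. Dividing each by its length gives the
  unitary \<open>W\<close>; the factor \<open>k\<close> is the inverse length of
  \<open>v\<close>.\<close>

lemma unitary_completion:
  assumes v: "v \<in> carrier_vec n" and v0: "v \<noteq> 0\<^sub>v n" and n: "n \<noteq> 0"
  obtains W k where "W \<in> carrier_mat n n" "dagger W * W = 1\<^sub>m n" "col W 0 = k \<cdot>\<^sub>v v"
proof -
  interpret cof_vec_space n "TYPE(complex)" .
  define b where "b = basis_completion v"
  define ws where "ws = gram_schmidt n b"
  from basis_completion[OF v v0, folded b_def]
  have dist: "distinct b" and indep: "\<not> lin_dep (set b)" and b: "set b \<subseteq> carrier_vec n"
    and hdb: "hd b = v" and len: "length b = n" by auto
  from hdb len n obtain vs where bv: "b = v # vs" by (cases b) auto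
  from gram_schmidt_result[OF b dist indep refl, folded ws_def]
  have ws: "set ws \<subseteq> carrier_vec n" "corthogonal ws" "length ws = n" by (auto simp: len)
  have "hd ws = v" using gram_schmidt_hd[OF v, of vs] by (simp add: ws_def bv)
  then have ws0: "ws ! 0 = v" using ws(3) n by (cases ws) auto
  have car: "ws ! i \<in> carrier_vec n" if "i < n" for i
    using ws that by (auto simp: subset_iff)
  define q where "q i = (\<Sum>k<n. (cmod (ws ! i $ k))\<^sup>2)" for i
  have sp: "(\<Sum>k<n. cnj (ws ! i $ k) * ws ! j $ k) = (if i = j then of_real (q i) else 0)"
    and q: "q i > 0" if "i < n" "j < n" for i j
  proof -
    have eq: "ws ! j \<bullet>c ws ! i = (\<Sum>k<n. cnj (ws ! i $ k) * ws ! j $ k)"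
      using car[OF that(1)] car[OF that(2)]
      by (auto simp: scalar_prod_def lessThan_atLeast0 mult.commute intro!: sum.cong)
    have diag: "(\<Sum>k<n. cnj (ws ! i $ k) * ws ! i $ k) = of_real (q i)"
      unfolding q_def of_real_sum by (intro sum.cong refl) (metis complex_norm_square mult.commute of_real_power)
    show "(\<Sum>k<n. cnj (ws ! i $ k) * ws ! j $ k) = (if i = j then of_real (q i) else 0)"
      using eq diag corthogonalD[OF ws(2), of j i] that ws(3) by auto
    have "ws ! i \<bullet>c ws ! i \<noteq> 0"
      using corthogonalD[OF ws(2), of i i] that ws(3) by auto
    moreover have "ws ! i \<bullet>c ws ! i = of_real (q i)"
      using diag car[OF that(1)]
      by (auto simp: scalar_prod_def lessThan_atLeast0 mult.commute intro!: sum.cong)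
    ultimately have "q i \<noteq> 0" by auto
    moreover have "q i \<ge> 0" unfolding q_def by (simp add: sum_nonneg)
    ultimately show "q i > 0" by simp
  qed
  define W where "W = mat n n (\<lambda>(k, i). ws ! i $ k / of_real (sqrt (q i)))"
  have "dagger W * W = 1\<^sub>m n"
  proof (rule eq_matI)
    fix i j assume "i < dim_row (1\<^sub>m n :: complex mat)" "j < dim_col (1\<^sub>m n :: complex mat)"
    then have ij: "i < n" "j < n" by auto
    have "(dagger W * W) $$ (i, j)
        = (\<Sum>k<n. cnj (ws ! i $ k) * ws ! j $ k / (of_real (sqrt (q i)) * of_real (sqrt (q j))))"
      using ij by (simp add: W_def scalar_prod_def lessThan_atLeast0)
    also have "\<dots> = (if i = j then of_real (q i) else 0) / (of_real (sqrt (q i)) * of_real (sqrt (q j)))"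
      by (simp only: sp[OF ij] flip: sum_divide_distrib)
    also have "\<dots> = 1\<^sub>m n $$ (i, j)"
      using q[OF ij] ij by (auto simp flip: of_real_mult)
    finally show "(dagger W * W) $$ (i, j) = 1\<^sub>m n $$ (i, j)" .
  qed (auto simp: W_def)
  moreover have "col W 0 = (1 / of_real (sqrt (q 0))) \<cdot>\<^sub>v v"
    using n v by (intro eq_vecI) (auto simp: W_def ws0)
  moreover have "W \<in> carrier_mat n n" by (simp add: W_def)
  ultimately show ?thesis using that by blast
qed

abbreviation diag_of :: "complex list \<Rightarrow> complex mat" where
  "diag_of es \<equiv> mat (length es) (length es) (\<lambda>(i, j). if i = j then es ! i else 0)"

text \<open>Deflation: conjugation by a unitary whose first column is an eigenvector clears the
  first column below the corner, and the Hermitian property clears the first row too. The remaining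
  block is Hermitian with the remaining roots. The list \<open>es\<close> stays tied to
  \<open>char_poly\<close>, so multiplicities agree with those in \<open>energy\<close>.\<close>

lemma hermitian_diagonalization:
  assumes "A \<in> carrier_mat (length es) (length es)" "dagger A = A"
    and "char_poly A = (\<Prod>e\<leftarrow>es. [:- e, 1:])"
  shows "\<exists>U \<in> carrier_mat (length es) (length es).
    dagger U * U = 1\<^sub>m (length es) \<and> dagger U * A * U = diag_of es"
  using assms
proof (induction es arbitrary: A)
  case Nil
  then show ?case by (intro bexI[of _ "1\<^sub>m 0"]) auto
next
  case (Cons e es)
  define m where "m = length es"
  let ?n = "Suc m"
  have A: "A \<in> carrier_mat ?n ?n" and herm: "dagger A = A" using Cons.prems by (auto simp: m_def)
  have cp: "char_poly A = [:- e, 1:] * (\<Prod>e\<leftarrow>es. [:- e, 1:])" using Cons.prems(3) by simp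
  have "eigenvalue A e" unfolding eigenvalue_root_char_poly[OF A] cp by simp
  then obtain v where v: "v \<in> carrier_vec ?n" "v \<noteq> 0\<^sub>v ?n" "A *\<^sub>v v = e \<cdot>\<^sub>v v"
    using A unfolding eigenvalue_def eigenvector_def by auto
  from unitary_completion[OF v(1,2)] obtain W k where W: "W \<in> carrier_mat ?n ?n"
    and WW: "dagger W * W = 1\<^sub>m ?n" and W0: "col W 0 = k \<cdot>\<^sub>v v" by blast
  have dW: "dagger W \<in> carrier_mat ?n ?n" using W by auto
  have WW': "W * dagger W = 1\<^sub>m ?n" by (rule mat_mult_left_right_inverse[OF dW W WW])
  define A' where "A' = dagger W * (A * W)"
  have A': "A' \<in> carrier_mat ?n ?n" using W A by (auto simp: A'_def)
  have "dagger A' = dagger (A * W) * dagger (dagger W)"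
    unfolding A'_def by (rule dagger_mult[OF dW]) (use A W in auto)
  also have "dagger (dagger W) = W" by (rule eq_matI) auto
  also have "dagger (A * W) = dagger W * A" using dagger_mult[OF A W] herm by simp
  finally have herm': "dagger A' = A'"
    unfolding A'_def using A W dW by (simp add: assoc_mult_mat[of _ ?n ?n _ ?n _ ?n])
  have "col A' 0 = dagger W *\<^sub>v (A *\<^sub>v (k \<cdot>\<^sub>v v))"
    unfolding A'_def col_mult2[OF dW mult_carrier_mat[OF A W] zero_less_Suc]
      col_mult2[OF A W zero_less_Suc] W0 ..
  also have "A *\<^sub>v (k \<cdot>\<^sub>v v) = e \<cdot>\<^sub>v (k \<cdot>\<^sub>v v)"
    using mult_mat_vec[OF A v(1), of k] v by (simp add: smult_smult_assoc mult.commute)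
  also have "dagger W *\<^sub>v (e \<cdot>\<^sub>v (k \<cdot>\<^sub>v v)) = e \<cdot>\<^sub>v (dagger W *\<^sub>v col W 0)"
    unfolding W0[symmetric] by (rule mult_mat_vec[OF dW]) (metis W carrier_matD(1) col_dim)
  also have "dagger W *\<^sub>v col W 0 = col (dagger W * W) 0"
    by (rule col_mult2[OF dW W zero_less_Suc, symmetric])
  finally have col0: "col A' 0 = e \<cdot>\<^sub>v col (1\<^sub>m ?n) 0" by (simp add: WW)
  have A'0: "A' $$ (i, 0) = (if i = 0 then e else 0)" if "i < ?n" for i
  proof -
    have "A' $$ (i, 0) = col A' 0 $ i" using A' that by simp
    then show ?thesis using that unfolding col0 by simp
  qed
  have A'0': "A' $$ (0, i) = (if i = 0 then e else 0)" if "i < ?n" for i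
  proof -
    have "A' $$ (0, i) = cnj (A' $$ (i, 0))" "A' $$ (0, 0) = cnj (A' $$ (0, 0))"
      using A' that arg_cong[OF herm', of "\<lambda>M. M $$ (0, i)"] arg_cong[OF herm', of "\<lambda>M. M $$ (0, 0)"]
      by auto
    then show ?thesis using A'0[OF that] A'0[of 0] by auto
  qed
  define A3 where "A3 = mat m m (\<lambda>(i, j). A' $$ (Suc i, Suc j))"
  have A3: "A3 \<in> carrier_mat m m" by (simp add: A3_def)
  have block: "A' = four_block_mat (mat 1 1 (\<lambda>_. e)) (0\<^sub>m 1 m) (0\<^sub>m m 1) A3"
  proof (rule eq_matI)
    fix i j
    assume "i < dim_row (four_block_mat (mat 1 1 (\<lambda>_. e)) (0\<^sub>m 1 m) (0\<^sub>m m 1) A3)"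
      "j < dim_col (four_block_mat (mat 1 1 (\<lambda>_. e)) (0\<^sub>m 1 m) (0\<^sub>m m 1) A3)"
    then have "i < ?n" "j < ?n" by (auto simp: A3_def)
    then show "A' $$ (i, j) = four_block_mat (mat 1 1 (\<lambda>_. e)) (0\<^sub>m 1 m) (0\<^sub>m m 1) A3 $$ (i, j)"
      using A'0[of i] A'0'[of j] by (cases i; cases j) (auto simp: A3_def)
  qed (use A' in \<open>auto simp: A3_def\<close>)
  have "similar_mat A' A"
    by (rule similar_matI[of _ _ "dagger W" W ?n])
      (use A A' W dW WW WW' in \<open>auto simp: A'_def assoc_mult_mat[of _ ?n ?n _ ?n _ ?n]\<close>)
  then have "char_poly A' = [:- e, 1:] * (\<Prod>e\<leftarrow>es. [:- e, 1:])"
    using char_poly_similar cp by metis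
  moreover have "char_poly A' = char_poly (mat 1 1 (\<lambda>_. e)) * char_poly A3"
    unfolding block by (rule char_poly_four_block_zeros_col[OF _ _ A3]) auto
  moreover have "char_poly (mat 1 1 (\<lambda>_. e)) = [:- e, 1:]"
    by (simp add: char_poly_defs det_def sign_def)
  ultimately have cp3: "char_poly A3 = (\<Prod>e\<leftarrow>es. [:- e, 1:])"
    by (metis mult_cancel_left pCons_eq_0_iff zero_neq_one)
  have "dagger A3 = A3"
  proof (rule eq_matI)
    fix i j assume "i < dim_row A3" "j < dim_col A3"
    then have ij: "i < m" "j < m" by (auto simp: A3_def)
    then have "A' $$ (Suc i, Suc j) = cnj (A' $$ (Suc j, Suc i))"
      using A' arg_cong[OF herm', of "\<lambda>M. M $$ (Suc i, Suc j)"] by auto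
    then show "dagger A3 $$ (i, j) = A3 $$ (i, j)" using ij by (simp add: A3_def)
  qed (auto simp: A3_def)
  then have "\<exists>U \<in> carrier_mat m m. dagger U * U = 1\<^sub>m m \<and> dagger U * A3 * U = diag_of es"
    using Cons.IH[OF A3[unfolded m_def] _ cp3] by (simp only: m_def simp_thms)
  then obtain U where U: "U \<in> carrier_mat m m"
    and UU: "dagger U * U = 1\<^sub>m m" and UA: "dagger U * A3 * U = diag_of es"
    by (elim bexE conjE)
  define V where "V = four_block_mat (1\<^sub>m 1) (0\<^sub>m 1 m) (0\<^sub>m m 1) U"
  have V: "V \<in> carrier_mat ?n ?n" using U by (auto simp: V_def)
  have one: "dagger (1\<^sub>m 1) = 1\<^sub>m 1" by (rule eq_matI) auto
  have zero: "dagger (0\<^sub>m i j) = 0\<^sub>m j i" for i j by (rule eq_matI) auto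
  have dV: "dagger V = four_block_mat (1\<^sub>m 1) (0\<^sub>m 1 m) (0\<^sub>m m 1) (dagger U)"
    unfolding V_def using U by (subst dagger_four_block_mat[of _ 1 _ m]) (auto simp: one zero)
  have dVc: "dagger V \<in> carrier_mat ?n ?n" using V by auto
  have dU: "dagger U \<in> carrier_mat m m" using U by auto
  have "dagger V * V = four_block_mat (1\<^sub>m 1) (0\<^sub>m 1 m) (0\<^sub>m m 1) (1\<^sub>m m)"
    unfolding dV unfolding V_def using U dU UU
    by (subst mult_four_block_mat[of _ 1 1 _ m _ m _ _ 1 _ m]) auto
  then have VV: "dagger V * V = 1\<^sub>m ?n" by simp
  have "dagger V * A' = four_block_mat (mat 1 1 (\<lambda>_. e)) (0\<^sub>m 1 m) (0\<^sub>m m 1) (dagger U * A3)"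
    unfolding dV block using U dU A3
    by (subst mult_four_block_mat[of _ 1 1 _ m _ m _ _ 1 _ m]) auto
  then have "dagger V * A' * V
      = four_block_mat (mat 1 1 (\<lambda>_. e)) (0\<^sub>m 1 m) (0\<^sub>m m 1) (dagger U * A3 * U)"
    unfolding V_def using U dU A3
    by (simp, subst mult_four_block_mat[of _ 1 1 _ m _ m _ _ 1 _ m]) auto
  also have "\<dots> = diag_of (e # es)"
    unfolding UA
    by (rule eq_matI) (auto simp: m_def nth_Cons split: nat.splits)
  finally have VA: "dagger V * A' * V = diag_of (e # es)" .
  have dWV: "dagger (W * V) = dagger V * dagger W" by (rule dagger_mult[OF W V])
  have "dagger (W * V) * (W * V) = dagger V * ((dagger W * W) * V)"
    unfolding dWV using W V dW dVc by (simp add: assoc_mult_mat[of _ ?n ?n _ ?n _ ?n])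
  also have "\<dots> = 1\<^sub>m ?n" using V VV by (simp add: WW)
  finally have 1: "dagger (W * V) * (W * V) = 1\<^sub>m ?n" .
  have "dagger (W * V) * A * (W * V) = dagger V * A' * V"
    unfolding dWV A'_def using A W V dW dVc by (simp add: assoc_mult_mat[of _ ?n ?n _ ?n _ ?n])
  then show ?case using 1 VA W V by (intro bexI[of _ "W * V"]) (auto simp: m_def)
qed

text \<open>The spectral decomposition in coordinates: eigenvalues \<open>l i\<close> and a unitary
  matrix of eigenvectors \<open>w i\<close>. The order of a root equals its number of occurrences in
  the list of linear factors, so the sum over distinct roots becomes a sum over that list; the
  eigenvalues are real because the diagonalized matrix is still Hermitian.\<close>

lemma energy_spectral:
  assumes E: "\<And>u v. E u v \<Longrightarrow> E v u"
  shows "\<exists>(l :: nat \<Rightarrow> real) (w :: nat \<Rightarrow> nat \<Rightarrow> complex).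
    energy n E = (\<Sum>i<n. \<bar>l i\<bar>) \<and>
    (\<forall>i<n. \<forall>j<n. (\<Sum>v<n. cnj (w i v) * w j v) = (if i = j then 1 else 0)) \<and>
    (\<forall>u<n. \<forall>v<n. (\<Sum>i<n. w i u * cnj (w i v)) = (if u = v then 1 else 0)) \<and>
    (\<forall>u<n. \<forall>v<n. (\<Sum>i<n. of_real (l i) * w i u * cnj (w i v)) = (if E u v then 1 else 0))"
proof -
  define A where "A = map_mat complex_of_real (adj_matrix n E)"
  have A: "A \<in> carrier_mat n n" by (simp add: A_def adj_matrix_def)
  have Aij: "A $$ (i, j) = (if E i j then 1 else 0)" if "i < n" "j < n" for i j
    using that by (simp add: A_def adj_matrix_def)
  have herm: "dagger A = A"
    by (rule eq_matI) (use A E in \<open>auto simp: Aij\<close>)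
  from char_poly_factorized[OF A] obtain es where
    cp: "char_poly A = (\<Prod>e\<leftarrow>es. [:- e, 1:])" and len: "length es = n" by blast
  obtain U where U: "U \<in> carrier_mat n n" and UU: "dagger U * U = 1\<^sub>m n"
    and UA: "dagger U * A * U = diag_of es"
    using hermitian_diagonalization[OF _ herm cp] A len by auto
  have dU: "dagger U \<in> carrier_mat n n" using U by auto
  have UU': "U * dagger U = 1\<^sub>m n" by (rule mat_mult_left_right_inverse[OF dU U UU])
  have Dc: "diag_of es \<in> carrier_mat n n" by (simp add: len)
  have "U * (dagger U * A * U) * dagger U = (U * dagger U) * A * (U * dagger U)"
    using U dU A by (simp add: assoc_mult_mat[of _ n n _ n _ n])
  then have AU: "A = U * diag_of es * dagger U" using A by (simp add: UA UU')
  have "dagger (dagger U) = U" by (rule eq_matI) auto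
  then have "dagger (dagger U * A * U) = dagger U * A * U"
    using U dU A
    by (simp add: dagger_mult[of _ n n _ n] herm assoc_mult_mat[of _ n n _ n _ n])
  then have Dh: "dagger (diag_of es) = diag_of es" by (simp only: UA)
  have real: "es ! i = of_real (Re (es ! i))" if "i < n" for i
    using arg_cong[OF Dh, of "\<lambda>M. M $$ (i, i)"] that len
    by (auto simp: complex_eq_iff)
  have count: "(\<Sum>x\<leftarrow>xs. if x = a then 1 else 0) = count_list xs a" for a :: complex and xs
    by (induction xs) auto
  have linear: "Polynomial.order a [:- e, 1:] = (if e = a then 1 else 0)" for a e :: complex
    using order_power_n_n[of a 1] by (auto intro: order_0I)
  have roots: "{a. poly (char_poly A) a = 0} = set es"
    unfolding cp by (auto simp: poly_prod_list prod_list_zero_iff)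
  have ord: "Polynomial.order a (char_poly A) = count_list es a" for a
    unfolding cp by (subst order_prod_list) (auto simp: o_def linear count)
  \<comment> \<open>A fixed superset \<open>S\<close> of the entries keeps the index set unchanged
    while the list shrinks.\<close>
  have weighted: "(\<Sum>a\<in>S. real (count_list xs a) * cmod a) = (\<Sum>a\<leftarrow>xs. cmod a)"
    if "finite S" "set xs \<subseteq> S" for S xs
    using that(2)
  proof (induction xs)
    case (Cons x xs)
    have "(\<Sum>a\<in>S. real (count_list (x # xs) a) * cmod a)
        = (\<Sum>a\<in>S. (if a = x then cmod a else 0) + real (count_list xs a) * cmod a)"
      by (rule sum.cong) (auto simp: algebra_simps)
    then show ?case using Cons that(1) by (simp add: sum.distrib)
  qed simp
  have "energy n E = (\<Sum>a\<in>set es. real (count_list es a) * cmod a)"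
    by (simp add: energy_def A_def[symmetric] Let_def roots ord)
  also have "\<dots> = (\<Sum>a\<leftarrow>es. cmod a)"
    by (rule weighted) auto
  also have "\<dots> = (\<Sum>i<n. \<bar>Re (es ! i)\<bar>)"
    unfolding sum_list_sum_nth len lessThan_atLeast0[symmetric] length_map
    by (rule sum.cong) (use real len in \<open>auto, metis norm_of_real real_norm_def\<close>)
  finally have en: "energy n E = (\<Sum>i<n. \<bar>Re (es ! i)\<bar>)" .
  show ?thesis
  proof (intro exI[of _ "\<lambda>i. Re (es ! i)"] exI[of _ "\<lambda>i v. U $$ (v, i)"] conjI allI impI)
    show "(\<Sum>v<n. cnj (U $$ (v, i)) * U $$ (v, j)) = (if i = j then 1 else 0)"
      if "i < n" "j < n" for i j
      using arg_cong[OF UU, of "\<lambda>M. M $$ (i, j)"] that U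
      by (simp add: scalar_prod_def lessThan_atLeast0)
    show "(\<Sum>i<n. U $$ (u, i) * cnj (U $$ (v, i))) = (if u = v then 1 else 0)"
      if "u < n" "v < n" for u v
      using arg_cong[OF UU', of "\<lambda>M. M $$ (u, v)"] that U
      by (simp add: scalar_prod_def lessThan_atLeast0)
    show "(\<Sum>i<n. of_real (Re (es ! i)) * U $$ (u, i) * cnj (U $$ (v, i))) = (if E u v then 1 else 0)"
      if "u < n" "v < n" for u v
    proof -
      have UD: "(U * diag_of es) $$ (u, i) = U $$ (u, i) * es ! i" if "i < n" for i
      proof -
        have "(U * diag_of es) $$ (u, i) = (\<Sum>k<n. U $$ (u, k) * (if k = i then es ! k else 0))"
          using that \<open>u < n\<close> U len by (simp add: scalar_prod_def lessThan_atLeast0)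
        also have "\<dots> = (\<Sum>k<n. if k = i then U $$ (u, k) * es ! k else 0)"
          by (rule sum.cong) auto
        finally show ?thesis using that by simp
      qed
      define M where "M = U * diag_of es"
      have M: "M \<in> carrier_mat n n" using U Dc by (simp add: M_def)
      have "A $$ (u, v) = (M * dagger U) $$ (u, v)" by (simp add: AU M_def)
      also have "\<dots> = (\<Sum>i<n. M $$ (u, i) * cnj (U $$ (v, i)))"
        using that U M by (simp add: scalar_prod_def lessThan_atLeast0)
      also have "\<dots> = (\<Sum>i<n. of_real (Re (es ! i)) * U $$ (u, i) * cnj (U $$ (v, i)))"
        by (rule sum.cong) (use UD real in \<open>auto simp: M_def\<close>)
      finally show ?thesis using Aij that by simp
    qed
  qed (use en in auto)
qed

section \<open>Bounds for the energy\<close>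

text \<open>For symmetric \<open>B\<close> this says that the spectral norm on \<open>V\<close> is
  at most 1. The quadratic form works over any finite index set and restricts to blocks without
  matrix types.\<close>

definition contraction_on :: "'a set \<Rightarrow> ('a \<Rightarrow> 'a \<Rightarrow> real) \<Rightarrow> bool" where
  "contraction_on V B \<longleftrightarrow> (\<forall>x. \<bar>\<Sum>u\<in>V. \<Sum>v\<in>V. B u v * (x u * x v)\<bar> \<le> (\<Sum>v\<in>V. (x v)\<^sup>2))"

text \<open>In the eigenbasis the trace of the product with \<open>B\<close> is the sum of
  \<open>l i\<close> times the value of the form of \<open>B\<close> at \<open>w i\<close>. That
  form is known for real vectors only, so \<open>w i\<close> is split into real and imaginary parts;
  their squared lengths add up to 1, which bounds each factor by 1.\<close>

lemma energy_ge_contraction: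
  assumes E: "\<And>u v. E u v \<Longrightarrow> E v u" and B: "contraction_on {..<n} B"
  shows "(\<Sum>u<n. \<Sum>v<n. if E u v then B u v else 0) \<le> energy n E"
proof -
  from energy_spectral[of E n, OF E] obtain l w where en: "energy n E = (\<Sum>i<n. \<bar>l i\<bar>)"
    and orth: "\<forall>i<n. \<forall>j<n. (\<Sum>v<n. cnj (w i v) * w j v) = (if i = j then 1 else 0)"
    and res: "\<forall>u<n. \<forall>v<n. (\<Sum>i<n. w i u * cnj (w i v)) = (if u = v then 1 else 0)"
    and A: "\<forall>u<n. \<forall>v<n. (\<Sum>i<n. of_real (l i) * w i u * cnj (w i v)) = (if E u v then 1 else 0)"
    by blast
  note orth = orth[rule_format] and res = res[rule_format] and A = A[rule_format]
  define a b where "a i v = Re (w i v)" and "b i v = Im (w i v)" for i v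
  have unit: "(\<Sum>v<n. (a i v)\<^sup>2) + (\<Sum>v<n. (b i v)\<^sup>2) = 1" if "i < n" for i
    using arg_cong[OF orth[OF that that], of Re]
    by (simp add: a_def b_def power2_eq_square sum.distrib)
  have Ar: "(\<Sum>i<n. l i * (a i u * a i v + b i u * b i v)) = (if E u v then 1 else 0)"
    if "u < n" "v < n" for u v
    using arg_cong[OF A[OF that], of Re] by (simp add: a_def b_def algebra_simps)
  have form: "\<bar>\<Sum>u<n. \<Sum>v<n. B u v * (x u * x v)\<bar> \<le> (\<Sum>v<n. (x v)\<^sup>2)" for x
    using B by (simp add: contraction_on_def)
  have "(\<Sum>u<n. \<Sum>v<n. if E u v then B u v else 0)
      = (\<Sum>u<n. \<Sum>v<n. \<Sum>i<n. B u v * (l i * (a i u * a i v + b i u * b i v)))"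
    by (intro sum.cong refl) (auto simp: Ar simp flip: sum_distrib_left)
  also have "\<dots> = (\<Sum>u<n. \<Sum>i<n. \<Sum>v<n. B u v * (l i * (a i u * a i v + b i u * b i v)))"
    by (intro sum.cong refl sum.swap)
  also have "\<dots> = (\<Sum>i<n. \<Sum>u<n. \<Sum>v<n. B u v * (l i * (a i u * a i v + b i u * b i v)))"
    by (rule sum.swap)
  also have "\<dots> = (\<Sum>i<n. l i * ((\<Sum>u<n. \<Sum>v<n. B u v * (a i u * a i v))
      + (\<Sum>u<n. \<Sum>v<n. B u v * (b i u * b i v))))"
    by (simp add: sum_distrib_left sum.distrib algebra_simps)
  also have "\<dots> \<le> (\<Sum>i<n. \<bar>l i\<bar>)"
  proof (rule sum_mono)
    fix i assume "i \<in> {..<n}"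
    then have "\<bar>(\<Sum>u<n. \<Sum>v<n. B u v * (a i u * a i v)) + (\<Sum>u<n. \<Sum>v<n. B u v * (b i u * b i v))\<bar> \<le> 1"
      using form[of "a i"] form[of "b i"] unit[of i] by simp
    then show "l i * ((\<Sum>u<n. \<Sum>v<n. B u v * (a i u * a i v))
      + (\<Sum>u<n. \<Sum>v<n. B u v * (b i u * b i v))) \<le> \<bar>l i\<bar>" (is "_ * ?q \<le> _")
      using mult_left_mono[of "\<bar>?q\<bar>" 1 "\<bar>l i\<bar>"] abs_mult[of "l i" ?q] by linarith
  qed
  finally show ?thesis by (simp add: en)
qed

text \<open>The eigenvalue \<open>l i\<close> is the Rayleigh quotient of \<open>w i\<close>, and
  the adjacency matrix is \<open>t\<close> plus its transpose, so |\<open>l i\<close>| is at most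
  twice the sum over \<open>u\<close> of |\<open>w i u\<close>| |\<open>T i u\<close>|. Summing over
  \<open>i\<close> first and applying Cauchy-Schwarz for fixed \<open>u\<close> leaves a factor 1,
  the length of a row of a unitary matrix, times the length of row \<open>u\<close> of
  \<open>t\<close>.\<close>

lemma energy_le_star_cover:
  assumes E: "\<And>u v. E u v \<Longrightarrow> E v u"
    and t: "\<And>u v. u < n \<Longrightarrow> v < n \<Longrightarrow> t u v + t v u = (if E u v then 1 else 0)"
  shows "energy n E \<le> 2 * (\<Sum>u<n. sqrt (\<Sum>v<n. (t u v)\<^sup>2))"
proof -
  from energy_spectral[of E n, OF E] obtain l w where en: "energy n E = (\<Sum>i<n. \<bar>l i\<bar>)"
    and orth: "\<forall>i<n. \<forall>j<n. (\<Sum>v<n. cnj (w i v) * w j v) = (if i = j then 1 else 0)"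
    and res: "\<forall>u<n. \<forall>v<n. (\<Sum>i<n. w i u * cnj (w i v)) = (if u = v then 1 else 0)"
    and A: "\<forall>u<n. \<forall>v<n. (\<Sum>i<n. of_real (l i) * w i u * cnj (w i v)) = (if E u v then 1 else 0)"
    by blast
  note orth = orth[rule_format] and res = res[rule_format] and A = A[rule_format]
  define T where "T i u = (\<Sum>v<n. of_real (t u v) * w i v)" for i u
  have l: "of_real (l i) = (\<Sum>u<n. cnj (w i u) * T i u + w i u * cnj (T i u))" if i: "i < n" for i
  proof -
    have "(\<Sum>u<n. \<Sum>v<n. cnj (w i u) * w i v * (if E u v then 1 else 0))
        = (\<Sum>u<n. \<Sum>v<n. \<Sum>j<n. of_real (l j) * (cnj (w i u) * w j u) * (cnj (w j v) * w i v))"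
      by (intro sum.cong refl) (auto simp: sum_distrib_left mult_ac simp flip: A)
    also have "\<dots> = (\<Sum>u<n. \<Sum>j<n. \<Sum>v<n. of_real (l j) * (cnj (w i u) * w j u) * (cnj (w j v) * w i v))"
      by (rule sum.cong[OF refl], rule sum.swap)
    also have "\<dots> = (\<Sum>j<n. \<Sum>u<n. \<Sum>v<n. of_real (l j) * (cnj (w i u) * w j u) * (cnj (w j v) * w i v))"
      by (rule sum.swap)
    also have "\<dots> = (\<Sum>j<n. of_real (l j) * (\<Sum>u<n. cnj (w i u) * w j u) * (\<Sum>v<n. cnj (w j v) * w i v))"
      by (simp add: sum_distrib_left sum_distrib_right mult_ac)
    also have "\<dots> = (\<Sum>j<n. if j = i then of_real (l j) else 0)"
      by (intro sum.cong refl) (auto simp: orth i)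
    also have "\<dots> = of_real (l i)" using i by simp
    finally have "of_real (l i) = (\<Sum>u<n. \<Sum>v<n. cnj (w i u) * w i v * (if E u v then 1 else 0))" ..
    also have "\<dots> = (\<Sum>u<n. \<Sum>v<n. cnj (w i u) * w i v * of_real (t u v + t v u))"
      by (intro sum.cong refl) (auto simp: t)
    also have "\<dots> = (\<Sum>u<n. \<Sum>v<n. cnj (w i u) * (of_real (t u v) * w i v))
        + (\<Sum>u<n. \<Sum>v<n. w i v * (of_real (t v u) * cnj (w i u)))"
      by (simp add: algebra_simps sum.distrib)
    also have "(\<Sum>u<n. \<Sum>v<n. w i v * (of_real (t v u) * cnj (w i u)))
        = (\<Sum>v<n. \<Sum>u<n. w i v * (of_real (t v u) * cnj (w i u)))" by (rule sum.swap)
    finally show ?thesis by (simp add: T_def sum_distrib_left sum.distrib)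
  qed
  have labs: "\<bar>l i\<bar> \<le> 2 * (\<Sum>u<n. cmod (w i u) * cmod (T i u))" if "i < n" for i
  proof -
    have "\<bar>l i\<bar> = cmod (\<Sum>u<n. cnj (w i u) * T i u + w i u * cnj (T i u))"
      by (simp add: l[OF that, symmetric])
    also have "\<dots> \<le> (\<Sum>u<n. 2 * (cmod (w i u) * cmod (T i u)))"
      by (rule sum_norm_le) (rule order_trans[OF norm_triangle_ineq], simp add: norm_mult)
    finally show ?thesis by (simp add: sum_distrib_left)
  qed
  have w1: "(\<Sum>i<n. (cmod (w i u))\<^sup>2) = 1" if "u < n" for u
  proof -
    have "complex_of_real (\<Sum>i<n. (cmod (w i u))\<^sup>2) = (\<Sum>i<n. w i u * cnj (w i u))"
      by (simp only: of_real_sum complex_norm_square)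
    then show ?thesis using res[OF that that] by (simp only: simp_thms if_True of_real_eq_1_iff)
  qed
  \<comment> \<open>Parseval: \<open>T i u\<close> pairs row \<open>u\<close> of \<open>t\<close>
    with the eigenvector \<open>w i\<close>, and \<open>res\<close> states completeness of the
    eigenvectors.\<close>
  have T2: "(\<Sum>i<n. (cmod (T i u))\<^sup>2) = (\<Sum>v<n. (t u v)\<^sup>2)" if "u < n" for u
  proof -
    have "complex_of_real (\<Sum>i<n. (cmod (T i u))\<^sup>2) = (\<Sum>i<n. T i u * cnj (T i u))"
      by (simp only: of_real_sum complex_norm_square)
    also have "\<dots> = (\<Sum>i<n. \<Sum>v<n. \<Sum>v'<n. of_real (t u v * t u v') * (w i v * cnj (w i v')))"
      by (simp add: T_def sum_product mult_ac)
    also have "\<dots> = (\<Sum>v<n. \<Sum>i<n. \<Sum>v'<n. of_real (t u v * t u v') * (w i v * cnj (w i v')))"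
      by (rule sum.swap)
    also have "\<dots> = (\<Sum>v<n. \<Sum>v'<n. \<Sum>i<n. of_real (t u v * t u v') * (w i v * cnj (w i v')))"
      by (rule sum.cong[OF refl], rule sum.swap)
    also have "\<dots> = (\<Sum>v<n. \<Sum>v'<n. if v' = v then of_real (t u v * t u v') else 0)"
      by (intro sum.cong refl) (auto simp: res simp flip: sum_distrib_left)
    also have "\<dots> = complex_of_real (\<Sum>v<n. (t u v)\<^sup>2)"
      by (simp add: power2_eq_square)
    finally show ?thesis by (simp only: of_real_eq_iff)
  qed
  have "energy n E \<le> (\<Sum>i<n. 2 * (\<Sum>u<n. cmod (w i u) * cmod (T i u)))"
    unfolding en by (rule sum_mono) (use labs in auto)
  also have "\<dots> = 2 * (\<Sum>u<n. \<Sum>i<n. cmod (w i u) * cmod (T i u))"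
    unfolding sum_distrib_left[symmetric] by (subst sum.swap) (rule refl)
  also have "(\<Sum>u<n. \<Sum>i<n. cmod (w i u) * cmod (T i u)) \<le> (\<Sum>u<n. sqrt (\<Sum>v<n. (t u v)\<^sup>2))"
  proof (rule sum_mono)
    fix u assume "u \<in> {..<n}"
    then have u: "u < n" by simp
    have "(\<Sum>i<n. \<bar>cmod (w i u)\<bar> * \<bar>cmod (T i u)\<bar>)
        \<le> L2_set (\<lambda>i. cmod (w i u)) {..<n} * L2_set (\<lambda>i. cmod (T i u)) {..<n}"
      by (rule L2_set_mult_ineq)
    then show "(\<Sum>i<n. cmod (w i u) * cmod (T i u)) \<le> sqrt (\<Sum>v<n. (t u v)\<^sup>2)"
      by (simp add: L2_set_def w1[OF u] T2[OF u])
  qed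
  finally show ?thesis by simp
qed

section \<open>Certified lower bounds\<close>

text \<open>\<open>R\<close> will contain both orientations of every edge, so the sum is the trace
  of the adjacency matrix times \<open>B\<close>.\<close>

definition energy_lb :: "'a set \<Rightarrow> ('a \<times> 'a) set \<Rightarrow> real \<Rightarrow> bool" where
  "energy_lb V R x \<longleftrightarrow> (\<exists>B. contraction_on V B \<and> x \<le> (\<Sum>(u, v)\<in>R. B u v))"

lemma energy_lb_mono: "energy_lb V R x \<Longrightarrow> y \<le> x \<Longrightarrow> energy_lb V R y"
  unfolding energy_lb_def by (meson order_trans)

lemma energy_lb_Un:
  assumes fin: "finite V1" "finite V2" "finite C" and disj: "V1 \<inter> V2 = {}"
    and R1: "R1 \<subseteq> V1 \<times> V1" and R2: "R2 \<subseteq> V2 \<times> V2"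
    and C: "C \<subseteq> V1 \<times> V2 \<union> V2 \<times> V1"
    and lb: "energy_lb V1 R1 x" "energy_lb V2 R2 y"
  shows "energy_lb (V1 \<union> V2) (R1 \<union> R2 \<union> C) (x + y)"
proof -
  from lb obtain B1 B2 where B1: "contraction_on V1 B1" "x \<le> (\<Sum>(u, v)\<in>R1. B1 u v)"
    and B2: "contraction_on V2 B2" "y \<le> (\<Sum>(u, v)\<in>R2. B2 u v)"
    unfolding energy_lb_def by blast
  define B where "B u v = (if u \<in> V1 \<and> v \<in> V1 then B1 u v
    else if u \<in> V2 \<and> v \<in> V2 then B2 u v else 0)" for u v
  have split: "(\<Sum>u\<in>V1 \<union> V2. \<Sum>v\<in>V1 \<union> V2. B u v * (z u * z v))
      = (\<Sum>u\<in>V1. \<Sum>v\<in>V1. B1 u v * (z u * z v)) + (\<Sum>u\<in>V2. \<Sum>v\<in>V2. B2 u v * (z u * z v))" for z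
  proof -
    have row1: "(\<Sum>v\<in>V1 \<union> V2. B u v * (z u * z v)) = (\<Sum>v\<in>V1. B1 u v * (z u * z v))" if "u \<in> V1" for u
    proof -
      have "(\<Sum>v\<in>V1. B u v * (z u * z v)) = (\<Sum>v\<in>V1. B1 u v * (z u * z v))"
        by (rule sum.cong) (use that in \<open>auto simp: B_def\<close>)
      moreover have "(\<Sum>v\<in>V2. B u v * (z u * z v)) = 0"
        by (rule sum.neutral) (use that disj in \<open>auto simp: B_def\<close>)
      ultimately show ?thesis using fin disj by (simp add: sum.union_disjoint)
    qed
    have row2: "(\<Sum>v\<in>V1 \<union> V2. B u v * (z u * z v)) = (\<Sum>v\<in>V2. B2 u v * (z u * z v))" if "u \<in> V2" for u
    proof -
      have "(\<Sum>v\<in>V2. B u v * (z u * z v)) = (\<Sum>v\<in>V2. B2 u v * (z u * z v))"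
        by (rule sum.cong) (use that disj in \<open>auto simp: B_def\<close>)
      moreover have "(\<Sum>v\<in>V1. B u v * (z u * z v)) = 0"
        by (rule sum.neutral) (use that disj in \<open>auto simp: B_def\<close>)
      ultimately show ?thesis using fin disj by (simp add: sum.union_disjoint)
    qed
    show ?thesis
      unfolding sum.union_disjoint[OF fin(1,2) disj, of "\<lambda>u. \<Sum>v\<in>V1 \<union> V2. B u v * (z u * z v)"]
      by (simp only: row1 row2 cong: sum.cong)
  qed
  have "contraction_on (V1 \<union> V2) B"
    unfolding contraction_on_def
  proof
    fix z
    show "\<bar>\<Sum>u\<in>V1 \<union> V2. \<Sum>v\<in>V1 \<union> V2. B u v * (z u * z v)\<bar> \<le> (\<Sum>v\<in>V1 \<union> V2. (z v)\<^sup>2)"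
      using B1(1)[unfolded contraction_on_def, rule_format, of z]
        B2(1)[unfolded contraction_on_def, rule_format, of z]
      unfolding split sum.union_disjoint[OF fin(1,2) disj, of "\<lambda>v. (z v)\<^sup>2"] by linarith
  qed
  moreover have "(\<Sum>(u, v)\<in>R1 \<union> R2 \<union> C. B u v) = (\<Sum>(u, v)\<in>R1. B1 u v) + (\<Sum>(u, v)\<in>R2. B2 u v)"
  proof -
    have fR: "finite R1" "finite R2"
      using R1 R2 fin finite_subset by blast+
    have "(\<Sum>(u, v)\<in>R1. B u v) = (\<Sum>(u, v)\<in>R1. B1 u v)"
      by (rule sum.cong) (use R1 in \<open>auto simp: B_def\<close>)
    moreover have "(\<Sum>(u, v)\<in>R2. B u v) = (\<Sum>(u, v)\<in>R2. B2 u v)"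
      by (rule sum.cong) (use R2 disj in \<open>auto simp: B_def\<close>)
    moreover have "(\<Sum>(u, v)\<in>C. B u v) = 0"
    proof (rule sum.neutral, clarify)
      fix u v assume "(u, v) \<in> C"
      then have "u \<in> V1 \<and> v \<in> V2 \<or> u \<in> V2 \<and> v \<in> V1" using C by blast
      then show "B u v = 0" using disj by (auto simp: B_def disjoint_iff)
    qed
    moreover have "R1 \<inter> R2 = {}" "(R1 \<union> R2) \<inter> C = {}"
      using R1 R2 C disj by blast+
    ultimately show ?thesis using fR fin(3) by (simp add: sum.union_disjoint)
  qed
  ultimately show ?thesis
    unfolding energy_lb_def using B1(2) B2(2) by (intro exI[of _ B]) simp
qed

lemma energy_lb_image:
  assumes inj: "inj_on f V" and R: "R \<subseteq> V \<times> V" and lb: "energy_lb V R x"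
  shows "energy_lb (f ` V) (map_prod f f ` R) x"
proof -
  from lb obtain B where B: "contraction_on V B" "x \<le> (\<Sum>(u, v)\<in>R. B u v)"
    unfolding energy_lb_def by blast
  let ?g = "the_inv_into V f"
  have g: "?g (f v) = v" if "v \<in> V" for v by (rule the_inv_into_f_f[OF inj that])
  have injR: "inj_on (map_prod f f) R"
    by (rule inj_on_subset[OF map_prod_inj_on[OF inj inj] R])
  have "contraction_on (f ` V) (\<lambda>u v. B (?g u) (?g v))"
    unfolding contraction_on_def
  proof
    fix z
    show "\<bar>\<Sum>u\<in>f ` V. \<Sum>v\<in>f ` V. B (?g u) (?g v) * (z u * z v)\<bar> \<le> (\<Sum>v\<in>f ` V. (z v)\<^sup>2)"
      using B(1)[unfolded contraction_on_def, rule_format, of "z \<circ> f"]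
      by (simp add: sum.reindex[OF inj] g cong: sum.cong)
  qed
  moreover have "(\<Sum>(u, v)\<in>map_prod f f ` R. B (?g u) (?g v)) = (\<Sum>(u, v)\<in>R. B u v)"
    unfolding sum.reindex[OF injR] by (rule sum.cong) (use R g in auto)
  ultimately show ?thesis using B(2) unfolding energy_lb_def by metis
qed

text \<open>
  \<open>U / N\<close> is a contraction because the spectral norm of its Gram matrix is bounded by the
  largest absolute row sum.
\<close>

lemma energy_lb_gram:
  assumes fin: "finite I" "finite J" and disj: "I \<inter> J = {}" and N: "N > 0"
    and gram: "\<And>i. i \<in> I \<Longrightarrow> (\<Sum>k\<in>I. \<bar>\<Sum>j\<in>J. U i j * U k j\<bar>) \<le> N\<^sup>2"
    and S: "S \<subseteq> I \<times> J" and x: "x * N \<le> 2 * (\<Sum>(i, j)\<in>S. U i j)"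
  shows "energy_lb (I \<union> J) (S \<union> S\<inverse>) x"
proof -
  \<comment> \<open>The symmetric matrix with off-diagonal blocks \<open>U / N\<close> and its
    transpose; its form is a contraction exactly when \<open>U / N\<close> does not increase length,
    which \<open>gram'\<close> provides.\<close>
  define B where "B u v = (if u \<in> I \<and> v \<in> J then U u v / N
    else if u \<in> J \<and> v \<in> I then U v u / N else 0)" for u v
  have form: "(\<Sum>u\<in>I \<union> J. \<Sum>v\<in>I \<union> J. B u v * (z u * z v))
      = 2 * (\<Sum>j\<in>J. z j * (\<Sum>i\<in>I. U i j * z i) / N)" for z
  proof -
    have row1: "(\<Sum>v\<in>I \<union> J. B u v * (z u * z v)) = (\<Sum>j\<in>J. U u j / N * (z u * z j))" if "u \<in> I" for u
    proof -
      have "(\<Sum>v\<in>J. B u v * (z u * z v)) = (\<Sum>j\<in>J. U u j / N * (z u * z j))"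
        by (rule sum.cong) (use that in \<open>auto simp: B_def\<close>)
      moreover have "(\<Sum>v\<in>I. B u v * (z u * z v)) = 0"
        by (rule sum.neutral) (use that disj in \<open>auto simp: B_def\<close>)
      ultimately show ?thesis using fin disj by (simp add: sum.union_disjoint)
    qed
    have row2: "(\<Sum>v\<in>I \<union> J. B u v * (z u * z v)) = (\<Sum>i\<in>I. U i u / N * (z u * z i))" if "u \<in> J" for u
    proof -
      have "(\<Sum>v\<in>I. B u v * (z u * z v)) = (\<Sum>i\<in>I. U i u / N * (z u * z i))"
        by (rule sum.cong) (use that disj in \<open>auto simp: B_def\<close>)
      moreover have "(\<Sum>v\<in>J. B u v * (z u * z v)) = 0"
        by (rule sum.neutral) (use that disj in \<open>auto simp: B_def\<close>)
      ultimately show ?thesis using fin disj by (simp add: sum.union_disjoint)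
    qed
    have "(\<Sum>u\<in>I \<union> J. \<Sum>v\<in>I \<union> J. B u v * (z u * z v))
      = (\<Sum>i\<in>I. \<Sum>j\<in>J. U i j / N * (z i * z j)) + (\<Sum>j\<in>J. \<Sum>i\<in>I. U i j / N * (z j * z i))"
      unfolding sum.union_disjoint[OF fin disj, of "\<lambda>u. \<Sum>v\<in>I \<union> J. B u v * (z u * z v)"]
      by (simp only: row1 row2 cong: sum.cong)
    also have "(\<Sum>i\<in>I. \<Sum>j\<in>J. U i j / N * (z i * z j)) = (\<Sum>j\<in>J. \<Sum>i\<in>I. U i j / N * (z i * z j))"
      by (rule sum.swap)
    finally show ?thesis
      by (simp add: sum_distrib_left sum_divide_distrib mult_ac sum.distrib[symmetric])
  qed
  \<comment> \<open>The Gram matrix \<open>G\<close> is symmetric. Each product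
    \<open>z i * z k\<close> is charged half to each of the two squares, so every square collects
    the absolute row sum of \<open>G\<close>.\<close>
  have gram': "(\<Sum>j\<in>J. (\<Sum>i\<in>I. U i j * z i)\<^sup>2) \<le> N\<^sup>2 * (\<Sum>i\<in>I. (z i)\<^sup>2)" for z
  proof -
    define G where "G i k = (\<Sum>j\<in>J. U i j * U k j)" for i k
    have "(\<Sum>j\<in>J. (\<Sum>i\<in>I. U i j * z i)\<^sup>2) = (\<Sum>j\<in>J. \<Sum>i\<in>I. \<Sum>k\<in>I. U i j * U k j * (z i * z k))"
      by (simp add: power2_eq_square sum_product mult_ac)
    also have "\<dots> = (\<Sum>i\<in>I. \<Sum>j\<in>J. \<Sum>k\<in>I. U i j * U k j * (z i * z k))" by (rule sum.swap)
    also have "\<dots> = (\<Sum>i\<in>I. \<Sum>k\<in>I. \<Sum>j\<in>J. U i j * U k j * (z i * z k))"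
      by (rule sum.cong[OF refl], rule sum.swap)
    also have "\<dots> = (\<Sum>i\<in>I. \<Sum>k\<in>I. G i k * (z i * z k))"
      by (simp add: G_def sum_distrib_right)
    also have "\<dots> \<le> (\<Sum>i\<in>I. \<Sum>k\<in>I. \<bar>G i k\<bar> * ((z i)\<^sup>2 + (z k)\<^sup>2) / 2)"
    proof (intro sum_mono)
      fix i k
      have "2 * \<bar>z i * z k\<bar> \<le> (z i)\<^sup>2 + (z k)\<^sup>2"
        using sum_squares_bound[of "\<bar>z i\<bar>" "\<bar>z k\<bar>"] by (simp add: abs_mult)
      then have "\<bar>G i k\<bar> * (2 * \<bar>z i * z k\<bar>) \<le> \<bar>G i k\<bar> * ((z i)\<^sup>2 + (z k)\<^sup>2)"
        by (rule mult_left_mono) simp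
      moreover have "G i k * (z i * z k) \<le> \<bar>G i k\<bar> * \<bar>z i * z k\<bar>"
        by (metis abs_ge_self abs_mult)
      ultimately show "G i k * (z i * z k) \<le> \<bar>G i k\<bar> * ((z i)\<^sup>2 + (z k)\<^sup>2) / 2" by simp
    qed
    also have "\<dots> = (\<Sum>i\<in>I. \<Sum>k\<in>I. \<bar>G i k\<bar> * (z i)\<^sup>2 / 2) + (\<Sum>i\<in>I. \<Sum>k\<in>I. \<bar>G i k\<bar> * (z k)\<^sup>2 / 2)"
      by (simp add: sum.distrib ring_distribs add_divide_distrib)
    also have "(\<Sum>i\<in>I. \<Sum>k\<in>I. \<bar>G i k\<bar> * (z k)\<^sup>2 / 2) = (\<Sum>k\<in>I. \<Sum>i\<in>I. \<bar>G k i\<bar> * (z k)\<^sup>2 / 2)"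
      by (subst sum.swap) (simp add: G_def mult.commute)
    also have "(\<Sum>i\<in>I. \<Sum>k\<in>I. \<bar>G i k\<bar> * (z i)\<^sup>2 / 2) + (\<Sum>k\<in>I. \<Sum>i\<in>I. \<bar>G k i\<bar> * (z k)\<^sup>2 / 2)
        = (\<Sum>i\<in>I. (\<Sum>k\<in>I. \<bar>G i k\<bar>) * (z i)\<^sup>2)"
      unfolding sum_divide_distrib[symmetric] sum_distrib_right by simp
    also have "\<dots> \<le> (\<Sum>i\<in>I. N\<^sup>2 * (z i)\<^sup>2)"
      by (intro sum_mono mult_right_mono) (use gram in \<open>auto simp: G_def\<close>)
    finally show ?thesis by (simp add: sum_distrib_left)
  qed
  have "contraction_on (I \<union> J) B"
    unfolding contraction_on_def
  proof
    fix z
    define y where "y j = (\<Sum>i\<in>I. U i j * z i) / N" for j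
    have y2: "(\<Sum>j\<in>J. (y j)\<^sup>2) \<le> (\<Sum>i\<in>I. (z i)\<^sup>2)"
      using gram'[of z] N
      by (simp add: y_def power_divide sum_divide_distrib[symmetric] divide_le_eq mult.commute)
    have "\<bar>\<Sum>u\<in>I \<union> J. \<Sum>v\<in>I \<union> J. B u v * (z u * z v)\<bar> = 2 * \<bar>\<Sum>j\<in>J. z j * y j\<bar>"
      by (simp add: form y_def abs_mult)
    also have "\<dots> \<le> (\<Sum>j\<in>J. (z j)\<^sup>2 + (y j)\<^sup>2)"
    proof -
      have "2 * \<bar>\<Sum>j\<in>J. z j * y j\<bar> \<le> (\<Sum>j\<in>J. 2 * \<bar>z j * y j\<bar>)"
        unfolding sum_distrib_left[symmetric] using sum_abs[of "\<lambda>j. z j * y j" J] by simp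
      also have "\<dots> \<le> (\<Sum>j\<in>J. (z j)\<^sup>2 + (y j)\<^sup>2)"
      proof (rule sum_mono)
        fix j
        show "2 * \<bar>z j * y j\<bar> \<le> (z j)\<^sup>2 + (y j)\<^sup>2"
          using sum_squares_bound[of "\<bar>z j\<bar>" "\<bar>y j\<bar>"] by (simp add: abs_mult)
      qed
      finally show ?thesis .
    qed
    also have "\<dots> \<le> (\<Sum>v\<in>I \<union> J. (z v)\<^sup>2)"
      using y2 fin disj by (simp add: sum.distrib sum.union_disjoint)
    finally show "\<bar>\<Sum>u\<in>I \<union> J. \<Sum>v\<in>I \<union> J. B u v * (z u * z v)\<bar> \<le> (\<Sum>v\<in>I \<union> J. (z v)\<^sup>2)" .
  qed
  moreover have "(\<Sum>(u, v)\<in>S \<union> S\<inverse>. B u v) = 2 * (\<Sum>(i, j)\<in>S. U i j) / N"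
  proof -
    have finS: "finite S" using S fin finite_subset by blast
    have "S \<inter> S\<inverse> = {}" using S disj by blast
    moreover have "(\<Sum>(u, v)\<in>S. B u v) = (\<Sum>(i, j)\<in>S. U i j / N)"
      by (rule sum.cong) (use S in \<open>auto simp: B_def\<close>)
    moreover have "(\<Sum>(u, v)\<in>S\<inverse>. B u v) = (\<Sum>(i, j)\<in>S. U i j / N)"
      by (rule sum.reindex_bij_witness[of _ prod.swap prod.swap]) (use S disj in \<open>auto simp: B_def\<close>)
    moreover have "(\<Sum>(i, j)\<in>S. U i j / N) = (\<Sum>(i, j)\<in>S. U i j) / N"
      by (simp add: sum_divide_distrib case_prod_unfold)
    ultimately show ?thesis using finS by (simp add: sum.union_disjoint)
  qed
  ultimately show ?thesis
    unfolding energy_lb_def using x N by (intro exI[of _ B]) (simp add: pos_le_divide_eq)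
qed

section \<open>Trees of maximum degree three\<close>

text \<open>
  A tree of maximum degree at most 3 is described by a vertex \<open>c\<close> and three branches at \<open>c\<close>. A branch
  is a binary tree of vertex labels, whose root is the neighbour of \<open>c\<close>; an absent branch is \<open>\<langle>\<rangle>\<close>.
\<close>

fun tree_edges :: "'a \<Rightarrow> 'a tree \<Rightarrow> ('a \<times> 'a) set" where
  "tree_edges s \<langle>\<rangle> = {}"
| "tree_edges s \<langle>l, r, q\<rangle> = {(s, r), (r, s)} \<union> tree_edges r l \<union> tree_edges r q"

definition star_verts :: "'a \<Rightarrow> 'a tree \<Rightarrow> 'a tree \<Rightarrow> 'a tree \<Rightarrow> 'a set" where
  "star_verts c X Y Z = insert c (set_tree X \<union> set_tree Y \<union> set_tree Z)"

definition star_edges :: "'a \<Rightarrow> 'a tree \<Rightarrow> 'a tree \<Rightarrow> 'a tree \<Rightarrow> ('a \<times> 'a) set" where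
  "star_edges c X Y Z = tree_edges c X \<union> tree_edges c Y \<union> tree_edges c Z"

definition star_distinct :: "'a \<Rightarrow> 'a tree \<Rightarrow> 'a tree \<Rightarrow> 'a tree \<Rightarrow> bool" where
  "star_distinct c X Y Z \<longleftrightarrow> distinct (c # preorder X @ preorder Y @ preorder Z)"

abbreviation shape :: "'a tree \<Rightarrow> unit tree" where
  "shape \<equiv> map_tree (\<lambda>_. ())"

lemma tree_edges_subset: "tree_edges s T \<subseteq> insert s (set_tree T) \<times> insert s (set_tree T)"
  by (induction s T rule: tree_edges.induct) auto

lemma star_edges_subset: "star_edges c X Y Z \<subseteq> star_verts c X Y Z \<times> star_verts c X Y Z"
  unfolding star_edges_def star_verts_def
  using tree_edges_subset[of c X] tree_edges_subset[of c Y] tree_edges_subset[of c Z] by blast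

lemma star_distinct_iff:
  "star_distinct c X Y Z \<longleftrightarrow> distinct (preorder X) \<and> distinct (preorder Y) \<and> distinct (preorder Z)
    \<and> c \<notin> set_tree X \<and> c \<notin> set_tree Y \<and> c \<notin> set_tree Z
    \<and> set_tree X \<inter> set_tree Y = {} \<and> set_tree X \<inter> set_tree Z = {} \<and> set_tree Y \<inter> set_tree Z = {}"
  unfolding star_distinct_def by auto

lemma star_swap12:
  "star_verts c X Y Z = star_verts c Y X Z" "star_edges c X Y Z = star_edges c Y X Z"
  "star_distinct c X Y Z \<longleftrightarrow> star_distinct c Y X Z"
  by (auto simp: star_verts_def star_edges_def star_distinct_iff)

lemma star_swap23:
  "star_verts c X Y Z = star_verts c X Z Y" "star_edges c X Y Z = star_edges c X Z Y"
  "star_distinct c X Y Z \<longleftrightarrow> star_distinct c X Z Y"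
  by (auto simp: star_verts_def star_edges_def star_distinct_iff)

text \<open>One step of the centre along an edge. The old centre becomes the root of a branch with
  its other two branches as children, which fits a binary tree because no vertex has more than three
  neighbours.\<close>

lemma star_rotate:
  "star_verts c \<langle>P, r, Q\<rangle> Y Z = star_verts r P Q \<langle>Y, c, Z\<rangle>"
  "star_edges c \<langle>P, r, Q\<rangle> Y Z = star_edges r P Q \<langle>Y, c, Z\<rangle>"
  "star_distinct c \<langle>P, r, Q\<rangle> Y Z \<longleftrightarrow> star_distinct r P Q \<langle>Y, c, Z\<rangle>"
  by (auto simp: star_verts_def star_edges_def star_distinct_iff)

lemma card_star_verts:
  assumes "star_distinct c X Y Z"
  shows "card (star_verts c X Y Z) = size X + size Y + size Z + 1"
proof -
  have "star_verts c X Y Z = set (c # preorder X @ preorder Y @ preorder Z)"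
    by (simp add: star_verts_def Un_assoc)
  then show ?thesis using distinct_card[of "c # preorder X @ preorder Y @ preorder Z"] assms
    by (simp add: star_distinct_def)
qed

lemma energy_lb_split_star:
  assumes d: "star_distinct c X Y \<langle>P, r, Q\<rangle>"
    and x: "energy_lb (star_verts c X Y \<langle>\<rangle>) (star_edges c X Y \<langle>\<rangle>) x"
    and y: "energy_lb (star_verts r P Q \<langle>\<rangle>) (star_edges r P Q \<langle>\<rangle>) y"
  shows "energy_lb (star_verts c X Y \<langle>P, r, Q\<rangle>) (star_edges c X Y \<langle>P, r, Q\<rangle>) (x + y)"
proof -
  have "energy_lb (star_verts c X Y \<langle>\<rangle> \<union> star_verts r P Q \<langle>\<rangle>)
      (star_edges c X Y \<langle>\<rangle> \<union> star_edges r P Q \<langle>\<rangle> \<union> {(c, r), (r, c)}) (x + y)"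
    by (rule energy_lb_Un[OF _ _ _ _ star_edges_subset star_edges_subset _ x y])
      (use d in \<open>auto simp: star_verts_def star_distinct_iff\<close>)
  moreover have "star_verts c X Y \<langle>\<rangle> \<union> star_verts r P Q \<langle>\<rangle> = star_verts c X Y \<langle>P, r, Q\<rangle>"
    by (auto simp: star_verts_def)
  moreover have "star_edges c X Y \<langle>\<rangle> \<union> star_edges r P Q \<langle>\<rangle> \<union> {(c, r), (r, c)}
      = star_edges c X Y \<langle>P, r, Q\<rangle>"
    by (auto simp: star_edges_def)
  ultimately show ?thesis by simp
qed

text \<open>Quantifying over all labellings turns bounds into statements on shapes, so later rules
  combine them without tracking labels or disjointness.\<close>

definition star_lb :: "unit tree \<Rightarrow> unit tree \<Rightarrow> unit tree \<Rightarrow> real \<Rightarrow> bool" where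
  "star_lb X Y Z x \<longleftrightarrow> (\<forall>(c :: nat) X' Y' Z'. shape X' = X \<longrightarrow> shape Y' = Y \<longrightarrow> shape Z' = Z
    \<longrightarrow> star_distinct c X' Y' Z' \<longrightarrow> energy_lb (star_verts c X' Y' Z') (star_edges c X' Y' Z') x)"

lemma star_lbD:
  assumes "star_lb (shape X) (shape Y) (shape Z) x" "star_distinct (c :: nat) X Y Z"
  shows "energy_lb (star_verts c X Y Z) (star_edges c X Y Z) x"
  using assms unfolding star_lb_def by blast

lemma star_lb_mono: "star_lb X Y Z x \<Longrightarrow> y \<le> x \<Longrightarrow> star_lb X Y Z y"
  unfolding star_lb_def using energy_lb_mono by blast

lemma star_lb_swap12: "star_lb X Y Z x \<Longrightarrow> star_lb Y X Z x"
  unfolding star_lb_def using star_swap12 by metis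

lemma star_lb_swap23: "star_lb X Y Z x \<Longrightarrow> star_lb X Z Y x"
  unfolding star_lb_def using star_swap23 by metis

lemma shape_eq_Node_iff:
  "shape T = \<langle>l, u, q\<rangle> \<longleftrightarrow> (\<exists>l' a q'. T = \<langle>l', a, q'\<rangle> \<and> shape l' = l \<and> shape q' = q)"
  by (cases T) auto

lemma star_lb_rotate: "star_lb P Q \<langle>Y, (), Z\<rangle> x \<Longrightarrow> star_lb \<langle>P, (), Q\<rangle> Y Z x"
  unfolding star_lb_def
proof (intro allI impI)
  fix c :: nat and X' Y' Z'
  assume *: "\<forall>(c :: nat) X' Y' Z'. shape X' = P \<longrightarrow> shape Y' = Q \<longrightarrow> shape Z' = \<langle>Y, (), Z\<rangle> \<longrightarrow>
      star_distinct c X' Y' Z' \<longrightarrow> energy_lb (star_verts c X' Y' Z') (star_edges c X' Y' Z') x"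
    and sh: "shape X' = \<langle>P, (), Q\<rangle>" "shape Y' = Y" "shape Z' = Z"
    and d: "star_distinct c X' Y' Z'"
  from sh(1) obtain P' r Q' where X': "X' = \<langle>P', r, Q'\<rangle>" "shape P' = P" "shape Q' = Q"
    unfolding shape_eq_Node_iff by blast
  show "energy_lb (star_verts c X' Y' Z') (star_edges c X' Y' Z') x"
    using *[rule_format, of P' Q' "\<langle>Y', c, Z'\<rangle>" r] X' sh d by (simp add: star_rotate)
qed

lemma star_lb_split:
  assumes "star_lb X Y \<langle>\<rangle> x" "star_lb P Q \<langle>\<rangle> y"
  shows "star_lb X Y \<langle>P, (), Q\<rangle> (x + y)"
  unfolding star_lb_def
proof (intro allI impI)
  fix c :: nat and X' Y' Z'
  assume sh: "shape X' = X" "shape Y' = Y" "shape Z' = \<langle>P, (), Q\<rangle>"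
    and d: "star_distinct c X' Y' Z'"
  from sh(3) obtain P' r Q' where Z': "Z' = \<langle>P', r, Q'\<rangle>" "shape P' = P" "shape Q' = Q"
    unfolding shape_eq_Node_iff by blast
  have "star_distinct c X' Y' \<langle>\<rangle>" "star_distinct r P' Q' \<langle>\<rangle>"
    using d unfolding Z' star_distinct_iff by auto
  then show "energy_lb (star_verts c X' Y' Z') (star_edges c X' Y' Z') (x + y)"
    unfolding Z'(1) using assms sh Z' d
    by (intro energy_lb_split_star star_lbD) auto
qed

text \<open>Equal shapes give left subtrees of equal size, so the concatenated preorder lists split
  at the same place. This lets \<open>star_relabel\<close> identify a tree with a relabelled copy
  from its label list alone.\<close>

lemma tree_eqI:
  "shape T = shape T' \<Longrightarrow> preorder T = preorder T' \<Longrightarrow> T = T'"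
proof (induction T arbitrary: T')
  case (Node l a q)
  then obtain l' a' q' where T': "T' = \<langle>l', a', q'\<rangle>" "shape l = shape l'" "shape q = shape q'"
    by (cases T') auto
  then have "length (preorder l) = length (preorder l')"
    by (metis length_preorder size_map_tree)
  then show ?case using Node T' by auto
qed (cases; simp)

lemma preorder_map_tree: "preorder (map_tree f T) = map f (preorder T)"
  by (induction T) auto

lemma tree_edges_map_tree: "tree_edges (f s) (map_tree f T) = map_prod f f ` tree_edges s T"
  by (induction s T rule: tree_edges.induct) auto

text \<open>The map \<open>f\<close> matches the two label lists position by position; it is a
  bijection since both lists are distinct.\<close>

lemma star_relabel:
  assumes d: "star_distinct c X Y Z" and d': "star_distinct c' X' Y' Z'"
    and sh: "shape X' = shape X" "shape Y' = shape Y" "shape Z' = shape Z"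
  shows "\<exists>f. bij_betw f (star_verts c X Y Z) (star_verts c' X' Y' Z')
    \<and> map_prod f f ` star_edges c X Y Z = star_edges c' X' Y' Z'"
proof -
  define vs where "vs = c # preorder X @ preorder Y @ preorder Z"
  define xs where "xs = c' # preorder X' @ preorder Y' @ preorder Z'"
  define f where "f v = the (map_of (zip vs xs) v)" for v
  have sz: "size X' = size X" "size Y' = size Y" "size Z' = size Z"
    using sh by (metis size_map_tree)+
  have len: "length vs = length xs" by (simp add: vs_def xs_def sz)
  have dist: "distinct vs" "distinct xs"
    using d d' by (simp_all add: vs_def xs_def star_distinct_def)
  have map: "map f vs = xs"
    by (rule nth_equalityI) (use len dist in \<open>auto simp: f_def map_of_zip_nth\<close>)
  then have f0: "f c = c'" and pre: "map f (preorder X) = preorder X'"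
    "map f (preorder Y) = preorder Y'" "map f (preorder Z) = preorder Z'"
    using sz by (auto simp: vs_def xs_def append_eq_append_conv)
  have maps: "X' = map_tree f X" "Y' = map_tree f Y" "Z' = map_tree f Z"
    by (rule tree_eqI; simp add: sh preorder_map_tree pre tree.map_comp o_def)+
  have V: "star_verts c X Y Z = set vs"
    by (simp add: vs_def star_verts_def Un_assoc)
  have "inj_on f (star_verts c X Y Z)"
    unfolding V using map dist by (metis distinct_map)
  moreover have "f ` star_verts c X Y Z = star_verts c' X' Y' Z'"
    by (simp add: star_verts_def maps f0 tree.set_map image_Un)
  moreover have "map_prod f f ` star_edges c X Y Z = star_edges c' X' Y' Z'"
    by (simp add: star_edges_def maps f0[symmetric] tree_edges_map_tree image_Un)
  ultimately show ?thesis by (auto simp: bij_betw_def)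
qed

text \<open>A single labelled tree decides a shape: its certificate is transported along the
  bijection of \<open>star_relabel\<close>.\<close>

lemma star_lb_of_instance:
  fixes X Y Z :: "nat tree"
  assumes d: "star_distinct c X Y Z"
    and lb: "energy_lb (star_verts c X Y Z) (star_edges c X Y Z) x"
  shows "star_lb (shape X) (shape Y) (shape Z) x"
  unfolding star_lb_def
proof (intro allI impI)
  fix c' :: nat and X' Y' Z'
  assume "shape X' = shape X" "shape Y' = shape Y" "shape Z' = shape Z"
    and "star_distinct c' X' Y' Z'"
  from star_relabel[OF d this(4,1,2,3)] obtain f where
    f: "bij_betw f (star_verts c X Y Z) (star_verts c' X' Y' Z')"
      "map_prod f f ` star_edges c X Y Z = star_edges c' X' Y' Z'" by blast
  then show "energy_lb (star_verts c' X' Y' Z') (star_edges c' X' Y' Z') x"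
    using energy_lb_image[OF _ star_edges_subset lb, of f] by (simp add: bij_betw_def)
qed

section \<open>Lower bounds for small trees\<close>

text \<open>
  In the names \<open>star_lb_XYZ\<close> below the letter \<open>N\<close> stands for an absent branch. The other shapes are the
  branches that form an exceptional tree: \<open>L\<close> is a single vertex; \<open>P\<close> and \<open>E\<close> are the path with 3 vertices, entered
  at its centre and at an end; \<open>B\<close> and \<open>D\<close> are the complete binary tree with 7 vertices, entered at
  its root and at a leaf; \<open>S\<close> is the star with 4 vertices, entered at a leaf.
\<close>

abbreviation "sL \<equiv> \<langle>\<langle>\<rangle>, (), \<langle>\<rangle>\<rangle>"
abbreviation "sP \<equiv> \<langle>sL, (), sL\<rangle>"
abbreviation "sS \<equiv> \<langle>sP, (), \<langle>\<rangle>\<rangle>"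
abbreviation "sB \<equiv> \<langle>sP, (), sP\<rangle>"
abbreviation "sE \<equiv> \<langle>\<langle>sL, (), \<langle>\<rangle>\<rangle>, (), \<langle>\<rangle>\<rangle>"
abbreviation "sD \<equiv> \<langle>\<langle>sS, (), sL\<rangle>, (), \<langle>\<rangle>\<rangle>"

text \<open>A list form of \<open>energy_lb_gram\<close> that evaluates by simplification.
  \<open>I\<close> and \<open>J\<close> are the colour classes of the tree and \<open>S\<close>
  lists its edges oriented from \<open>I\<close> to \<open>J\<close>. Rows are addressed by vertex
  label, so positions belonging to \<open>I\<close> are mere padding and hold 0.\<close>

lemma star_lb_certificate:
  fixes X Y Z :: "nat tree" and M :: "(nat \<times> real list) list" and N :: real
  defines "U \<equiv> \<lambda>i. the (map_of M i)"
  assumes d: "star_distinct c X Y Z"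
    and V: "star_verts c X Y Z = set (I @ J)" and IJ: "distinct (I @ J)"
    and N: "N > 0"
    and gram: "list_all (\<lambda>i. (\<Sum>k\<leftarrow>I. \<bar>\<Sum>j\<leftarrow>J. U i ! j * U k ! j\<bar>) \<le> N\<^sup>2) I"
    and S: "list_all (\<lambda>(i, j). i \<in> set I \<and> j \<in> set J) S" "distinct S"
    and edges: "star_edges c X Y Z = set (S @ map (\<lambda>(u, v). (v, u)) S)"
    and x: "x * N \<le> 2 * (\<Sum>(i, j)\<leftarrow>S. U i ! j)"
  shows "star_lb (shape X) (shape Y) (shape Z) x"
proof (rule star_lb_of_instance[OF d])
  have R: "set (S @ map (\<lambda>(u, v). (v, u)) S) = set S \<union> (set S)\<inverse>" by force
  show "energy_lb (star_verts c X Y Z) (star_edges c X Y Z) x"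
    unfolding V edges R unfolding set_append
  proof (rule energy_lb_gram[OF _ _ _ N])
    show "(\<Sum>k\<in>set I. \<bar>\<Sum>j\<in>set J. U i ! j * U k ! j\<bar>) \<le> N\<^sup>2" if "i \<in> set I" for i
      using gram IJ that by (simp add: list_all_iff sum.distinct_set_conv_list)
    show "x * N \<le> 2 * (\<Sum>(i, j)\<in>set S. U i ! j)"
      using x S(2) by (simp add: sum.distinct_set_conv_list)
  qed (use IJ S(1) in \<open>auto simp: list_all_iff\<close>)
qed

lemmas certificate_simps = star_distinct_def star_verts_def star_edges_def insert_commute

text \<open>
  The entries of \<open>M\<close> are found numerically: \<open>M\<close> is approximately \<open>N\<close> times the polar factor of the block of the
  adjacency matrix with rows \<open>I\<close> and columns \<open>J\<close>.
\<close>

lemma star_lb_NNL: "star_lb \<langle>\<rangle> \<langle>\<rangle> sL 2"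
  using star_lb_certificate[where X = "\<langle>\<rangle>" and Y = "\<langle>\<rangle>" and Z = "\<langle>\<langle>\<rangle>, 1, \<langle>\<rangle>\<rangle>"
      and c = 0 and N = 1 and I = "[0]" and J = "[1]" and S = "[(0, 1)]" and x = "2"
      and M = "[(0, [0, 1])]"]
  by (simp add: certificate_simps)

lemma star_lb_NNS: "star_lb \<langle>\<rangle> \<langle>\<rangle> sS (518 / 100)"
  using star_lb_certificate[where X = "\<langle>\<rangle>" and Y = "\<langle>\<rangle>" and Z = "\<langle>\<langle>\<langle>\<langle>\<rangle>, 3, \<langle>\<rangle>\<rangle>, 2, \<langle>\<langle>\<rangle>, 4, \<langle>\<rangle>\<rangle>\<rangle>, 1, \<langle>\<rangle>\<rangle>"
      and c = 0 and N = 37 and I = "[0, 2]" and J = "[1, 3, 4]" and S = "[(0, 1), (2, 1), (2, 3), (2, 4)]" and x = "518 / 100"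
      and M = "[(0, [0, 34, 0, -10, -10]),
        (2, [0, 14, 0, 24, 24])]"]
  by (simp add: certificate_simps)

lemma star_lb_NLP: "star_lb \<langle>\<rangle> sL sP (518 / 100)"
  using star_lb_certificate[where X = "\<langle>\<rangle>" and Y = "\<langle>\<langle>\<rangle>, 1, \<langle>\<rangle>\<rangle>" and Z = "\<langle>\<langle>\<langle>\<rangle>, 3, \<langle>\<rangle>\<rangle>, 2, \<langle>\<langle>\<rangle>, 4, \<langle>\<rangle>\<rangle>\<rangle>"
      and c = 0 and N = 37 and I = "[1, 2]" and J = "[0, 3, 4]" and S = "[(1, 0), (2, 0), (2, 3), (2, 4)]" and x = "518 / 100"
      and M = "[(1, [34, 0, 0, -10, -10]),
        (2, [14, 0, 0, 24, 24])]"]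
  by (simp add: certificate_simps)

lemma star_lb_NLS: "star_lb \<langle>\<rangle> sL sS 6"
  using star_lb_certificate[where X = "\<langle>\<rangle>" and Y = "\<langle>\<langle>\<rangle>, 1, \<langle>\<rangle>\<rangle>" and Z = "\<langle>\<langle>\<langle>\<langle>\<rangle>, 4, \<langle>\<rangle>\<rangle>, 3, \<langle>\<langle>\<rangle>, 5, \<langle>\<rangle>\<rangle>\<rangle>, 2, \<langle>\<rangle>\<rangle>"
      and c = 0 and N = 12 and I = "[0, 3]" and J = "[1, 2, 4, 5]" and S = "[(0, 1), (0, 2), (3, 2), (3, 4), (3, 5)]" and x = "6"
      and M = "[(0, [0, 9, 7, 0, -2, -2]),
        (3, [0, -2, 6, 0, 7, 7])]"]
  by (simp add: certificate_simps)

lemma star_lb_LLP: "star_lb sL sL sP 6"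
  using star_lb_certificate[where X = "\<langle>\<langle>\<rangle>, 1, \<langle>\<rangle>\<rangle>" and Y = "\<langle>\<langle>\<rangle>, 2, \<langle>\<rangle>\<rangle>" and Z = "\<langle>\<langle>\<langle>\<rangle>, 4, \<langle>\<rangle>\<rangle>, 3, \<langle>\<langle>\<rangle>, 5, \<langle>\<rangle>\<rangle>\<rangle>"
      and c = 0 and N = 6 and I = "[0, 4, 5]" and J = "[1, 2, 3]" and S = "[(0, 1), (0, 2), (0, 3), (4, 3), (5, 3)]" and x = "6"
      and M = "[(0, [0, 4, 4, 2, 0, 0]),
        (4, [0, -1, -1, 4, 0, 0]),
        (5, [0, -1, -1, 4, 0, 0])]"]
  by (simp add: certificate_simps)

text \<open>The surplus 36/100 over the 8 vertices pays for two later cuts at 18/100 each, as in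
  \<open>star_lb_NPB\<close> followed by \<open>star_lb_PBB\<close>, or \<open>star_lb_NBB\<close>
  followed by \<open>star_lb_BBB\<close>.\<close>

lemma star_lb_NNB: "star_lb \<langle>\<rangle> \<langle>\<rangle> sB (836 / 100)"
  using star_lb_certificate[where X = "\<langle>\<rangle>" and Y = "\<langle>\<rangle>" and Z = "\<langle>\<langle>\<langle>\<langle>\<rangle>, 3, \<langle>\<rangle>\<rangle>, 2, \<langle>\<langle>\<rangle>, 4, \<langle>\<rangle>\<rangle>\<rangle>, 1, \<langle>\<langle>\<langle>\<rangle>, 6, \<langle>\<rangle>\<rangle>, 5, \<langle>\<langle>\<rangle>, 7, \<langle>\<rangle>\<rangle>\<rangle>\<rangle>"
      and c = 0 and N = 75 and I = "[1, 3, 4, 6, 7]" and J = "[0, 2, 5]" and S = "[(1, 0), (1, 2), (3, 2), (4, 2), (1, 5), (6, 5), (7, 5)]" and x = "836 / 100"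
      and M = "[(1, [64, 0, 27, 0, 0, 27, 0, 0]),
        (3, [-19, 0, 49, 0, 0, -4, 0, 0]),
        (4, [-19, 0, 49, 0, 0, -4, 0, 0]),
        (6, [-19, 0, -4, 0, 0, 49, 0, 0]),
        (7, [-19, 0, -4, 0, 0, 49, 0, 0])]"]
  by (simp add: certificate_simps)

lemma star_lb_LPP: "star_lb sL sP sP 8"
  using star_lb_certificate[where X = "\<langle>\<langle>\<rangle>, 1, \<langle>\<rangle>\<rangle>" and Y = "\<langle>\<langle>\<langle>\<rangle>, 3, \<langle>\<rangle>\<rangle>, 2, \<langle>\<langle>\<rangle>, 4, \<langle>\<rangle>\<rangle>\<rangle>" and Z = "\<langle>\<langle>\<langle>\<rangle>, 6, \<langle>\<rangle>\<rangle>, 5, \<langle>\<langle>\<rangle>, 7, \<langle>\<rangle>\<rangle>\<rangle>"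
      and c = 0 and N = 19 and I = "[1, 2, 5]" and J = "[0, 3, 4, 6, 7]" and S = "[(1, 0), (2, 0), (2, 3), (2, 4), (5, 0), (5, 6), (5, 7)]" and x = "8"
      and M = "[(1, [16, 0, 0, -5, -5, 0, -5, -5]),
        (2, [7, 0, 0, 12, 12, 0, -1, -1]),
        (5, [7, 0, 0, -1, -1, 0, 12, 12])]"]
  by (simp add: certificate_simps)

lemma star_lb_NPS: "star_lb \<langle>\<rangle> sP sS (818 / 100)"
  using star_lb_certificate[where X = "\<langle>\<rangle>" and Y = "\<langle>\<langle>\<langle>\<rangle>, 2, \<langle>\<rangle>\<rangle>, 1, \<langle>\<langle>\<rangle>, 3, \<langle>\<rangle>\<rangle>\<rangle>" and Z = "\<langle>\<langle>\<langle>\<langle>\<rangle>, 6, \<langle>\<rangle>\<rangle>, 5, \<langle>\<langle>\<rangle>, 7, \<langle>\<rangle>\<rangle>\<rangle>, 4, \<langle>\<rangle>\<rangle>"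
      and c = 0 and N = 27 and I = "[0, 2, 3, 5]" and J = "[1, 4, 6, 7]" and S = "[(0, 1), (2, 1), (3, 1), (0, 4), (5, 4), (5, 6), (5, 7)]" and x = "818 / 100"
      and M = "[(0, [0, 11, 0, 0, 22, 0, -7, -7]),
        (2, [0, 17, 0, 0, -7, 0, 3, 3]),
        (3, [0, 17, 0, 0, -7, 0, 3, 3]),
        (5, [0, -1, 0, 0, 11, 0, 17, 17])]"]
  by (simp add: certificate_simps)

lemma star_lb_NSS: "star_lb \<langle>\<rangle> sS sS (918 / 100)"
  using star_lb_certificate[where X = "\<langle>\<rangle>" and Y = "\<langle>\<langle>\<langle>\<langle>\<rangle>, 3, \<langle>\<rangle>\<rangle>, 2, \<langle>\<langle>\<rangle>, 4, \<langle>\<rangle>\<rangle>\<rangle>, 1, \<langle>\<rangle>\<rangle>" and Z = "\<langle>\<langle>\<langle>\<langle>\<rangle>, 7, \<langle>\<rangle>\<rangle>, 6, \<langle>\<langle>\<rangle>, 8, \<langle>\<rangle>\<rangle>\<rangle>, 5, \<langle>\<rangle>\<rangle>"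
      and c = 0 and N = 18 and I = "[0, 2, 6]" and J = "[1, 3, 4, 5, 7, 8]" and S = "[(0, 1), (2, 1), (2, 3), (2, 4), (0, 5), (6, 5), (6, 7), (6, 8)]" and x = "918 / 100"
      and M = "[(0, [0, 12, 0, -3, -3, 12, 0, -3, -3]),
        (2, [0, 8, 0, 11, 11, -2, 0, 1, 1]),
        (6, [0, -2, 0, 1, 1, 8, 0, 11, 11])]"]
  by (simp add: certificate_simps)

lemma star_lb_NLB: "star_lb \<langle>\<rangle> sL sB (936 / 100)"
  using star_lb_certificate[where X = "\<langle>\<rangle>" and Y = "\<langle>\<langle>\<rangle>, 1, \<langle>\<rangle>\<rangle>" and Z = "\<langle>\<langle>\<langle>\<langle>\<rangle>, 4, \<langle>\<rangle>\<rangle>, 3, \<langle>\<langle>\<rangle>, 5, \<langle>\<rangle>\<rangle>\<rangle>, 2, \<langle>\<langle>\<langle>\<rangle>, 7, \<langle>\<rangle>\<rangle>, 6, \<langle>\<langle>\<rangle>, 8, \<langle>\<rangle>\<rangle>\<rangle>\<rangle>"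
      and c = 0 and N = 67 and I = "[0, 3, 6]" and J = "[1, 2, 4, 5, 7, 8]" and S = "[(0, 1), (0, 2), (3, 2), (3, 4), (3, 5), (6, 2), (6, 7), (6, 8)]" and x = "936 / 100"
      and M = "[(0, [0, 53, 37, 0, -8, -8, 0, -8, -8]),
        (3, [0, -8, 28, 0, 42, 42, 0, -5, -5]),
        (6, [0, -8, 28, 0, -5, -5, 0, 42, 42])]"]
  by (simp add: certificate_simps)

lemma star_lb_LPS: "star_lb sL sP sS 9"
  using star_lb_certificate[where X = "\<langle>\<langle>\<rangle>, 1, \<langle>\<rangle>\<rangle>" and Y = "\<langle>\<langle>\<langle>\<rangle>, 3, \<langle>\<rangle>\<rangle>, 2, \<langle>\<langle>\<rangle>, 4, \<langle>\<rangle>\<rangle>\<rangle>" and Z = "\<langle>\<langle>\<langle>\<langle>\<rangle>, 7, \<langle>\<rangle>\<rangle>, 6, \<langle>\<langle>\<rangle>, 8, \<langle>\<rangle>\<rangle>\<rangle>, 5, \<langle>\<rangle>\<rangle>"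
      and c = 0 and N = 37 and I = "[0, 3, 4, 6]" and J = "[1, 2, 5, 7, 8]" and S = "[(0, 1), (0, 2), (3, 2), (4, 2), (0, 5), (6, 5), (6, 7), (6, 8)]" and x = "9"
      and M = "[(0, [0, 26, 12, 0, 0, 21, 0, -5, -5]),
        (3, [0, -7, 24, 0, 0, -5, 0, 2, 2]),
        (4, [0, -7, 24, 0, 0, -5, 0, 2, 2]),
        (6, [0, -5, -1, 0, 0, 17, 0, 22, 22])]"]
  by (simp add: certificate_simps)

lemma star_lb_LLB: "star_lb sL sL sB 10"
  using star_lb_certificate[where X = "\<langle>\<langle>\<rangle>, 1, \<langle>\<rangle>\<rangle>" and Y = "\<langle>\<langle>\<rangle>, 2, \<langle>\<rangle>\<rangle>" and Z = "\<langle>\<langle>\<langle>\<langle>\<rangle>, 5, \<langle>\<rangle>\<rangle>, 4, \<langle>\<langle>\<rangle>, 6, \<langle>\<rangle>\<rangle>\<rangle>, 3, \<langle>\<langle>\<langle>\<rangle>, 8, \<langle>\<rangle>\<rangle>, 7, \<langle>\<langle>\<rangle>, 9, \<langle>\<rangle>\<rangle>\<rangle>\<rangle>"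
      and c = 0 and N = 33 and I = "[0, 4, 7]" and J = "[1, 2, 3, 5, 6, 8, 9]" and S = "[(0, 1), (0, 2), (0, 3), (4, 3), (4, 5), (4, 6), (7, 3), (7, 8), (7, 9)]" and x = "10"
      and M = "[(0, [0, 20, 20, 15, 0, -3, -3, 0, -3, -3]),
        (4, [0, -3, -3, 15, 0, 20, 20, 0, -3, -3]),
        (7, [0, -3, -3, 15, 0, -3, -3, 0, 20, 20])]"]
  by (simp add: certificate_simps)

lemma star_lb_LSS: "star_lb sL sS sS (1018 / 100)"
  using star_lb_certificate[where X = "\<langle>\<langle>\<rangle>, 1, \<langle>\<rangle>\<rangle>" and Y = "\<langle>\<langle>\<langle>\<langle>\<rangle>, 4, \<langle>\<rangle>\<rangle>, 3, \<langle>\<langle>\<rangle>, 5, \<langle>\<rangle>\<rangle>\<rangle>, 2, \<langle>\<rangle>\<rangle>" and Z = "\<langle>\<langle>\<langle>\<langle>\<rangle>, 8, \<langle>\<rangle>\<rangle>, 7, \<langle>\<langle>\<rangle>, 9, \<langle>\<rangle>\<rangle>\<rangle>, 6, \<langle>\<rangle>\<rangle>"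
      and c = 0 and N = 934 and I = "[0, 3, 7]" and J = "[1, 2, 4, 5, 6, 8, 9]" and S = "[(0, 1), (0, 2), (3, 2), (3, 4), (3, 5), (0, 6), (7, 6), (7, 8), (7, 9)]" and x = "1018 / 100"
      and M = "[(0, [0, 593, 488, 0, -105, -105, 488, 0, -105, -105]),
        (3, [0, -105, 461, 0, 566, 566, -78, 0, 27, 27]),
        (7, [0, -105, -78, 0, 27, 27, 461, 0, 566, 566])]"]
  by (simp add: certificate_simps)

lemma star_lb_PPP: "star_lb sP sP sP 10"
  using star_lb_certificate[where X = "\<langle>\<langle>\<langle>\<rangle>, 2, \<langle>\<rangle>\<rangle>, 1, \<langle>\<langle>\<rangle>, 3, \<langle>\<rangle>\<rangle>\<rangle>" and Y = "\<langle>\<langle>\<langle>\<rangle>, 5, \<langle>\<rangle>\<rangle>, 4, \<langle>\<langle>\<rangle>, 6, \<langle>\<rangle>\<rangle>\<rangle>" and Z = "\<langle>\<langle>\<langle>\<rangle>, 8, \<langle>\<rangle>\<rangle>, 7, \<langle>\<langle>\<rangle>, 9, \<langle>\<rangle>\<rangle>\<rangle>"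
      and c = 0 and N = 33 and I = "[1, 4, 7]" and J = "[0, 2, 3, 5, 6, 8, 9]" and S = "[(1, 0), (1, 2), (1, 3), (4, 0), (4, 5), (4, 6), (7, 0), (7, 8), (7, 9)]" and x = "10"
      and M = "[(1, [15, 0, 20, 20, 0, -3, -3, 0, -3, -3]),
        (4, [15, 0, -3, -3, 0, 20, 20, 0, -3, -3]),
        (7, [15, 0, -3, -3, 0, -3, -3, 0, 20, 20])]"]
  by (simp add: certificate_simps)

lemma star_lb_NLE: "star_lb \<langle>\<rangle> sL sE 5"
  using star_lb_certificate[where X = "\<langle>\<rangle>" and Y = "\<langle>\<langle>\<rangle>, 1, \<langle>\<rangle>\<rangle>" and Z = "\<langle>\<langle>\<langle>\<langle>\<rangle>, 4, \<langle>\<rangle>\<rangle>, 3, \<langle>\<rangle>\<rangle>, 2, \<langle>\<rangle>\<rangle>"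
      and c = 0 and N = 3 and I = "[0, 3]" and J = "[1, 2, 4]" and S = "[(0, 1), (0, 2), (3, 2), (3, 4)]" and x = "5"
      and M = "[(0, [0, 2, 2, 0, -1]),
        (3, [0, -1, 2, 0, 2])]"]
  by (simp add: certificate_simps)

lemma star_lb_LLE: "star_lb sL sL sE 6"
  using star_lb_certificate[where X = "\<langle>\<langle>\<rangle>, 1, \<langle>\<rangle>\<rangle>" and Y = "\<langle>\<langle>\<rangle>, 2, \<langle>\<rangle>\<rangle>" and Z = "\<langle>\<langle>\<langle>\<langle>\<rangle>, 5, \<langle>\<rangle>\<rangle>, 4, \<langle>\<rangle>\<rangle>, 3, \<langle>\<rangle>\<rangle>"
      and c = 0 and N = 12 and I = "[0, 4]" and J = "[1, 2, 3, 5]" and S = "[(0, 1), (0, 2), (0, 3), (4, 3), (4, 5)]" and x = "6"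
      and M = "[(0, [0, 7, 7, 6, 0, -2]),
        (4, [0, -2, -2, 7, 0, 9])]"]
  by (simp add: certificate_simps)

lemma star_lb_LSE: "star_lb sL sS sE 9"
  using star_lb_certificate[where X = "\<langle>\<langle>\<rangle>, 1, \<langle>\<rangle>\<rangle>" and Y = "\<langle>\<langle>\<langle>\<langle>\<rangle>, 4, \<langle>\<rangle>\<rangle>, 3, \<langle>\<langle>\<rangle>, 5, \<langle>\<rangle>\<rangle>\<rangle>, 2, \<langle>\<rangle>\<rangle>" and Z = "\<langle>\<langle>\<langle>\<langle>\<rangle>, 8, \<langle>\<rangle>\<rangle>, 7, \<langle>\<rangle>\<rangle>, 6, \<langle>\<rangle>\<rangle>"
      and c = 0 and N = 19 and I = "[0, 3, 7]" and J = "[1, 2, 4, 5, 6, 8]" and S = "[(0, 1), (0, 2), (3, 2), (3, 4), (3, 5), (0, 6), (7, 6), (7, 8)]" and x = "9"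
      and M = "[(0, [0, 12, 10, 0, -2, -2, 9, 0, -3]),
        (3, [0, -2, 9, 0, 11, 11, -1, 0, 1]),
        (7, [0, -3, -2, 0, 1, 1, 11, 0, 14])]"]
  by (simp add: certificate_simps)

lemma star_lb_NLD: "star_lb \<langle>\<rangle> sL sD 9"
  using star_lb_certificate[where X = "\<langle>\<rangle>" and Y = "\<langle>\<langle>\<rangle>, 1, \<langle>\<rangle>\<rangle>" and Z = "\<langle>\<langle>\<langle>\<langle>\<langle>\<langle>\<rangle>, 6, \<langle>\<rangle>\<rangle>, 5, \<langle>\<langle>\<rangle>, 7, \<langle>\<rangle>\<rangle>\<rangle>, 4, \<langle>\<rangle>\<rangle>, 3, \<langle>\<langle>\<rangle>, 8, \<langle>\<rangle>\<rangle>\<rangle>, 2, \<langle>\<rangle>\<rangle>"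
      and c = 0 and N = 19 and I = "[0, 3, 5]" and J = "[1, 2, 4, 6, 7, 8]" and S = "[(0, 1), (0, 2), (3, 2), (3, 4), (5, 4), (5, 6), (5, 7), (3, 8)]" and x = "9"
      and M = "[(0, [0, 14, 11, 0, -2, 0, 1, 1, -3]),
        (3, [0, -3, 9, 0, 10, 0, -2, -2, 12]),
        (5, [0, 1, -1, 0, 9, 0, 11, 11, -2])]"]
  by (simp add: certificate_simps)

lemma star_lb_LLD: "star_lb sL sL sD 10"
  using star_lb_certificate[where X = "\<langle>\<langle>\<rangle>, 1, \<langle>\<rangle>\<rangle>" and Y = "\<langle>\<langle>\<rangle>, 2, \<langle>\<rangle>\<rangle>" and Z = "\<langle>\<langle>\<langle>\<langle>\<langle>\<langle>\<rangle>, 7, \<langle>\<rangle>\<rangle>, 6, \<langle>\<langle>\<rangle>, 8, \<langle>\<rangle>\<rangle>\<rangle>, 5, \<langle>\<rangle>\<rangle>, 4, \<langle>\<langle>\<rangle>, 9, \<langle>\<rangle>\<rangle>\<rangle>, 3, \<langle>\<rangle>\<rangle>"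
      and c = 0 and N = 27 and I = "[0, 4, 6]" and J = "[1, 2, 3, 5, 7, 8, 9]" and S = "[(0, 1), (0, 2), (0, 3), (4, 3), (4, 5), (6, 5), (6, 7), (6, 8), (4, 9)]" and x = "10"
      and M = "[(0, [0, 16, 16, 13, 0, -2, 0, 1, 1, -3]),
        (4, [0, -3, -3, 14, 0, 14, 0, -3, -3, 17]),
        (6, [0, 1, 1, -2, 0, 13, 0, 16, 16, -3])]"]
  by (simp add: certificate_simps)

lemma star_lb_LSD: "star_lb sL sS sD 13"
  using star_lb_certificate[where X = "\<langle>\<langle>\<rangle>, 1, \<langle>\<rangle>\<rangle>" and Y = "\<langle>\<langle>\<langle>\<langle>\<rangle>, 4, \<langle>\<rangle>\<rangle>, 3, \<langle>\<langle>\<rangle>, 5, \<langle>\<rangle>\<rangle>\<rangle>, 2, \<langle>\<rangle>\<rangle>" and Z = "\<langle>\<langle>\<langle>\<langle>\<langle>\<langle>\<rangle>, 10, \<langle>\<rangle>\<rangle>, 9, \<langle>\<langle>\<rangle>, 11, \<langle>\<rangle>\<rangle>\<rangle>, 8, \<langle>\<rangle>\<rangle>, 7, \<langle>\<langle>\<rangle>, 12, \<langle>\<rangle>\<rangle>\<rangle>, 6, \<langle>\<rangle>\<rangle>"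
      and c = 0 and N = 26 and I = "[0, 3, 7, 9]" and J = "[1, 2, 4, 5, 6, 8, 10, 11, 12]" and S = "[(0, 1), (0, 2), (3, 2), (3, 4), (3, 5), (0, 6), (7, 6), (7, 8), (9, 8), (9, 10), (9, 11), (7, 12)]" and x = "13"
      and M = "[(0, [0, 16, 13, 0, -3, -3, 13, 0, -2, 0, 1, 1, -3]),
        (3, [0, -3, 13, 0, 15, 15, -2, 0, 1, 0, 0, 0, 1]),
        (7, [0, -3, -2, 0, 1, 1, 13, 0, 13, 0, -3, -3, 16]),
        (9, [0, 1, 1, 0, 0, 0, -2, 0, 13, 0, 15, 15, -3])]"]
  by (simp add: certificate_simps)

text \<open>The path with 3 vertices has energy \<open>2 * sqrt 2\<close>, so no bound by its order
  is possible; this value fixes the price of cutting off a cherry.\<close>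

lemma star_lb_NLL: "star_lb \<langle>\<rangle> sL sL (282 / 100)"
  using star_lb_certificate[where X = "\<langle>\<rangle>" and Y = "\<langle>\<langle>\<rangle>, 1, \<langle>\<rangle>\<rangle>" and Z = "\<langle>\<langle>\<rangle>, 2, \<langle>\<rangle>\<rangle>"
      and c = 0 and N = 17 and I = "[0]" and J = "[1, 2]" and S = "[(0, 1), (0, 2)]" and x = "282 / 100"
      and M = "[(0, [0, 12, 12])]"]
  by (simp add: certificate_simps)

text \<open>The complete binary tree with 7 vertices has eigenvalues 2, -2, \<open>sqrt 2\<close>,
  \<open>- sqrt 2\<close> and 0 three times, hence energy \<open>4 + 2 * sqrt 2\<close>, slightly
  above 6.82 and below 7.\<close>

lemma star_lb_NPP: "star_lb \<langle>\<rangle> sP sP (682 / 100)"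
  using star_lb_certificate[where X = "\<langle>\<rangle>" and Y = "\<langle>\<langle>\<langle>\<rangle>, 2, \<langle>\<rangle>\<rangle>, 1, \<langle>\<langle>\<rangle>, 3, \<langle>\<rangle>\<rangle>\<rangle>" and Z = "\<langle>\<langle>\<langle>\<rangle>, 5, \<langle>\<rangle>\<rangle>, 4, \<langle>\<langle>\<rangle>, 6, \<langle>\<rangle>\<rangle>\<rangle>"
      and c = 0 and N = 58 and I = "[1, 4]" and J = "[0, 2, 3, 5, 6]" and S = "[(1, 0), (1, 2), (1, 3), (4, 0), (4, 5), (4, 6)]" and x = "682 / 100"
      and M = "[(1, [29, 0, 35, 35, 0, -6, -6]),
        (4, [29, 0, -6, -6, 0, 35, 35])]"]
  by (simp add: certificate_simps)

section \<open>Bounds for larger shapes, obtained by cutting off pieces\<close>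

lemmas star_lb_cycle = star_lb_swap23[OF star_lb_swap12]

text \<open>Moving the centre back along the same edge is again a rotation, up to cyclic shifts of
  the branches.\<close>

lemma star_lb_unrotate: "star_lb \<langle>P, (), Q\<rangle> Y Z x \<Longrightarrow> star_lb P Q \<langle>Y, (), Z\<rangle> x"
  by (rule star_lb_cycle[OF star_lb_rotate[OF star_lb_cycle]])

lemma star_lb_cherry: "star_lb X Y \<langle>\<rangle> x \<Longrightarrow> star_lb X Y sP (x + 282 / 100)"
  by (rule star_lb_split[OF _ star_lb_cycle[OF star_lb_NLL]])

lemma star_lb_binary: "star_lb X Y \<langle>\<rangle> x \<Longrightarrow> star_lb X Y sB (x + 682 / 100)"
  by (rule star_lb_split[OF _ star_lb_cycle[OF star_lb_NPP]])

text \<open>The root of \<open>sS\<close> has one free slot. A rotation makes that root the centre,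
  the slot receives a second cherry, and rotating back shows \<open>sB\<close>.\<close>

lemma star_lb_second_cherry: "star_lb X Y sS x \<Longrightarrow> star_lb X Y sB (x + 282 / 100)"
  by (rule star_lb_unrotate[OF star_lb_cherry[OF star_lb_rotate]])

text \<open>The same manoeuvre on a single vertex: with the vertex of \<open>sL\<close> as centre, a
  cherry is hung on it, which turns the branch into \<open>sS\<close>.\<close>

lemma star_lb_grow_cherry: "star_lb X Y sL x \<Longrightarrow> star_lb X Y sS (x + 282 / 100)"
  by (rule star_lb_unrotate[OF star_lb_swap23[OF star_lb_cherry[OF star_lb_rotate]]])

text \<open>The new piece is a single edge, two vertices of energy 2, so the balance between energy
  and order is unchanged: a bound with \<open>sL\<close> settles the one with
  \<open>sE\<close>.\<close>

lemma star_lb_path: "star_lb X Y sL x \<Longrightarrow> star_lb X Y sE (x + 2)"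
  by (rule star_lb_unrotate[OF star_lb_swap23[OF star_lb_split[OF star_lb_rotate
    star_lb_swap12[OF star_lb_swap23[OF star_lb_NNL]]]]])

text \<open>The piece beyond the root of \<open>sD\<close> is the tree of
  \<open>star_lb_NLS\<close>, with 6 vertices and energy at least 6. Hence \<open>sD\<close> also
  reduces to \<open>sL\<close> without loss.\<close>

lemma star_lb_fork: "star_lb X Y sL x \<Longrightarrow> star_lb X Y sD (x + 6)"
  by (rule star_lb_unrotate[OF star_lb_swap23[OF star_lb_split[OF star_lb_rotate
    star_lb_swap12[OF star_lb_cycle[OF star_lb_NLS]]]]])

lemma star_lb_NNE: "star_lb \<langle>\<rangle> \<langle>\<rangle> sE 4"
  by (rule star_lb_mono[OF star_lb_path[OF star_lb_NNL]]) simp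

lemma star_lb_NND: "star_lb \<langle>\<rangle> \<langle>\<rangle> sD 8"
  by (rule star_lb_mono[OF star_lb_fork[OF star_lb_NNL]]) simp

lemma star_lb_NPB: "star_lb \<langle>\<rangle> sP sB (1118 / 100)"
  by (rule star_lb_mono[OF star_lb_swap23[OF star_lb_cherry[OF star_lb_swap23[OF star_lb_NNB]]]]) simp

lemma star_lb_NPE: "star_lb \<langle>\<rangle> sP sE (718 / 100)"
  by (rule star_lb_mono[OF star_lb_path[OF star_lb_swap23[OF star_lb_NLP]]]) simp

lemma star_lb_NPD: "star_lb \<langle>\<rangle> sP sD (1118 / 100)"
  by (rule star_lb_mono[OF star_lb_fork[OF star_lb_swap23[OF star_lb_NLP]]]) simp

lemma star_lb_NSB: "star_lb \<langle>\<rangle> sS sB (1218 / 100)"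
  by (rule star_lb_mono[OF star_lb_swap23[OF star_lb_grow_cherry[OF star_lb_swap23[OF star_lb_NLB]]]]) simp

lemma star_lb_NSE: "star_lb \<langle>\<rangle> sS sE 8"
  by (rule star_lb_mono[OF star_lb_path[OF star_lb_swap23[OF star_lb_NLS]]]) simp

lemma star_lb_NSD: "star_lb \<langle>\<rangle> sS sD 12"
  by (rule star_lb_mono[OF star_lb_fork[OF star_lb_swap23[OF star_lb_NLS]]]) simp

lemma star_lb_NBB: "star_lb \<langle>\<rangle> sB sB (1518 / 100)"
  by (rule star_lb_mono[OF star_lb_binary[OF star_lb_swap23[OF star_lb_NNB]]]) simp

lemma star_lb_NBE: "star_lb \<langle>\<rangle> sB sE (1136 / 100)"
  by (rule star_lb_mono[OF star_lb_path[OF star_lb_swap23[OF star_lb_NLB]]]) simp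

lemma star_lb_NBD: "star_lb \<langle>\<rangle> sB sD (1536 / 100)"
  by (rule star_lb_mono[OF star_lb_fork[OF star_lb_swap23[OF star_lb_NLB]]]) simp

lemma star_lb_NEE: "star_lb \<langle>\<rangle> sE sE 7"
  by (rule star_lb_mono[OF star_lb_path[OF star_lb_swap23[OF star_lb_NLE]]]) simp

lemma star_lb_NED: "star_lb \<langle>\<rangle> sE sD 11"
  by (rule star_lb_mono[OF star_lb_fork[OF star_lb_swap23[OF star_lb_NLE]]]) simp

lemma star_lb_NDD: "star_lb \<langle>\<rangle> sD sD 15"
  by (rule star_lb_mono[OF star_lb_fork[OF star_lb_swap23[OF star_lb_NLD]]]) simp

lemma star_lb_LPB: "star_lb sL sP sB (1218 / 100)"
  by (rule star_lb_mono[OF star_lb_swap23[OF star_lb_cherry[OF star_lb_swap23[OF star_lb_swap12[OF star_lb_NLB]]]]]) simp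

lemma star_lb_LPE: "star_lb sL sP sE 8"
  by (rule star_lb_mono[OF star_lb_path[OF star_lb_swap23[OF star_lb_LLP]]]) simp

lemma star_lb_LPD: "star_lb sL sP sD 12"
  by (rule star_lb_mono[OF star_lb_fork[OF star_lb_swap23[OF star_lb_LLP]]]) simp

lemma star_lb_LSB: "star_lb sL sS sB 13"
  by (rule star_lb_mono[OF star_lb_second_cherry[OF star_lb_LSS]]) simp

lemma star_lb_LBB: "star_lb sL sB sB (1618 / 100)"
  by (rule star_lb_mono[OF star_lb_binary[OF star_lb_swap23[OF star_lb_swap12[OF star_lb_NLB]]]]) simp

lemma star_lb_LBE: "star_lb sL sB sE 12"
  by (rule star_lb_mono[OF star_lb_path[OF star_lb_swap23[OF star_lb_LLB]]]) simp

lemma star_lb_LBD: "star_lb sL sB sD 16"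
  by (rule star_lb_mono[OF star_lb_fork[OF star_lb_swap23[OF star_lb_LLB]]]) simp

lemma star_lb_LEE: "star_lb sL sE sE 8"
  by (rule star_lb_mono[OF star_lb_path[OF star_lb_swap23[OF star_lb_LLE]]]) simp

lemma star_lb_LED: "star_lb sL sE sD 12"
  by (rule star_lb_mono[OF star_lb_fork[OF star_lb_swap23[OF star_lb_LLE]]]) simp

lemma star_lb_LDD: "star_lb sL sD sD 16"
  by (rule star_lb_mono[OF star_lb_fork[OF star_lb_swap23[OF star_lb_LLD]]]) simp

lemma star_lb_PPS: "star_lb sP sP sS 11"
  by (rule star_lb_mono[OF star_lb_swap23[OF star_lb_cherry[OF star_lb_swap23[OF star_lb_swap12[OF star_lb_NPS]]]]]) simp

lemma star_lb_PPB: "star_lb sP sP sB 14"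
  by (rule star_lb_mono[OF star_lb_swap23[OF star_lb_cherry[OF star_lb_swap23[OF star_lb_swap12[OF star_lb_NPB]]]]]) simp

lemma star_lb_PPE: "star_lb sP sP sE 10"
  by (rule star_lb_mono[OF star_lb_path[OF star_lb_swap23[OF star_lb_swap12[OF star_lb_LPP]]]]) simp

lemma star_lb_PPD: "star_lb sP sP sD 14"
  by (rule star_lb_mono[OF star_lb_fork[OF star_lb_swap23[OF star_lb_swap12[OF star_lb_LPP]]]]) simp

lemma star_lb_PSS: "star_lb sP sS sS 12"
  by (rule star_lb_mono[OF star_lb_swap12[OF star_lb_swap23[OF star_lb_cherry[OF star_lb_swap23[OF star_lb_swap12[OF star_lb_NSS]]]]]]) simp

lemma star_lb_PSB: "star_lb sP sS sB 15"
  by (rule star_lb_mono[OF star_lb_binary[OF star_lb_swap23[OF star_lb_swap12[OF star_lb_NPS]]]]) simp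

lemma star_lb_PSE: "star_lb sP sS sE 11"
  by (rule star_lb_mono[OF star_lb_path[OF star_lb_swap23[OF star_lb_swap12[OF star_lb_LPS]]]]) simp

lemma star_lb_PSD: "star_lb sP sS sD 15"
  by (rule star_lb_mono[OF star_lb_fork[OF star_lb_swap23[OF star_lb_swap12[OF star_lb_LPS]]]]) simp

lemma star_lb_PBB: "star_lb sP sB sB 18"
  by (rule star_lb_mono[OF star_lb_binary[OF star_lb_swap23[OF star_lb_swap12[OF star_lb_NPB]]]]) simp

lemma star_lb_PBE: "star_lb sP sB sE (1418 / 100)"
  by (rule star_lb_mono[OF star_lb_path[OF star_lb_swap23[OF star_lb_swap12[OF star_lb_LPB]]]]) simp

lemma star_lb_PBD: "star_lb sP sB sD (1818 / 100)"
  by (rule star_lb_mono[OF star_lb_fork[OF star_lb_swap23[OF star_lb_swap12[OF star_lb_LPB]]]]) simp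

lemma star_lb_PEE: "star_lb sP sE sE 10"
  by (rule star_lb_mono[OF star_lb_path[OF star_lb_swap23[OF star_lb_swap12[OF star_lb_LPE]]]]) simp

lemma star_lb_PED: "star_lb sP sE sD 14"
  by (rule star_lb_mono[OF star_lb_fork[OF star_lb_swap23[OF star_lb_swap12[OF star_lb_LPE]]]]) simp

lemma star_lb_PDD: "star_lb sP sD sD 18"
  by (rule star_lb_mono[OF star_lb_fork[OF star_lb_swap23[OF star_lb_swap12[OF star_lb_LPD]]]]) simp

lemma star_lb_SSS: "star_lb sS sS sS 13"
  by (rule star_lb_mono[OF star_lb_grow_cherry[OF star_lb_swap23[OF star_lb_swap12[OF star_lb_LSS]]]]) simp

lemma star_lb_SSB: "star_lb sS sS sB 16"
  by (rule star_lb_mono[OF star_lb_binary[OF star_lb_swap23[OF star_lb_swap12[OF star_lb_NSS]]]]) simp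

lemma star_lb_SSE: "star_lb sS sS sE (1218 / 100)"
  by (rule star_lb_mono[OF star_lb_path[OF star_lb_swap23[OF star_lb_swap12[OF star_lb_LSS]]]]) simp

lemma star_lb_SSD: "star_lb sS sS sD (1618 / 100)"
  by (rule star_lb_mono[OF star_lb_fork[OF star_lb_swap23[OF star_lb_swap12[OF star_lb_LSS]]]]) simp

lemma star_lb_SBB: "star_lb sS sB sB 19"
  by (rule star_lb_mono[OF star_lb_binary[OF star_lb_swap23[OF star_lb_swap12[OF star_lb_NSB]]]]) simp

lemma star_lb_SBE: "star_lb sS sB sE 15"
  by (rule star_lb_mono[OF star_lb_path[OF star_lb_swap23[OF star_lb_swap12[OF star_lb_LSB]]]]) simp

lemma star_lb_SBD: "star_lb sS sB sD 19"
  by (rule star_lb_mono[OF star_lb_fork[OF star_lb_swap23[OF star_lb_swap12[OF star_lb_LSB]]]]) simp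

lemma star_lb_SEE: "star_lb sS sE sE 11"
  by (rule star_lb_mono[OF star_lb_path[OF star_lb_swap23[OF star_lb_swap12[OF star_lb_LSE]]]]) simp

lemma star_lb_SED: "star_lb sS sE sD 15"
  by (rule star_lb_mono[OF star_lb_fork[OF star_lb_swap23[OF star_lb_swap12[OF star_lb_LSE]]]]) simp

lemma star_lb_SDD: "star_lb sS sD sD 19"
  by (rule star_lb_mono[OF star_lb_fork[OF star_lb_swap23[OF star_lb_swap12[OF star_lb_LSD]]]]) simp

lemma star_lb_BBB: "star_lb sB sB sB 22"
  by (rule star_lb_mono[OF star_lb_binary[OF star_lb_swap23[OF star_lb_swap12[OF star_lb_NBB]]]]) simp

lemma star_lb_BBE: "star_lb sB sB sE (1818 / 100)"
  by (rule star_lb_mono[OF star_lb_path[OF star_lb_swap23[OF star_lb_swap12[OF star_lb_LBB]]]]) simp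

lemma star_lb_BBD: "star_lb sB sB sD (2218 / 100)"
  by (rule star_lb_mono[OF star_lb_fork[OF star_lb_swap23[OF star_lb_swap12[OF star_lb_LBB]]]]) simp

lemma star_lb_BEE: "star_lb sB sE sE 14"
  by (rule star_lb_mono[OF star_lb_path[OF star_lb_swap23[OF star_lb_swap12[OF star_lb_LBE]]]]) simp

lemma star_lb_BED: "star_lb sB sE sD 18"
  by (rule star_lb_mono[OF star_lb_fork[OF star_lb_swap23[OF star_lb_swap12[OF star_lb_LBE]]]]) simp

lemma star_lb_BDD: "star_lb sB sD sD 22"
  by (rule star_lb_mono[OF star_lb_fork[OF star_lb_swap23[OF star_lb_swap12[OF star_lb_LBD]]]]) simp

lemma star_lb_EEE: "star_lb sE sE sE 10"
  by (rule star_lb_mono[OF star_lb_path[OF star_lb_swap23[OF star_lb_swap12[OF star_lb_LEE]]]]) simp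

lemma star_lb_EED: "star_lb sE sE sD 14"
  by (rule star_lb_mono[OF star_lb_fork[OF star_lb_swap23[OF star_lb_swap12[OF star_lb_LEE]]]]) simp

lemma star_lb_EDD: "star_lb sE sD sD 18"
  by (rule star_lb_mono[OF star_lb_fork[OF star_lb_swap23[OF star_lb_swap12[OF star_lb_LED]]]]) simp

lemma star_lb_DDD: "star_lb sD sD sD 22"
  by (rule star_lb_mono[OF star_lb_fork[OF star_lb_swap23[OF star_lb_swap12[OF star_lb_LDD]]]]) simp
text \<open>
  The shapes of \<open>K\<^sub>1\<close>, of the path with 3 vertices, of the star with 4 vertices and of the complete binary
  tree with 7 vertices, each seen from its centre.
\<close>

definition exceptional_shapes :: "(unit tree \<times> unit tree \<times> unit tree) set" where
  "exceptional_shapes = {(\<langle>\<rangle>, \<langle>\<rangle>, \<langle>\<rangle>), (\<langle>\<rangle>, sL, sL), (sL, sL, sL), (\<langle>\<rangle>, sP, sP)}"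

definition exceptional :: "nat set \<Rightarrow> (nat \<times> nat) set \<Rightarrow> bool" where
  "exceptional V R \<longleftrightarrow> (\<exists>c X Y Z. star_distinct c X Y Z \<and> V = star_verts c X Y Z
    \<and> R = star_edges c X Y Z \<and> (shape X, shape Y, shape Z) \<in> exceptional_shapes)"

text \<open>The second alternative speaks of the graph and not of the three shapes, so it survives a
  change of centre; an exceptional tree may be presented from a vertex other than its
  centre.\<close>

definition star_ok :: "unit tree \<Rightarrow> unit tree \<Rightarrow> unit tree \<Rightarrow> bool" where
  "star_ok X Y Z \<longleftrightarrow> (\<forall>c X' Y' Z'. shape X' = X \<longrightarrow> shape Y' = Y \<longrightarrow> shape Z' = Z
    \<longrightarrow> star_distinct c X' Y' Z'
    \<longrightarrow> energy_lb (star_verts c X' Y' Z') (star_edges c X' Y' Z') (card (star_verts c X' Y' Z'))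
      \<or> exceptional (star_verts c X' Y' Z') (star_edges c X' Y' Z'))"

lemma star_ok_swap12: "star_ok X Y Z \<Longrightarrow> star_ok Y X Z"
  unfolding star_ok_def using star_swap12 by metis

lemma star_ok_swap23: "star_ok X Y Z \<Longrightarrow> star_ok X Z Y"
  unfolding star_ok_def using star_swap23 by metis

lemma star_ok_rotate: "star_ok P Q \<langle>Y, (), Z\<rangle> \<Longrightarrow> star_ok \<langle>P, (), Q\<rangle> Y Z"
  unfolding star_ok_def
proof (intro allI impI)
  fix c :: nat and X' Y' Z'
  let ?ok = "\<lambda>c X' Y' Z'. energy_lb (star_verts c X' Y' Z') (star_edges c X' Y' Z') (card (star_verts c X' Y' Z'))
      \<or> exceptional (star_verts c X' Y' Z') (star_edges c X' Y' Z')"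
  assume *: "\<forall>(c :: nat) X' Y' Z'. shape X' = P \<longrightarrow> shape Y' = Q \<longrightarrow> shape Z' = \<langle>Y, (), Z\<rangle> \<longrightarrow>
      star_distinct c X' Y' Z' \<longrightarrow> ?ok c X' Y' Z'"
    and sh: "shape X' = \<langle>P, (), Q\<rangle>" "shape Y' = Y" "shape Z' = Z"
    and d: "star_distinct c X' Y' Z'"
  from sh(1) obtain P' r Q' where X': "X' = \<langle>P', r, Q'\<rangle>" "shape P' = P" "shape Q' = Q"
    unfolding shape_eq_Node_iff by blast
  show "?ok c X' Y' Z'"
    using *[rule_format, of P' Q' "\<langle>Y', c, Z'\<rangle>" r] X' sh d by (simp add: star_rotate)
qed

lemma star_ok_lb:
  assumes "star_lb X Y Z x" "real (size X + size Y + size Z + 1) \<le> x"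
  shows "star_ok X Y Z"
  unfolding star_ok_def
proof (intro allI impI disjI1)
  fix c :: nat and X' Y' Z'
  assume sh: "shape X' = X" "shape Y' = Y" "shape Z' = Z" and d: "star_distinct c X' Y' Z'"
  then have "size X' = size X" "size Y' = size Y" "size Z' = size Z" by (metis size_map_tree)+
  then show "energy_lb (star_verts c X' Y' Z') (star_edges c X' Y' Z') (card (star_verts c X' Y' Z'))"
    using assms(1)[unfolded star_lb_def] sh d assms(2) energy_lb_mono card_star_verts[OF d] by metis
qed

lemma star_ok_exceptional: "(X, Y, Z) \<in> exceptional_shapes \<Longrightarrow> star_ok X Y Z"
  unfolding star_ok_def exceptional_def by blast

section \<open>Exhaustive check of all triples of small branches\<close>

primrec all_pairs :: "('a \<Rightarrow> 'a \<Rightarrow> bool) \<Rightarrow> 'a list \<Rightarrow> bool" where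
  "all_pairs Q [] = True"
| "all_pairs Q (x # xs) = (list_all (Q x) (x # xs) \<and> all_pairs Q xs)"

text \<open>Only triples in list order, repetitions allowed, are visited. For a symmetric predicate
  on 7 branches this leaves 84 cases out of 343.\<close>

primrec all_triples :: "('a \<Rightarrow> 'a \<Rightarrow> 'a \<Rightarrow> bool) \<Rightarrow> 'a list \<Rightarrow> bool" where
  "all_triples Q [] = True"
| "all_triples Q (x # xs) = (all_pairs (Q x) (x # xs) \<and> all_triples Q xs)"

lemma all_pairsD:
  assumes "all_pairs Q xs" "x \<in> set xs" "y \<in> set xs" "\<And>x y. Q x y \<Longrightarrow> Q y x"
  shows "Q x y"
  using assms(1-3) by (induction xs) (auto simp: list_all_iff intro: assms(4))

lemma all_triplesD:
  assumes "all_triples Q xs" "x \<in> set xs" "y \<in> set xs" "z \<in> set xs"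
    and swap12: "\<And>x y z. Q x y z \<Longrightarrow> Q y x z" and swap23: "\<And>x y z. Q x y z \<Longrightarrow> Q x z y"
  shows "Q x y z"
  using assms(1-4)
proof (induction xs)
  case (Cons a xs)
  have a: "Q a u v" if "u \<in> set (a # xs)" "v \<in> set (a # xs)" for u v
  proof (rule all_pairsD[OF _ that])
    show "all_pairs (Q a) (a # xs)" using Cons.prems(1) by (simp only: all_triples.simps)
  qed (rule swap23)
  consider "x = a" | "y = a" | "z = a" | "x \<in> set xs" "y \<in> set xs" "z \<in> set xs"
    using Cons.prems by auto
  then show ?case
  proof cases
    case 1
    then show ?thesis using a Cons.prems by simp
  next
    case 2
    then show ?thesis using swap12[OF a[of x z]] Cons.prems by simp
  next
    case 3
    then show ?thesis using swap23[OF swap12[OF a[of x y]]] Cons.prems by simp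
  next
    case 4
    then show ?thesis using Cons by simp
  qed
qed simp

lemmas star_lower_bounds =
  star_lb_NNL star_lb_NNS star_lb_NNB star_lb_NNE star_lb_NND star_lb_NLP star_lb_NLS
  star_lb_NLB star_lb_NLE star_lb_NLD star_lb_NPS star_lb_NPB star_lb_NPE star_lb_NPD
  star_lb_NSS star_lb_NSB star_lb_NSE star_lb_NSD star_lb_NBB star_lb_NBE star_lb_NBD
  star_lb_NEE star_lb_NED star_lb_NDD star_lb_LLP star_lb_LLB star_lb_LLE star_lb_LLD
  star_lb_LPP star_lb_LPS star_lb_LPB star_lb_LPE star_lb_LPD star_lb_LSS star_lb_LSB
  star_lb_LSE star_lb_LSD star_lb_LBB star_lb_LBE star_lb_LBD star_lb_LEE star_lb_LED
  star_lb_LDD star_lb_PPP star_lb_PPS star_lb_PPB star_lb_PPE star_lb_PPD star_lb_PSS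
  star_lb_PSB star_lb_PSE star_lb_PSD star_lb_PBB star_lb_PBE star_lb_PBD star_lb_PEE
  star_lb_PED star_lb_PDD star_lb_SSS star_lb_SSB star_lb_SSE star_lb_SSD star_lb_SBB
  star_lb_SBE star_lb_SBD star_lb_SEE star_lb_SED star_lb_SDD star_lb_BBB star_lb_BBE
  star_lb_BBD star_lb_BEE star_lb_BED star_lb_BDD star_lb_EEE star_lb_EED star_lb_EDD
  star_lb_DDD

text \<open>Of the 84 multisets, 78 have a lower bound that reaches the order. The other six are
  exceptional trees: four seen from their centre and two seen from another vertex.\<close>

lemma star_ok_small:
  assumes "{X, Y, Z} \<subseteq> {\<langle>\<rangle>, sL, sP, sS, sB, sE, sD}"
  shows "star_ok X Y Z"
proof -
  have exc: "star_ok \<langle>\<rangle> \<langle>\<rangle> \<langle>\<rangle>" "star_ok \<langle>\<rangle> sL sL" "star_ok sL sL sL" "star_ok \<langle>\<rangle> sP sP"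
    by (rule star_ok_exceptional, simp add: exceptional_shapes_def)+
  \<comment> \<open>The star with 4 vertices, seen from a leaf.\<close>
  have P: "star_ok \<langle>\<rangle> \<langle>\<rangle> sP"
    by (rule star_ok_swap23[OF star_ok_swap12[OF star_ok_rotate]]) (rule exc)
  \<comment> \<open>The complete binary tree with 7 vertices, seen from a child of its root.\<close>
  have S: "star_ok sL sL sS"
    by (rule star_ok_swap23[OF star_ok_swap12[OF star_ok_rotate[OF star_ok_swap12]]]) (rule exc)
  have "all_triples star_ok [\<langle>\<rangle>, sL, sP, sS, sB, sE, sD]"
    unfolding all_triples.simps all_pairs.simps list.pred_inject
    by (intro conjI; (rule TrueI list.pred_inject(1) exc P S | (rule star_ok_lb, rule star_lower_bounds, simp; fail)))
  then show ?thesis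
    by (rule all_triplesD[OF _ _ _ _ star_ok_swap12 star_ok_swap23]) (use assms in auto)
qed

section \<open>Reduction to small branches\<close>

lemma tree_edges_from_outside:
  assumes "(s, v) \<in> tree_edges s T" "s \<notin> set_tree T"
  shows "\<exists>l q. T = \<langle>l, v, q\<rangle>"
proof (cases T)
  case (Node l a q)
  then show ?thesis using assms tree_edges_subset[of a l] tree_edges_subset[of a q] by auto
qed (use assms in auto)

text \<open>With its third slot empty, \<open>r\<close> has degree at most 2; this excludes the
  vertices of degree 3 as entry points of an exceptional piece.\<close>

lemma two_neighbours:
  assumes "star_distinct r P Q \<langle>\<rangle>" "{(r, x), (r, y), (r, z)} \<subseteq> star_edges r P Q \<langle>\<rangle>"
  shows "x = y \<or> x = z \<or> y = z"
proof -
  have "(\<exists>l q. P = \<langle>l, v, q\<rangle>) \<or> (\<exists>l q. Q = \<langle>l, v, q\<rangle>)" if "(r, v) \<in> star_edges r P Q \<langle>\<rangle>" for v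
    using that assms(1) tree_edges_from_outside[of r v P] tree_edges_from_outside[of r v Q]
    by (auto simp: star_edges_def star_distinct_iff)
  from this[of x] this[of y] this[of z] assms(2) show ?thesis by auto
qed

text \<open>The third slot of \<open>r\<close> is reserved for the cut edge, so \<open>r\<close> is
  not a vertex of degree 3 in the exceptional tree. Going through the remaining vertices and using
  the symmetries of the four trees leaves six rooted shapes.\<close>

lemma exceptional_rooted:
  assumes d: "star_distinct r P Q \<langle>\<rangle>"
    and e: "exceptional (star_verts r P Q \<langle>\<rangle>) (star_edges r P Q \<langle>\<rangle>)"
  shows "\<exists>P' Q'. star_distinct r P' Q' \<langle>\<rangle> \<and> star_verts r P' Q' \<langle>\<rangle> = star_verts r P Q \<langle>\<rangle>
    \<and> star_edges r P' Q' \<langle>\<rangle> = star_edges r P Q \<langle>\<rangle> \<and> shape \<langle>P', r, Q'\<rangle> \<in> {sL, sP, sS, sB, sE, sD}"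
    (is "\<exists>P' Q'. ?G P' Q'")
proof -
  define G where "G P' Q' \<longleftrightarrow> ?G P' Q'" for P' Q'
  note defs = star_distinct_def star_verts_def star_edges_def
  have r: "r \<in> star_verts r P Q \<langle>\<rangle>" by (simp add: star_verts_def)
  note nb = two_neighbours[OF d]
  from e obtain c X Y Z where s: "star_distinct c X Y Z"
    and V: "star_verts r P Q \<langle>\<rangle> = star_verts c X Y Z" and R: "star_edges r P Q \<langle>\<rangle> = star_edges c X Y Z"
    and sh: "(shape X, shape Y, shape Z) \<in> exceptional_shapes"
    unfolding exceptional_def by blast
  from sh consider "shape X = \<langle>\<rangle>" "shape Y = \<langle>\<rangle>" "shape Z = \<langle>\<rangle>"
    | "shape X = \<langle>\<rangle>" "shape Y = sL" "shape Z = sL"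
    | "shape X = sL" "shape Y = sL" "shape Z = sL"
    | "shape X = \<langle>\<rangle>" "shape Y = sP" "shape Z = sP"
    unfolding exceptional_shapes_def by auto
  then have "\<exists>P' Q'. G P' Q'"
  proof cases
    case 1
    then have "r = c" using r unfolding V by (simp add: star_verts_def)
    with 1 show ?thesis unfolding G_def V R
      by (intro exI[of _ "\<langle>\<rangle>"]) (auto simp: defs)
  next
    case 2
    then obtain a b where X: "X = \<langle>\<rangle>" "Y = \<langle>\<langle>\<rangle>, a, \<langle>\<rangle>\<rangle>" "Z = \<langle>\<langle>\<rangle>, b, \<langle>\<rangle>\<rangle>"
      by (auto simp: shape_eq_Node_iff)
    have dist: "distinct [c, a, b]" using s unfolding X by (simp add: defs)
    have leaf: "G \<langle>\<langle>\<langle>\<rangle>, y, \<langle>\<rangle>\<rangle>, c, \<langle>\<rangle>\<rangle> \<langle>\<rangle>" if "r = x" "{x, y} = {a, b}" for x y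
      using dist that unfolding G_def V R X by (auto simp: defs doubleton_eq_iff)
    have centre: "G Y Z" if "r = c"
      using dist that unfolding G_def V R X by (auto simp: defs)
    consider "r = c" | "r = a" | "r = b" using r unfolding V X by (auto simp: star_verts_def)
    then show ?thesis using leaf[of a b] leaf[of b a] centre by cases blast+
  next
    case 3
    then obtain x y z where X: "X = \<langle>\<langle>\<rangle>, x, \<langle>\<rangle>\<rangle>" "Y = \<langle>\<langle>\<rangle>, y, \<langle>\<rangle>\<rangle>" "Z = \<langle>\<langle>\<rangle>, z, \<langle>\<rangle>\<rangle>"
      by (auto simp: shape_eq_Node_iff)
    have dist: "distinct [c, x, y, z]" using s unfolding X by (simp add: defs)
    have "r \<noteq> c" using nb[of x y z] dist unfolding R X by (auto simp: star_edges_def)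
    moreover have "G \<langle>\<langle>\<langle>\<rangle>, y, \<langle>\<rangle>\<rangle>, c, \<langle>\<langle>\<rangle>, z, \<langle>\<rangle>\<rangle>\<rangle> \<langle>\<rangle>" if "r = x"
      using dist that unfolding G_def V R X by (auto simp: defs)
    moreover have "G \<langle>\<langle>\<langle>\<rangle>, x, \<langle>\<rangle>\<rangle>, c, \<langle>\<langle>\<rangle>, z, \<langle>\<rangle>\<rangle>\<rangle> \<langle>\<rangle>" if "r = y"
      using dist that unfolding G_def V R X by (auto simp: defs)
    moreover have "G \<langle>\<langle>\<langle>\<rangle>, x, \<langle>\<rangle>\<rangle>, c, \<langle>\<langle>\<rangle>, y, \<langle>\<rangle>\<rangle>\<rangle> \<langle>\<rangle>" if "r = z"
      using dist that unfolding G_def V R X by (auto simp: defs)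
    moreover have "r \<in> {c, x, y, z}" using r unfolding V X by (auto simp: star_verts_def)
    ultimately show ?thesis by blast
  next
    case 4
    then obtain p a a' q b b' where X: "X = \<langle>\<rangle>"
      "Y = \<langle>\<langle>\<langle>\<rangle>, a, \<langle>\<rangle>\<rangle>, p, \<langle>\<langle>\<rangle>, a', \<langle>\<rangle>\<rangle>\<rangle>" "Z = \<langle>\<langle>\<langle>\<rangle>, b, \<langle>\<rangle>\<rangle>, q, \<langle>\<langle>\<rangle>, b', \<langle>\<rangle>\<rangle>\<rangle>"
      by (auto simp: shape_eq_Node_iff)
    have dist: "distinct [c, p, a, a', q, b, b']" using s unfolding X by (simp add: defs)
    have "r \<noteq> p" using nb[of c a a'] dist unfolding R X by (auto simp: star_edges_def)
    moreover have "r \<noteq> q" using nb[of c b b'] dist unfolding R X by (auto simp: star_edges_def)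
    moreover have "G Y Z" if "r = c"
      using dist that unfolding G_def V R X by (auto simp: defs)
    moreover have "G \<langle>\<langle>Z, c, \<langle>\<rangle>\<rangle>, p, \<langle>\<langle>\<rangle>, a', \<langle>\<rangle>\<rangle>\<rangle> \<langle>\<rangle>" if "r = a"
      using dist that unfolding G_def V R X by (auto simp: defs)
    moreover have "G \<langle>\<langle>Z, c, \<langle>\<rangle>\<rangle>, p, \<langle>\<langle>\<rangle>, a, \<langle>\<rangle>\<rangle>\<rangle> \<langle>\<rangle>" if "r = a'"
      using dist that unfolding G_def V R X by (auto simp: defs)
    moreover have "G \<langle>\<langle>Y, c, \<langle>\<rangle>\<rangle>, q, \<langle>\<langle>\<rangle>, b', \<langle>\<rangle>\<rangle>\<rangle> \<langle>\<rangle>" if "r = b"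
      using dist that unfolding G_def V R X by (auto simp: defs)
    moreover have "G \<langle>\<langle>Y, c, \<langle>\<rangle>\<rangle>, q, \<langle>\<langle>\<rangle>, b, \<langle>\<rangle>\<rangle>\<rangle> \<langle>\<rangle>" if "r = b'"
      using dist that unfolding G_def V R X by (auto simp: defs)
    moreover have "r \<in> {c, p, a, a', q, b, b'}" using r unfolding V X by (auto simp: star_verts_def)
    ultimately show ?thesis by blast
  qed
  then show ?thesis unfolding G_def .
qed

text \<open>The branches that a cut cannot handle: the piece beyond the edge is exceptional, so the
  induction hypothesis gives no bound for it. An absent branch counts as small so that all three
  slots are treated alike.\<close>

definition small_branch :: "nat tree \<Rightarrow> bool" where
  "small_branch Z \<longleftrightarrow> Z = \<langle>\<rangle> \<or> (\<exists>P r Q. Z = \<langle>P, r, Q\<rangle>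
    \<and> exceptional (star_verts r P Q \<langle>\<rangle>) (star_edges r P Q \<langle>\<rangle>))"

text \<open>The same rooted piece may be drawn with its children in another order. It is redrawn in
  standard form on the same vertices and edges; equality of \<open>tree_edges\<close> for every
  outside vertex \<open>s\<close> lets it be put back in place.\<close>

lemma small_branch_normal_form:
  assumes "small_branch Z" "distinct (preorder Z)"
  shows "\<exists>Z'. shape Z' \<in> {\<langle>\<rangle>, sL, sP, sS, sB, sE, sD} \<and> set_tree Z' = set_tree Z
    \<and> distinct (preorder Z') \<and> (\<forall>s. tree_edges s Z' = tree_edges s Z)"
proof (cases Z)
  case Leaf
  then show ?thesis by (intro exI[of _ "\<langle>\<rangle>"]) simp
next
  case (Node P r Q)
  have edges: "tree_edges s \<langle>P, r, Q\<rangle> = {(s, r), (r, s)} \<union> star_edges r P Q \<langle>\<rangle>"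
    and verts: "set_tree \<langle>P, r, Q\<rangle> = star_verts r P Q \<langle>\<rangle>"
    and dist: "distinct (preorder \<langle>P, r, Q\<rangle>) \<longleftrightarrow> star_distinct r P Q \<langle>\<rangle>" for s P Q
    by (auto simp: star_edges_def star_verts_def star_distinct_def)
  have "star_distinct r P Q \<langle>\<rangle>" "exceptional (star_verts r P Q \<langle>\<rangle>) (star_edges r P Q \<langle>\<rangle>)"
    using assms Node by (auto simp: small_branch_def simp flip: dist)
  from exceptional_rooted[OF this] obtain P' Q' where *: "star_distinct r P' Q' \<langle>\<rangle>"
    "star_verts r P' Q' \<langle>\<rangle> = star_verts r P Q \<langle>\<rangle>" "star_edges r P' Q' \<langle>\<rangle> = star_edges r P Q \<langle>\<rangle>"
    "shape \<langle>P', r, Q'\<rangle> \<in> {sL, sP, sS, sB, sE, sD}" by blast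
  show ?thesis
    unfolding Node using * by (intro exI[of _ "\<langle>P', r, Q'\<rangle>"]) (simp only: edges verts dist, blast)
qed

abbreviation star_good :: "nat \<Rightarrow> nat tree \<Rightarrow> nat tree \<Rightarrow> nat tree \<Rightarrow> bool" where
  "star_good c X Y Z \<equiv>
    energy_lb (star_verts c X Y Z) (star_edges c X Y Z) (card (star_verts c X Y Z))
    \<or> exceptional (star_verts c X Y Z) (star_edges c X Y Z)"

lemma star_good_small_branches:
  assumes d: "star_distinct c X Y Z" and small: "small_branch X" "small_branch Y" "small_branch Z"
  shows "star_good c X Y Z"
proof -
  have dist: "distinct (preorder X)" "distinct (preorder Y)" "distinct (preorder Z)"
    using d by (auto simp: star_distinct_def)
  from small_branch_normal_form[OF small(1) dist(1)] obtain X' where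
    X: "shape X' \<in> {\<langle>\<rangle>, sL, sP, sS, sB, sE, sD}" "set_tree X' = set_tree X"
      "distinct (preorder X')" "\<forall>s. tree_edges s X' = tree_edges s X"
    by blast
  from small_branch_normal_form[OF small(2) dist(2)] obtain Y' where
    Y: "shape Y' \<in> {\<langle>\<rangle>, sL, sP, sS, sB, sE, sD}" "set_tree Y' = set_tree Y"
      "distinct (preorder Y')" "\<forall>s. tree_edges s Y' = tree_edges s Y"
    by blast
  from small_branch_normal_form[OF small(3) dist(3)] obtain Z' where
    Z: "shape Z' \<in> {\<langle>\<rangle>, sL, sP, sS, sB, sE, sD}" "set_tree Z' = set_tree Z"
      "distinct (preorder Z')" "\<forall>s. tree_edges s Z' = tree_edges s Z"
    by blast
  have V: "star_verts c X Y Z = star_verts c X' Y' Z'" by (simp add: star_verts_def X Y Z)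
  have R: "star_edges c X Y Z = star_edges c X' Y' Z'" by (simp add: star_edges_def X Y Z)
  have "star_distinct c X' Y' Z'" using d X Y Z by (simp add: star_distinct_iff)
  moreover have "star_ok (shape X') (shape Y') (shape Z')"
    by (rule star_ok_small) (use X(1) Y(1) Z(1) in blast)
  ultimately show ?thesis unfolding V R star_ok_def by blast
qed

text \<open>Cut the edge between \<open>c\<close> and \<open>r\<close>. The far piece is not
  exceptional, so induction yields its full order as a bound. If the near piece has its full bound
  as well, the two add up; otherwise it is exceptional, that is, a small branch as seen from
  \<open>r\<close>.\<close>

lemma star_good_split:
  assumes d: "star_distinct c X Y \<langle>P, r, Q\<rangle>"
    and IH: "\<And>c' X' Y' Z'. size X' + size Y' + size Z' < size X + size Y + size \<langle>P, r, Q\<rangle>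
      \<Longrightarrow> star_distinct c' X' Y' Z' \<Longrightarrow> star_good c' X' Y' Z'"
    and large: "\<not> small_branch \<langle>P, r, Q\<rangle>"
  shows "star_good c X Y \<langle>P, r, Q\<rangle> \<or> small_branch \<langle>X, c, Y\<rangle>"
proof -
  have d': "star_distinct c X Y \<langle>\<rangle>" "star_distinct r P Q \<langle>\<rangle>"
    using d unfolding star_distinct_iff by auto
  have "star_good r P Q \<langle>\<rangle>" by (rule IH) (use d' in auto)
  then have 1: "energy_lb (star_verts r P Q \<langle>\<rangle>) (star_edges r P Q \<langle>\<rangle>) (card (star_verts r P Q \<langle>\<rangle>))"
    using large by (simp add: small_branch_def)
  have "star_good c X Y \<langle>\<rangle>" by (rule IH) (use d' in auto)
  then show ?thesis
  proof
    assume 2: "energy_lb (star_verts c X Y \<langle>\<rangle>) (star_edges c X Y \<langle>\<rangle>) (card (star_verts c X Y \<langle>\<rangle>))"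
    have "card (star_verts c X Y \<langle>P, r, Q\<rangle>) = card (star_verts c X Y \<langle>\<rangle>) + card (star_verts r P Q \<langle>\<rangle>)"
      using d d' by (simp add: card_star_verts)
    then show ?thesis using energy_lb_split_star[OF d 2 1] by simp
  qed (simp add: small_branch_def)
qed

lemma star_good:
  assumes "star_distinct c X Y Z"
  shows "star_good c X Y Z"
  using assms
proof (induction "size X + size Y + size Z" arbitrary: c X Y Z rule: less_induct)
  case less
  have IH: "star_good c' X' Y' Z'" if "size X' + size Y' + size Z' < n" "star_distinct c' X' Y' Z'"
    "n = size X + size Y + size Z" for c' X' Y' Z' n
    using less.hyps that by simp
  \<comment> \<open>The walk: with a small branch in the third slot, step into a large branch
    \<open>A\<close>. Either the cut settles the tree or everything left behind is again a single
    small branch. The total size of the two other branches drops at each step, while the order of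
    the whole tree stays fixed so that the outer hypothesis remains usable.\<close>
  have small: "star_good c' X' Y' Z'" if "small_branch Z'"
    "size X' + size Y' + size Z' = size X + size Y + size Z" "star_distinct c' X' Y' Z'" for c' X' Y' Z'
    using that
  proof (induction "size X' + size Y'" arbitrary: c' X' Y' Z' rule: less_induct)
    case (less X' Y' c' Z')
    have large: "star_good c' A B Z'" if "\<not> small_branch A"
      "size A + size B = size X' + size Y'" "star_distinct c' A B Z'" for A B
    proof -
      from that(1) obtain P r Q where A: "A = \<langle>P, r, Q\<rangle>" by (cases A) (auto simp: small_branch_def)
      have d: "star_distinct c' B Z' A" using that(3) star_swap12(3) star_swap23(3) by metis
      have eq: "star_verts c' B Z' A = star_verts c' A B Z'" "star_edges c' B Z' A = star_edges c' A B Z'"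
        using star_swap12 star_swap23 by metis+
      have "star_good c' B Z' A \<or> small_branch \<langle>B, c', Z'\<rangle>"
        unfolding A
        by (rule star_good_split[OF d[unfolded A] IH that(1)[unfolded A]])
          (use less.prems(2) that(2) A in auto)
      then show ?thesis
      proof
        assume "star_good c' B Z' A"
        then show ?thesis unfolding eq .
      next
        assume *: "small_branch \<langle>B, c', Z'\<rangle>"
        have "star_good r P Q \<langle>B, c', Z'\<rangle>"
          by (rule less.hyps[OF _ *])
            (use that less.prems(2) in \<open>auto simp: A star_rotate(3)\<close>)
        then show ?thesis unfolding A star_rotate .
      qed
    qed
    show ?case
    proof (cases "small_branch X'")
      case False
      then show ?thesis using large[of X' Y'] less.prems by simp
    next
      case X: True
      show ?thesis
      proof (cases "small_branch Y'")
        case False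
        then have "star_good c' Y' X' Z'"
          using large[of Y' X'] less.prems star_swap12(3)[of c' X'] by simp
        then show ?thesis using star_swap12[of c' X'] by simp
      next
        case True
        then show ?thesis using star_good_small_branches X less.prems by simp
      qed
    qed
  qed
  show ?case
  proof (cases "small_branch Z")
    case True
    then show ?thesis using small less.prems by blast
  next
    case False
    then obtain P r Q where Z: "Z = \<langle>P, r, Q\<rangle>" by (cases Z) (auto simp: small_branch_def)
    have "star_good c X Y Z \<or> small_branch \<langle>X, c, Y\<rangle>"
      unfolding Z
      by (rule star_good_split[OF less.prems[unfolded Z] _ False[unfolded Z]])
        (use less.hyps Z in simp)
    then consider "star_good c X Y Z" | "small_branch \<langle>X, c, Y\<rangle>" by blast
    then show ?thesis
    proof cases
      \<comment> \<open>The side of \<open>c\<close> is exceptional, so it serves as the small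
        branch at \<open>r\<close> from which the walk starts.\<close>
      case 2
      have eq: "star_verts c X Y Z = star_verts r P Q \<langle>X, c, Y\<rangle>"
        "star_edges c X Y Z = star_edges r P Q \<langle>X, c, Y\<rangle>"
        "star_distinct c X Y Z = star_distinct r P Q \<langle>X, c, Y\<rangle>"
        unfolding Z using star_rotate star_swap12 star_swap23 by metis+
      have "star_good r P Q \<langle>X, c, Y\<rangle>"
        by (rule small[OF 2 _ less.prems[unfolded eq(3)]]) (simp add: Z)
      then show ?thesis unfolding eq .
    qed
  qed
qed

section \<open>From graphs to labelled trees\<close>

text \<open>Rotations carry the centre down the branch to \<open>w\<close>, one edge at a
  time.\<close>

lemma star_reroot_branch:
  assumes "star_distinct c T Y Z" "w \<in> set_tree T"
  shows "\<exists>X' Y' Z'. star_distinct w X' Y' Z' \<and> star_verts w X' Y' Z' = star_verts c T Y Z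
    \<and> star_edges w X' Y' Z' = star_edges c T Y Z"
  using assms
proof (induction T arbitrary: c Y Z)
  case (Node l a q)
  have rot: "star_distinct a l q \<langle>Y, c, Z\<rangle>" using Node.prems(1) by (simp add: star_rotate)
  consider "w = a" | "w \<in> set_tree l" | "w \<in> set_tree q" using Node.prems(2) by auto
  then show ?case
  proof cases
    case 1
    show ?thesis unfolding star_rotate using rot unfolding 1 by blast
  next
    case 2
    show ?thesis using Node.IH(1)[OF rot 2] by (simp add: star_rotate)
  next
    case 3
    show ?thesis
      using Node.IH(2)[OF rot[unfolded star_swap12(3)[of a l]] 3]
      by (simp add: star_rotate star_swap12(1,2)[of a l])
  qed
qed simp

lemma star_reroot:
  assumes d: "star_distinct c X Y Z" and w: "w \<in> star_verts c X Y Z"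
  shows "\<exists>X' Y' Z'. star_distinct w X' Y' Z' \<and> star_verts w X' Y' Z' = star_verts c X Y Z
    \<and> star_edges w X' Y' Z' = star_edges c X Y Z"
proof -
  consider "w = c" | "w \<in> set_tree X" | "w \<in> set_tree Y" | "w \<in> set_tree Z"
    using w by (auto simp: star_verts_def)
  then show ?thesis
  proof cases
    case 1
    then show ?thesis using d by blast
  next
    case 2
    then show ?thesis using star_reroot_branch[OF d] by blast
  next
    case 3
    then show ?thesis
      using star_reroot_branch[OF d[unfolded star_swap12(3)[of c X]]] by (simp add: star_swap12(1,2)[of c X])
  next
    case 4
    have "star_distinct c Z X Y" using d star_swap12(3) star_swap23(3) by metis
    moreover have "star_verts c Z X Y = star_verts c X Y Z" "star_edges c Z X Y = star_edges c X Y Z"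
      using star_swap12 star_swap23 by metis+
    ultimately show ?thesis using star_reroot_branch[of c Z X Y w] 4 by simp
  qed
qed

text \<open>\<open>R\<close> holds both orientations of each edge, so the last condition is the
  count of \<open>card V - 1\<close> edges, written without subtraction.\<close>

definition tree_on :: "'a set \<Rightarrow> ('a \<times> 'a) set \<Rightarrow> bool" where
  "tree_on V R \<longleftrightarrow> finite V \<and> V \<noteq> {} \<and> R \<subseteq> V \<times> V \<and> sym R \<and> irrefl R
    \<and> (\<forall>u\<in>V. \<forall>v\<in>V. (u, v) \<in> R\<^sup>*) \<and> card R + 2 = 2 * card V"

text \<open>The degrees sum to less than \<open>2 * card V\<close>, so some degree is at most 1;
  connectedness with a second vertex excludes degree 0.\<close>

lemma tree_on_leaf:
  assumes T: "tree_on V R" and V: "card V \<noteq> 1"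
  shows "\<exists>v\<in>V. \<exists>u. R `` {v} = {u}"
proof -
  from T have fin: "finite V" and R: "R \<subseteq> V \<times> V" and conn: "\<forall>u\<in>V. \<forall>v\<in>V. (u, v) \<in> R\<^sup>*"
    and card: "card R + 2 = 2 * card V" and ne: "V \<noteq> {}" by (auto simp: tree_on_def)
  have finR: "finite (R `` {v})" for v
    by (rule finite_subset[of _ V]) (use R fin in auto)
  have "R = Sigma V (\<lambda>v. R `` {v})" using R by auto
  then have "card R = (\<Sum>v\<in>V. card (R `` {v}))" using fin finR by (metis card_SigmaI)
  moreover have "card R < 2 * card V" using card by simp
  ultimately have "\<not> (\<forall>v\<in>V. 2 \<le> card (R `` {v}))"
    using sum_bounded_below[of V 2 "\<lambda>v. card (R `` {v})"] by auto
  then obtain v where v: "v \<in> V" "card (R `` {v}) \<le> 1" by fastforce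
  have "card V > 1" using V ne fin by (metis One_nat_def Suc_lessI card_gt_0_iff)
  then have "V - {v} \<noteq> {}" using v(1) fin by (metis card_Diff_singleton card.empty diff_is_0_eq leD)
  then obtain w where w: "w \<in> V" "w \<noteq> v" by blast
  then have "(v, w) \<in> R\<^sup>*" using conn v by blast
  then have "R `` {v} \<noteq> {}" using w(2) by (auto elim: converse_rtranclE)
  then have "card (R `` {v}) \<noteq> 0" using finR[of v] by simp
  then have "card (R `` {v}) = 1" using v(2) by linarith
  then show ?thesis using v(1) by (metis card_1_singletonE)
qed

lemma tree_on_remove_leaf:
  assumes T: "tree_on V R" and v: "v \<in> V" and u: "R `` {v} = {u}"
  shows "tree_on (V - {v}) (R - {(v, u), (u, v)})" "u \<in> V" "u \<noteq> v" "{(v, u), (u, v)} \<subseteq> R"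
proof -
  from T have fin: "finite V" and R: "R \<subseteq> V \<times> V" and conn: "\<forall>u\<in>V. \<forall>v\<in>V. (u, v) \<in> R\<^sup>*"
    and card: "card R + 2 = 2 * card V" and sym: "sym R" and irr: "irrefl R"
    by (auto simp: tree_on_def)
  show vu: "{(v, u), (u, v)} \<subseteq> R" using u sym by (auto dest: symD)
  show uV: "u \<in> V" using vu R by auto
  show uv: "u \<noteq> v" using vu irr by (auto simp: irrefl_def)
  let ?R = "R - {(v, u), (u, v)}"
  have only: "y = u" if "(v, y) \<in> R \<or> (y, v) \<in> R" for y
    using that u sym by (auto dest: symD)
  have sub: "?R \<subseteq> (V - {v}) \<times> (V - {v})" using R only by blast
  \<comment> \<open>A walk meets the leaf \<open>v\<close> only by coming from \<open>u\<close> and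
    returning to it, so \<open>u\<close> can stand in for \<open>v\<close> along the walk.\<close>
  have path: "(y \<noteq> v \<longrightarrow> (a, y) \<in> ?R\<^sup>*) \<and> (y = v \<longrightarrow> (a, u) \<in> ?R\<^sup>*)" if "(a, y) \<in> R\<^sup>*" "a \<noteq> v" for a y
    using that(1)
  proof (induction rule: rtrancl_induct)
    case base
    then show ?case using that(2) by simp
  next
    case (step y z)
    show ?case
    proof (cases "y = v \<or> z = v")
      case True
      then show ?thesis using step only[of y] only[of z] uv by auto
    next
      case False
      then have "(y, z) \<in> ?R" using step.hyps by auto
      then show ?thesis using False step.IH by (auto intro: rtrancl_into_rtrancl)
    qed
  qed
  have "card ?R = card R - 2"
    using vu uv by (subst card_Diff_subset) auto
  moreover have "card (V - {v}) = card V - 1" using v by simp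
  moreover have "card V \<ge> 2" using card_mono[of V "{u, v}"] uV v uv fin by simp
  ultimately have "card ?R + 2 = 2 * card (V - {v})" using card by simp
  moreover have "sym ?R" using sym by (auto simp: sym_def)
  moreover have "irrefl ?R" using irr by (auto simp: irrefl_def)
  ultimately show "tree_on (V - {v}) ?R"
    unfolding tree_on_def using fin uV uv sub path conn by auto
qed

lemma root_neighbours:
  assumes "star_distinct c \<langle>l1, x, q1\<rangle> \<langle>l2, y, q2\<rangle> \<langle>l3, z, q3\<rangle>"
  shows "{x, y, z} \<subseteq> star_edges c \<langle>l1, x, q1\<rangle> \<langle>l2, y, q2\<rangle> \<langle>l3, z, q3\<rangle> `` {c}"
    "card {x, y, z} = 3"
  using assms by (auto simp: star_edges_def star_distinct_def)

text \<open>Remove a leaf \<open>v\<close> with neighbour \<open>u\<close>, describe the rest by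
  induction and make \<open>u\<close> the centre. Without \<open>v\<close> the degree of
  \<open>u\<close> is at most 2, so one of its slots is empty and takes \<open>v\<close>
  back.\<close>

lemma tree_on_star:
  assumes "tree_on V R" "\<And>v. card (R `` {v}) \<le> 3"
  shows "\<exists>c X Y Z. star_distinct c X Y Z \<and> star_verts c X Y Z = V \<and> star_edges c X Y Z = R"
  using assms
proof (induction "card V" arbitrary: V R rule: less_induct)
  case less
  have fin: "finite V" and irr: "irrefl R" and RV: "R \<subseteq> V \<times> V" using less.prems(1) by (auto simp: tree_on_def)
  then have finR: "finite R" by (meson finite_SigmaI finite_subset)
  show ?case
  proof (cases "card V = 1")
    case True
    then obtain c where V: "V = {c}" by (meson card_1_singletonE)
    then have "R = {}" using RV irr by (auto simp: irrefl_def)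
    then show ?thesis
      by (intro exI[of _ c] exI[of _ "\<langle>\<rangle>"]) (simp add: V star_distinct_def star_verts_def star_edges_def)
  next
    case False
    from tree_on_leaf[OF less.prems(1) False] obtain v u where v: "v \<in> V" and u: "R `` {v} = {u}" by blast
    let ?R = "R - {(v, u), (u, v)}"
    note rem = tree_on_remove_leaf[OF less.prems(1) v u]
    have deg: "card (?R `` {w}) \<le> 3" for w
    proof -
      have "card (?R `` {w}) \<le> card (R `` {w})"
        by (rule card_mono) (use finR in auto)
      then show ?thesis using less.prems(2)[of w] by simp
    qed
    have "card (V - {v}) < card V" using v fin by (intro psubset_card_mono) auto
    from less.hyps[OF this rem(1) deg] obtain c X Y Z where
      *: "star_distinct c X Y Z" "star_verts c X Y Z = V - {v}" "star_edges c X Y Z = ?R" by blast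
    then have "u \<in> star_verts c X Y Z" using rem by simp
    from star_reroot[OF *(1) this] * obtain X' Y' Z' where
      s: "star_distinct u X' Y' Z'" "star_verts u X' Y' Z' = V - {v}" "star_edges u X' Y' Z' = ?R"
      by auto
    have deg_u: "card (?R `` {u}) \<le> 2"
    proof -
      have "R `` {u} = insert v (?R `` {u})" "v \<notin> ?R `` {u}" using rem by auto
      then show ?thesis using less.prems(2)[of u] finR by simp
    qed
    have "X' = \<langle>\<rangle> \<or> Y' = \<langle>\<rangle> \<or> Z' = \<langle>\<rangle>"
    proof (rule ccontr)
      assume "\<not> ?thesis"
      then obtain l1 x q1 l2 y q2 l3 z q3 where
        XYZ: "X' = \<langle>l1, x, q1\<rangle>" "Y' = \<langle>l2, y, q2\<rangle>" "Z' = \<langle>l3, z, q3\<rangle>"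
        by (metis tree.exhaust)
      from root_neighbours[OF s(1)[unfolded XYZ]] s(3)[unfolded XYZ]
      have "{x, y, z} \<subseteq> ?R `` {u}" "card {x, y, z} = 3" by auto
      then have "3 \<le> card (?R `` {u})" using card_mono[of "?R `` {u}" "{x, y, z}"] finR by simp
      then show False using deg_u by simp
    qed
    then obtain P Q where s': "star_distinct u \<langle>\<rangle> P Q" "star_verts u \<langle>\<rangle> P Q = V - {v}"
      "star_edges u \<langle>\<rangle> P Q = ?R"
      using s star_swap12 star_swap23 by metis
    have "star_distinct u \<langle>\<langle>\<rangle>, v, \<langle>\<rangle>\<rangle> P Q" using s'(1,2) rem
      by (auto simp: star_distinct_iff star_verts_def)
    moreover have "star_verts u \<langle>\<langle>\<rangle>, v, \<langle>\<rangle>\<rangle> P Q = V" using s'(2) v rem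
      by (auto simp: star_verts_def)
    moreover have "star_edges u \<langle>\<langle>\<rangle>, v, \<langle>\<rangle>\<rangle> P Q = R" using s'(3) rem
      by (auto simp: star_edges_def)
    ultimately show ?thesis by blast
  qed
qed

abbreviation edge_rel :: "(nat \<Rightarrow> nat \<Rightarrow> bool) \<Rightarrow> (nat \<times> nat) set" where
  "edge_rel E \<equiv> {(u, v). E u v}"

lemma tree_on_is_tree:
  assumes "is_tree n E"
  shows "tree_on {0..<n} (edge_rel E)"
proof -
  have simple: "\<And>u v. E u v \<Longrightarrow> u < n \<and> v < n \<and> u \<noteq> v \<and> E v u" and n: "n \<ge> 1"
    and conn: "\<And>u v. u < n \<Longrightarrow> v < n \<Longrightarrow> E\<^sup>*\<^sup>* u v" and card: "card (edges n E) = n - 1"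
    using assms by (auto simp: is_tree_def simple_graph_def connected_graph_def)
  have sub: "edge_rel E \<subseteq> {0..<n} \<times> {0..<n}" using simple by auto
  then have fin: "finite (edge_rel E)" by (meson finite_SigmaI finite_atLeastLessThan finite_subset)
  have "card (edge_rel E) = 2 * card (edges n E)"
  proof -
    let ?L = "{(u, v). E u v \<and> u < v}"
    have L: "edge_rel E = ?L \<union> ?L\<inverse>" "?L \<inter> ?L\<inverse> = {}" using simple by (auto simp: nat_neq_iff)
    have finL: "finite ?L" by (rule finite_subset[OF _ fin]) auto
    have "edges n E = (\<lambda>(u, v). {u, v}) ` ?L"
    proof -
      have "{u, v} \<in> (\<lambda>(u, v). {u, v}) ` ?L" if "E u v" for u v
      proof (cases "u < v")
        case False
        then have "(v, u) \<in> ?L" using simple[OF that] by auto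
        then show ?thesis by (metis (no_types, lifting) case_prod_conv image_eqI insert_commute)
      qed (use that in force)
      then show ?thesis using simple by (fastforce simp: edges_def)
    qed
    moreover have "inj_on (\<lambda>(u, v). {u, v}) ?L" by (auto simp: inj_on_def doubleton_eq_iff)
    ultimately have "card (edges n E) = card ?L" by (simp add: card_image)
    moreover have "card (edge_rel E) = card ?L + card (?L\<inverse>)"
      unfolding L(1) by (rule card_Un_disjoint[OF finL _ L(2)]) (simp add: finL)
    ultimately show ?thesis by (simp add: card_inverse)
  qed
  then have "card (edge_rel E) + 2 = 2 * card {0..<n}" using card n by simp
  moreover have "(u, v) \<in> (edge_rel E)\<^sup>*" if "u < n" "v < n" for u v
    using conn[OF that] by (simp add: rtranclp_rtrancl_eq)
  moreover have "sym (edge_rel E)" "irrefl (edge_rel E)" using simple by (auto simp: sym_def irrefl_def)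
  ultimately show ?thesis using sub n by (auto simp: tree_on_def)
qed

lemma degree_le_max_degree: "v < n \<Longrightarrow> Defs.degree n E v \<le> max_degree n E"
  unfolding max_degree_def by (intro Max_ge) auto

lemma is_tree_star:
  assumes T: "is_tree n E" and \<Delta>: "max_degree n E \<le> 3"
  shows "\<exists>c X Y Z. star_distinct c X Y Z \<and> star_verts c X Y Z = {0..<n} \<and> star_edges c X Y Z = edge_rel E"
proof (rule tree_on_star[OF tree_on_is_tree[OF T]])
  fix v
  have simple: "\<And>u v. E u v \<Longrightarrow> u < n \<and> v < n" using T by (auto simp: is_tree_def simple_graph_def)
  then have eq: "edge_rel E `` {v} = {u. u < n \<and> E v u}" by auto
  show "card (edge_rel E `` {v}) \<le> 3"
  proof (cases "v < n")
    case True
    have "card (edge_rel E `` {v}) = Defs.degree n E v" unfolding eq degree_def ..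
    then show ?thesis using degree_le_max_degree[OF True, of E] \<Delta> by simp
  next
    case False
    then have "edge_rel E `` {v} = {}" using simple by auto
    then show ?thesis by simp
  qed
qed

section \<open>Orders and uniqueness of the exceptional trees\<close>

lemma exceptional_shapes_size:
  "(A, B, C) \<in> exceptional_shapes \<Longrightarrow> size A + size B + size C + 1 \<in> {1, 3, 4, 7}"
  by (auto simp: exceptional_shapes_def)

text \<open>The four trees have different orders, so the order determines the shape; this is the
  source of uniqueness in part (a).\<close>

lemma exceptional_shapes_size_inj:
  assumes "(A, B, C) \<in> exceptional_shapes" "(A', B', C') \<in> exceptional_shapes"
    and "size A + size B + size C = size A' + size B' + size C'"
  shows "A' = A" "B' = B" "C' = C"
  using assms by (auto simp: exceptional_shapes_def)

lemma exceptional_card: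
  assumes "exceptional V R"
  shows "card V \<in> {1, 3, 4, 7}"
proof -
  from assms obtain c X Y Z where d: "star_distinct c X Y Z" and V: "V = star_verts c X Y Z"
    and sh: "(shape X, shape Y, shape Z) \<in> exceptional_shapes" unfolding exceptional_def by blast
  show ?thesis using card_star_verts[OF d] exceptional_shapes_size[OF sh] by (simp add: V)
qed

lemma exceptional_iso:
  assumes "exceptional {0..<n} (edge_rel E)" "exceptional {0..<n} (edge_rel E')"
    and simple: "simple_graph n E"
  shows "graph_iso n E E'"
proof -
  from assms(1) obtain c X Y Z where d: "star_distinct c X Y Z" and V: "{0..<n} = star_verts c X Y Z"
    and R: "edge_rel E = star_edges c X Y Z" and sh: "(shape X, shape Y, shape Z) \<in> exceptional_shapes"
    unfolding exceptional_def by blast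
  from assms(2) obtain c' X' Y' Z' where d': "star_distinct c' X' Y' Z'"
    and V': "{0..<n} = star_verts c' X' Y' Z'" and R': "edge_rel E' = star_edges c' X' Y' Z'"
    and sh': "(shape X', shape Y', shape Z') \<in> exceptional_shapes"
    unfolding exceptional_def by blast
  have "size (shape X) + size (shape Y) + size (shape Z)
      = size (shape X') + size (shape Y') + size (shape Z')"
    using card_star_verts[OF d] card_star_verts[OF d'] by (simp flip: V V')
  note shapes = exceptional_shapes_size_inj[OF sh sh' this]
  from star_relabel[OF d d' shapes] obtain f where
    f: "bij_betw f {0..<n} {0..<n}" and im: "map_prod f f ` edge_rel E = edge_rel E'"
    unfolding V[symmetric] V'[symmetric] R R' by blast
  have "E u v \<longleftrightarrow> E' (f u) (f v)" if "u < n" "v < n" for u v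
  proof
    assume "E u v"
    then have "(f u, f v) \<in> map_prod f f ` edge_rel E" by force
    then show "E' (f u) (f v)" unfolding im by simp
  next
    assume "E' (f u) (f v)"
    then have "(f u, f v) \<in> map_prod f f ` edge_rel E" unfolding im by simp
    then obtain a b where ab: "E a b" "f a = f u" "f b = f v" by auto
    then have "a < n" "b < n" using simple by (auto simp: simple_graph_def)
    then have "a = u" "b = v" using f ab that by (auto simp: bij_betw_def inj_on_def)
    then show "E u v" using ab by simp
  qed
  then show ?thesis using f unfolding graph_iso_def by blast
qed

section \<open>Hypoenergetic trees built from stars\<close>

text \<open>The star with \<open>k\<close> edges attached to the last vertex \<open>n - 1\<close> has centre \<open>n\<close>.\<close>

definition star_leaves :: "nat \<Rightarrow> nat \<Rightarrow> nat set" where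
  "star_leaves n k = insert (n - 1) {n<..<n + k}"

definition attach_star :: "nat \<Rightarrow> nat \<Rightarrow> (nat \<Rightarrow> nat \<Rightarrow> bool) \<Rightarrow> nat \<Rightarrow> nat \<Rightarrow> bool" where
  "attach_star n k E a b \<longleftrightarrow> E a b \<or> a = n \<and> b \<in> star_leaves n k \<or> b = n \<and> a \<in> star_leaves n k"

lemma finite_star_leaves [simp]: "finite (star_leaves n k)"
  by (simp add: star_leaves_def)

lemma card_star_leaves: "n \<ge> 1 \<Longrightarrow> k \<ge> 1 \<Longrightarrow> card (star_leaves n k) = k"
  by (simp add: star_leaves_def)

lemma star_leaves_less: "n \<ge> 1 \<Longrightarrow> k \<ge> 1 \<Longrightarrow> v \<in> star_leaves n k \<Longrightarrow> v < n + k \<and> v \<noteq> n"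
  by (auto simp: star_leaves_def)

lemma simple_graph_attach_star:
  assumes "simple_graph n E" "n \<ge> 1" "k \<ge> 1"
  shows "simple_graph (n + k) (attach_star n k E)"
  using assms star_leaves_less[OF assms(2,3)]
  by (fastforce simp: simple_graph_def attach_star_def)

text \<open>The star brings \<open>k\<close> edges and also \<open>k\<close> new vertices, its
  centre \<open>n\<close> and \<open>k - 1\<close> leaves, because its remaining leaf is the old
  vertex \<open>n - 1\<close>. So the edge count of a tree is kept.\<close>

lemma is_tree_attach_star:
  assumes T: "is_tree n E" and k: "k \<ge> 1"
  shows "is_tree (n + k) (attach_star n k E)"
proof -
  let ?E = "attach_star n k E"
  have n: "n \<ge> 1" and simple: "simple_graph n E" and conn: "connected_graph n E"
    and card: "card (edges n E) = n - 1" using T by (auto simp: is_tree_def)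
  have S: "simple_graph (n + k) ?E" by (rule simple_graph_attach_star[OF simple n k])
  then have "symp ?E" by (auto simp: simple_graph_def symp_def)
  then have sym: "?E\<^sup>*\<^sup>* u v \<Longrightarrow> ?E\<^sup>*\<^sup>* v u" for u v
    by (metis symp_rtranclp sympD)
  have last: "n - 1 \<in> star_leaves n k" by (simp add: star_leaves_def)
  have old: "?E\<^sup>*\<^sup>* (n - 1) v" if "v < n" for v
    by (rule rtranclp_mono[THEN predicate2D, of E]) (use conn n that in \<open>auto simp: connected_graph_def attach_star_def\<close>)
  have centre: "?E\<^sup>*\<^sup>* (n - 1) n" using last by (auto simp: attach_star_def)
  have root: "?E\<^sup>*\<^sup>* (n - 1) v" if "v < n + k" for v
  proof (cases "v \<le> n")
    case True
    then show ?thesis using old centre by (cases "v = n") auto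
  next
    case False
    then have "?E n v" using that by (auto simp: attach_star_def star_leaves_def)
    then show ?thesis using centre by (rule rtranclp.rtrancl_into_rtrancl[rotated])
  qed
  have "connected_graph (n + k) ?E"
    unfolding connected_graph_def using root sym by (meson rtranclp_trans)
  moreover have "edges (n + k) ?E = edges n E \<union> (\<lambda>v. {n, v}) ` star_leaves n k"
  proof (intro equalityI subsetI)
    fix e assume "e \<in> edges (n + k) ?E"
    then obtain u v where "e = {u, v}" "?E u v" by (auto simp: edges_def)
    then show "e \<in> edges n E \<union> (\<lambda>v. {n, v}) ` star_leaves n k"
      using simple by (auto simp: edges_def attach_star_def simple_graph_def)
  next
    fix e assume "e \<in> edges n E \<union> (\<lambda>v. {n, v}) ` star_leaves n k"
    then obtain u v where e: "e = {u, v}" "?E u v"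
      by (auto simp: edges_def attach_star_def)
    then show "e \<in> edges (n + k) ?E" using S by (auto simp: edges_def simple_graph_def)
  qed
  moreover have "edges n E \<inter> (\<lambda>v. {n, v}) ` star_leaves n k = {}"
    by (auto simp: edges_def doubleton_eq_iff)
  moreover have "inj_on (\<lambda>v. {n, v}) (star_leaves n k)"
    by (auto simp: inj_on_def doubleton_eq_iff)
  moreover have "finite (edges n E)"
    by (rule finite_subset[of _ "Pow {0..<n}"]) (auto simp: edges_def)
  ultimately have "card (edges (n + k) ?E) = n + k - 1" "connected_graph (n + k) ?E"
    using card n k by (simp_all add: card_Un_disjoint card_image card_star_leaves)
  then show ?thesis using S n by (simp add: is_tree_def)
qed

lemma degree_attach_star:
  assumes simple: "simple_graph n E" and n: "n \<ge> 1" and k: "k \<ge> 1" and v: "v < n + k"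
  shows "Defs.degree (n + k) (attach_star n k E) v =
    (if v < n - 1 then Defs.degree n E v else if v = n - 1 then Defs.degree n E v + 1 else if v = n then k else 1)"
proof -
  let ?N = "{u. u < n + k \<and> attach_star n k E v u}"
  have E: "\<And>u. E v u \<Longrightarrow> v < n \<and> u < n \<and> u < n + k" using simple by (fastforce simp: simple_graph_def)
  consider "v < n - 1" | "v = n - 1" | "v = n" | "n < v" by linarith
  then show ?thesis
  proof cases
    case 1
    then have "?N = {u. u < n \<and> E v u}" using E by (auto simp: attach_star_def star_leaves_def)
    then show ?thesis using 1 by (simp add: degree_def)
  next
    case 2
    then have "?N = insert n {u. u < n \<and> E v u}" using E n k by (auto simp: attach_star_def star_leaves_def)
    then show ?thesis using 2 n by (simp add: degree_def)
  next
    case 3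
    then have "?N = star_leaves n k" using E star_leaves_less[OF n k] by (auto simp: attach_star_def)
    moreover have "n \<noteq> n - 1" "\<not> n < n - 1" using n by linarith+
    ultimately show ?thesis using 3 card_star_leaves[OF n k] by (simp add: degree_def)
  next
    case 4
    then have "?N = {n}" using E v k by (auto simp: attach_star_def star_leaves_def)
    moreover have "v \<noteq> n - 1" "\<not> v < n - 1" "v \<noteq> n" using 4 by linarith+
    ultimately show ?thesis by (simp add: degree_def)
  qed
qed

text \<open>
  Row \<open>u\<close> of \<open>t\<close> is the star with centre \<open>u\<close>. An edge may be shared by the stars at its two ends.
\<close>

definition star_cover :: "nat \<Rightarrow> (nat \<Rightarrow> nat \<Rightarrow> bool) \<Rightarrow> real \<Rightarrow> bool" where
  "star_cover n E x \<longleftrightarrow> (\<exists>t. (\<forall>u<n. \<forall>v<n. t u v + t v u = (if E u v then 1 else 0 :: real))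
    \<and> 2 * (\<Sum>u<n. sqrt (\<Sum>v<n. (t u v)\<^sup>2)) \<le> x)"

text \<open>The old rows are kept and row \<open>n\<close> takes all \<open>k\<close> new edges with
  weight 1; the rows of the new leaves vanish.\<close>

lemma star_cover_attach_star:
  assumes simple: "simple_graph n E" and n: "n \<ge> 1" and k: "k \<ge> 1" and x: "star_cover n E x"
  shows "star_cover (n + k) (attach_star n k E) (x + 2 * sqrt k)"
proof -
  from x obtain t where t: "\<forall>u<n. \<forall>v<n. t u v + t v u = (if E u v then 1 else 0 :: real)"
    and tx: "2 * (\<Sum>u<n. sqrt (\<Sum>v<n. (t u v)\<^sup>2)) \<le> x" unfolding star_cover_def by blast
  have E: "\<And>u v. E u v \<Longrightarrow> u < n \<and> v < n" using simple by (auto simp: simple_graph_def)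
  define s where "s u v = (if u < n \<and> v < n then t u v else if u = n \<and> v \<in> star_leaves n k then 1 else 0)" for u v
  have less: "{..<n + k} = {..<n} \<union> {n..<n + k}" "{..<n} \<inter> {n..<n + k} = {}" by auto
  have "s u v + s v u = (if attach_star n k E u v then 1 else 0)" if "u < n + k" "v < n + k" for u v
    using t that E[of u v] star_leaves_less[OF n k, of n]
    by (auto simp: s_def attach_star_def)
  moreover have "(\<Sum>u<n + k. sqrt (\<Sum>v<n + k. (s u v)\<^sup>2)) = (\<Sum>u<n. sqrt (\<Sum>v<n. (t u v)\<^sup>2)) + sqrt k"
  proof -
    have row: "(\<Sum>v<n + k. (s u v)\<^sup>2) = (\<Sum>v<n. (t u v)\<^sup>2)" if "u < n" for u
      using that unfolding less(1) by (subst sum.union_disjoint) (auto simp: s_def)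
    have "{n..<n + k} = insert n {n<..<n + k}" using k by auto
    then have "(\<Sum>u\<in>{n..<n + k}. sqrt (\<Sum>v<n + k. (s u v)\<^sup>2))
        = sqrt (\<Sum>v<n + k. (s n v)\<^sup>2) + (\<Sum>u\<in>{n<..<n + k}. sqrt (\<Sum>v<n + k. (s u v)\<^sup>2))" by simp
    also have "(\<Sum>u\<in>{n<..<n + k}. sqrt (\<Sum>v<n + k. (s u v)\<^sup>2)) = 0"
      by (rule sum.neutral) (auto simp: s_def)
    also have "(\<Sum>v<n + k. (s n v)\<^sup>2) = (\<Sum>v<n + k. if v \<in> star_leaves n k then 1 else 0)"
      by (rule sum.cong) (auto simp: s_def)
    also have "\<dots> = card ({..<n + k} \<inter> star_leaves n k)" by (simp add: sum.If_cases)
    also have "{..<n + k} \<inter> star_leaves n k = star_leaves n k" using star_leaves_less[OF n k] by auto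
    finally have "(\<Sum>u\<in>{n..<n + k}. sqrt (\<Sum>v<n + k. (s u v)\<^sup>2)) = sqrt k"
      by (simp add: card_star_leaves[OF n k])
    moreover have "(\<Sum>u<n + k. sqrt (\<Sum>v<n + k. (s u v)\<^sup>2))
        = (\<Sum>u<n. sqrt (\<Sum>v<n + k. (s u v)\<^sup>2)) + (\<Sum>u\<in>{n..<n + k}. sqrt (\<Sum>v<n + k. (s u v)\<^sup>2))"
      by (subst less(1)) (rule sum.union_disjoint[OF _ _ less(2)], auto)
    ultimately show ?thesis by (simp add: row)
  qed
  ultimately show ?thesis unfolding star_cover_def using tx by (intro exI[of _ s]) simp
qed

text \<open>The invariant for repeated attachment: the last vertex has degree at most 1, so gluing
  the next star there raises it to at most 2 and never exceeds \<open>\<Delta>\<close>. The cover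
  makes \<open>x\<close> an upper bound for the energy.\<close>

definition star_tree :: "nat \<Rightarrow> (nat \<Rightarrow> nat \<Rightarrow> bool) \<Rightarrow> nat \<Rightarrow> real \<Rightarrow> bool" where
  "star_tree n E \<Delta> x \<longleftrightarrow> is_tree n E \<and> star_cover n E x \<and> (\<forall>v<n. Defs.degree n E v \<le> \<Delta>) \<and> Defs.degree n E (n - 1) \<le> 1"

lemma star_tree_single: "star_tree 1 (\<lambda>_ _. False) \<Delta> 0"
  by (auto simp: star_tree_def is_tree_def simple_graph_def connected_graph_def edges_def star_cover_def degree_def
      intro!: exI[of _ "\<lambda>_ _. 0"])

lemma star_tree_attach:
  assumes T: "star_tree n E \<Delta> x" and k: "1 \<le> k" "k \<le> \<Delta>" and \<Delta>: "2 \<le> \<Delta>"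
  shows "star_tree (n + k) (attach_star n k E) \<Delta> (x + 2 * sqrt k)"
proof -
  have simple: "simple_graph n E" and n: "n \<ge> 1" using T by (auto simp: star_tree_def is_tree_def)
  note deg = degree_attach_star[OF simple n k(1)]
  have "Defs.degree (n + k) (attach_star n k E) v \<le> \<Delta>" if v: "v < n + k" for v
    using T k \<Delta> n unfolding deg[OF v] star_tree_def by auto
  \<comment> \<open>The last vertex is a new leaf if \<open>k\<close> is at least 2 and the centre
    of a one-edge star if \<open>k\<close> is 1; its degree is 1 either way.\<close>
  moreover have "Defs.degree (n + k) (attach_star n k E) (n + k - 1) \<le> 1"
    using k n by (subst deg) auto
  ultimately show ?thesis
    using T is_tree_attach_star k star_cover_attach_star[OF simple n k(1)] by (auto simp: star_tree_def)
qed

lemma degree_attach_star_centre: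
  assumes "star_tree n E \<Delta> x" "1 \<le> k"
  shows "Defs.degree (n + k) (attach_star n k E) n = k"
  using assms by (subst degree_attach_star) (auto simp: star_tree_def is_tree_def)

text \<open>A vertex of degree at least 2 cannot be the attachment vertex \<open>n - 1\<close>,
  whose degree is at most 1. Hence a vertex of degree \<open>\<Delta>\<close> survives all later
  attachments.\<close>

lemma degree_attach_star_old:
  assumes "star_tree n E \<Delta> x" "1 \<le> k" "v < n" "Defs.degree n E v \<ge> 2"
  shows "Defs.degree (n + k) (attach_star n k E) v = Defs.degree n E v"
  using assms by (subst degree_attach_star) (auto simp: star_tree_def is_tree_def)

lemma two_sqrt_less:
  assumes "4 < (x :: real)" shows "2 * sqrt x < x"
proof -
  have "2 < sqrt x" using assms real_less_rsqrt[of 2 x] by simp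
  then have "2 * sqrt x < sqrt x * sqrt x" using assms by (intro mult_strict_right_mono) auto
  then show ?thesis using assms by simp
qed

text \<open>
  For six vertices and maximum degree 4 a cover by unweighted stars costs at least 6, so
  the edge between the two centres has to be shared.
\<close>

lemma star_tree_six: "\<exists>E x. star_tree 6 E 4 x \<and> (\<exists>v<6. Defs.degree 6 E v = 4) \<and> x < 6"
proof -
  define E where "E = attach_star 5 1 (attach_star 1 4 (\<lambda>_ _. False))"
  have 1: "star_tree 5 (attach_star 1 4 (\<lambda>_ _. False)) 4 (2 * sqrt 4)"
    using star_tree_attach[OF star_tree_single, of 4 4] by simp
  have 2: "star_tree 6 E 4 (2 * sqrt 4 + 2)"
    using star_tree_attach[OF 1, of 1] by (simp add: E_def)
  have "Defs.degree 6 E 1 = 4"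
    using degree_attach_star_old[OF 1, of 1 1] degree_attach_star_centre[OF star_tree_single, of 4]
    by (simp add: E_def)
  then have "\<exists>v<6. Defs.degree 6 E v = 4" by (intro exI[of _ 1]) simp
  \<comment> \<open>Vertex 1 owns three full edges and half of its edge to vertex 4, so its row has
    squared length 3 + 1/4. Vertex 4 owns the other half and the full edge to vertex 5, which gives
    1 + 1/4.\<close>
  moreover have "star_cover 6 E (2 * (sqrt (13 / 4) + sqrt (5 / 4)))"
  proof -
    define t :: "nat \<Rightarrow> nat \<Rightarrow> real" where "t u v = (if u = 1 \<and> v \<in> {0, 2, 3} \<or> u = 4 \<and> v = 5 then 1
      else if u = 1 \<and> v = 4 \<or> u = 4 \<and> v = 1 then 1 / 2 else 0)" for u v
    have E_iff: "E u v \<longleftrightarrow> u = 1 \<and> v \<in> {0, 2, 3, 4} \<or> v = 1 \<and> u \<in> {0, 2, 3, 4} \<or> u = 5 \<and> v = 4 \<or> u = 4 \<and> v = 5" for u v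
      by (auto simp: E_def attach_star_def star_leaves_def)
    have six: "{..<6} = {0, 1, 2, 3, 4, 5 :: nat}" by auto
    have "t u v + t v u = (if E u v then 1 else 0)" for u v
      by (auto simp: t_def E_iff)
    moreover have "(\<Sum>u<6. sqrt (\<Sum>v<6. (t u v)\<^sup>2)) = sqrt (13 / 4) + sqrt (5 / 4)"
      by (simp add: six t_def power2_eq_square)
    ultimately show ?thesis unfolding star_cover_def by (intro exI[of _ t]) simp
  qed
  moreover have "2 * (sqrt (13 / 4) + sqrt (5 / 4)) < (6 :: real)"
  proof -
    have "sqrt (13 / 4) < (181 / 100 :: real)" by (rule real_less_lsqrt) (auto simp: power2_eq_square)
    moreover have "sqrt (5 / 4) < (112 / 100 :: real)" by (rule real_less_lsqrt) (auto simp: power2_eq_square)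
    ultimately show ?thesis by simp
  qed
  ultimately show ?thesis using 2 unfolding star_tree_def
    by (intro exI[of _ E] exI[of _ "2 * (sqrt (13 / 4) + sqrt (5 / 4))"]) auto
qed

text \<open>Attaching a star with four edges adds 4 vertices at cost \<open>2 * sqrt 4\<close>,
  exactly 4, so the inequality passes from \<open>n - 4\<close> to \<open>n\<close>. The base cases
  are a star with \<open>\<Delta>\<close> edges, alone or with one more star of
  \<open>k = 1, 2, 3\<close> edges. The large star costs at most \<open>\<Delta>\<close> for
  \<open>\<Delta> + 1\<close> vertices, and the spare unit covers the second star since
  \<open>2 * sqrt k < k + 1\<close> for \<open>k = 2, 3\<close>. For \<open>k = 1\<close> there is
  equality, so \<open>\<Delta> > 4\<close> is required and \<open>\<Delta> = 4\<close> is left to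
  \<open>star_tree_six\<close>.\<close>

lemma star_tree_exists:
  assumes "4 \<le> \<Delta>" "\<Delta> + 1 \<le> n"
  shows "\<exists>E x. star_tree n E \<Delta> x \<and> (\<exists>v<n. Defs.degree n E v = \<Delta>) \<and> x < n"
  using assms(2)
proof (induction n rule: less_induct)
  case (less n)
  have two: "2 \<le> \<Delta>" using assms by simp
  let ?S = "attach_star 1 \<Delta> (\<lambda>_ _. False)"
  have star: "star_tree (\<Delta> + 1) ?S \<Delta> (2 * sqrt \<Delta>)"
    using star_tree_attach[OF star_tree_single, of \<Delta> \<Delta>] assms by (simp add: add.commute)
  have star_deg: "Defs.degree (\<Delta> + 1) ?S 1 = \<Delta>"
    using degree_attach_star_centre[OF star_tree_single, of \<Delta>] assms by (simp add: add.commute)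
  have star_le: "2 * sqrt \<Delta> \<le> \<Delta>"
    using two_sqrt_less[of \<Delta>] assms by (cases "\<Delta> = 4") auto
  have extend: ?case if "star_tree m E \<Delta> x" "\<exists>v<m. Defs.degree m E v = \<Delta>" "x + 2 * sqrt k < m + k"
    "n = m + k" "1 \<le> k" "k \<le> \<Delta>" for m E x k
  proof -
    from that(2) obtain v where "v < m" "Defs.degree m E v = \<Delta>" by blast
    then have "Defs.degree (m + k) (attach_star m k E) v = \<Delta>" "v < m + k"
      using degree_attach_star_old[OF that(1,5)] two by auto
    then show ?thesis using star_tree_attach[OF that(1,5,6) two] that(3,4) by (metis of_nat_add)
  qed
  have sqrt2: "sqrt 2 < (3 / 2 :: real)" and sqrt3: "sqrt 3 < (2 :: real)"
    by (rule real_less_lsqrt; simp add: power2_eq_square)+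
  have deg1: "\<exists>v<\<Delta> + 1. Defs.degree (\<Delta> + 1) ?S v = \<Delta>" using star_deg assms by (intro exI[of _ 1]) simp
  consider "n = \<Delta> + 1" | "n = \<Delta> + 2" "\<Delta> = 4" | "n = \<Delta> + 2" "\<Delta> > 4" | "n = \<Delta> + 3" | "n = \<Delta> + 4" | "n \<ge> \<Delta> + 5"
    using less.prems assms by linarith
  then show ?case
  proof cases
    case 1
    then show ?thesis using star deg1 star_le by (intro exI[of _ ?S] exI[of _ "2 * sqrt \<Delta>"]) simp
  next
    case 2
    then show ?thesis using star_tree_six by simp
  next
    case 3
    then have "2 * sqrt \<Delta> + 2 * sqrt 1 < real (\<Delta> + 1) + real 1" using two_sqrt_less[of \<Delta>] by simp
    then show ?thesis using extend[OF star deg1, of 1] 3 by simp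
  next
    case 4
    have "2 * sqrt \<Delta> + 2 * sqrt (real 2) < real (\<Delta> + 1) + real 2" using star_le sqrt2 by simp
    then show ?thesis using extend[OF star deg1, of 2] 4 assms by simp
  next
    case 5
    have "2 * sqrt \<Delta> + 2 * sqrt (real 3) < real (\<Delta> + 1) + real 3" using star_le sqrt3 by simp
    then show ?thesis using extend[OF star deg1, of 3] 5 assms by simp
  next
    case 6
    then have "n - 4 < n" "\<Delta> + 1 \<le> n - 4" by auto
    from less.IH[OF this] obtain E x where E: "star_tree (n - 4) E \<Delta> x"
      "\<exists>v<n - 4. Defs.degree (n - 4) E v = \<Delta>" "x < real (n - 4)" by blast
    have "x + 2 * sqrt (real 4) < real (n - 4) + real 4" using E(3) by simp
    then show ?thesis using extend[OF E(1,2), of 4] 6 assms by simp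
  qed
qed

lemma max_degree_le:
  assumes "\<And>v. v < n \<Longrightarrow> Defs.degree n E v \<le> d" "n \<ge> 1"
  shows "max_degree n E \<le> d"
  unfolding max_degree_def by (rule Max.boundedI) (use assms in auto)

lemma star_tree_max_degree:
  assumes "star_tree n E \<Delta> x"
  shows "max_degree n E \<le> \<Delta>"
  using assms by (intro max_degree_le) (auto simp: star_tree_def is_tree_def)

text \<open>The complete binary tree with 7 vertices is two stars with three edges sharing the leaf
  3, which is its root. The bound 7/4 on \<open>sqrt 3\<close> is just what
  \<open>4 * sqrt 3 < 7\<close> needs.\<close>

lemma star_tree_exceptional:
  assumes "n \<in> {1, 3, 4, 7}"
  shows "\<exists>E x. star_tree n E 3 x \<and> x < n \<and> exceptional {0..<n} (edge_rel E)"
proof -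
  have sqrt2: "sqrt 2 < (3 / 2 :: real)" and sqrt3: "sqrt 3 < (7 / 4 :: real)"
    by (rule real_less_lsqrt; simp add: power2_eq_square)+
  let ?K1 = "\<lambda>_ _. False"
  let ?P3 = "attach_star 1 2 ?K1" and ?S4 = "attach_star 1 3 ?K1"
  let ?B7 = "attach_star 4 3 ?S4"
  have S4: "star_tree 4 ?S4 3 (2 * sqrt 3)" using star_tree_attach[OF star_tree_single, of 3 3] by simp
  have P3: "star_tree 3 ?P3 3 (2 * sqrt 2)" using star_tree_attach[OF star_tree_single, of 2 3] by (simp add: numeral_3_eq_3)
  have B7: "star_tree 7 ?B7 3 (2 * sqrt 3 + 2 * sqrt 3)" using star_tree_attach[OF S4, of 3] by simp
  note defs = star_distinct_def star_verts_def star_edges_def exceptional_shapes_def attach_star_def star_leaves_def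
  have eK1: "exceptional {0..<1} (edge_rel ?K1)"
    unfolding exceptional_def
    by (intro exI[of _ 0] exI[of _ "\<langle>\<rangle>"]) (auto simp: defs)
  have eP3: "exceptional {0..<3} (edge_rel ?P3)"
    unfolding exceptional_def
    by (intro exI[of _ 1] exI[of _ "\<langle>\<rangle>"] exI[of _ "\<langle>\<langle>\<rangle>, 0, \<langle>\<rangle>\<rangle>"] exI[of _ "\<langle>\<langle>\<rangle>, 2, \<langle>\<rangle>\<rangle>"]) (auto simp: defs)
  have eS4: "exceptional {0..<4} (edge_rel ?S4)"
    unfolding exceptional_def
    by (intro exI[of _ 1] exI[of _ "\<langle>\<langle>\<rangle>, 0, \<langle>\<rangle>\<rangle>"] exI[of _ "\<langle>\<langle>\<rangle>, 2, \<langle>\<rangle>\<rangle>"] exI[of _ "\<langle>\<langle>\<rangle>, 3, \<langle>\<rangle>\<rangle>"])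
      (auto simp: defs)
  have eB7: "exceptional {0..<7} (edge_rel ?B7)"
  proof -
    let ?Y = "\<langle>\<langle>\<langle>\<rangle>, 0, \<langle>\<rangle>\<rangle>, 1, \<langle>\<langle>\<rangle>, 2, \<langle>\<rangle>\<rangle>\<rangle> :: nat tree"
    let ?Z = "\<langle>\<langle>\<langle>\<rangle>, 5, \<langle>\<rangle>\<rangle>, 4, \<langle>\<langle>\<rangle>, 6, \<langle>\<rangle>\<rangle>\<rangle> :: nat tree"
    have leaves: "star_leaves 1 3 = {0, 2, 3}" "star_leaves 4 3 = {3, 5, 6}"
      by (auto simp: star_leaves_def)
    have "{0..<7} = star_verts 3 \<langle>\<rangle> ?Y ?Z" by (auto simp: star_verts_def)
    moreover have "edge_rel ?B7 = {4} \<times> {3, 5, 6} \<union> {3, 5, 6} \<times> {4} \<union> {1} \<times> {0, 2, 3} \<union> {0, 2, 3} \<times> {1}"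
      unfolding attach_star_def leaves by blast
    moreover have "\<dots> = star_edges 3 \<langle>\<rangle> ?Y ?Z"
      by (auto simp: star_edges_def)
    moreover have "star_distinct 3 \<langle>\<rangle> ?Y ?Z" by (simp add: star_distinct_def)
    moreover have "(shape \<langle>\<rangle>, shape ?Y, shape ?Z) \<in> exceptional_shapes"
      by (simp add: exceptional_shapes_def)
    ultimately show ?thesis unfolding exceptional_def by metis
  qed
  have "2 * sqrt 2 < real 3" "2 * sqrt 3 < real 4" "2 * sqrt 3 + 2 * sqrt 3 < real 7"
    using sqrt2 sqrt3 by simp_all
  then show ?thesis
    using assms star_tree_single[of 3] P3 S4 B7 eK1 eP3 eS4 eB7
    by (elim insertE emptyE) (fastforce+)
qed

section \<open>Transfer of the bounds to graphs, and the classification\<close>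

lemma star_cover_energy:
  assumes "simple_graph n E" "star_cover n E x"
  shows "energy n E \<le> x"
proof -
  from assms(2) obtain t where t: "\<forall>u<n. \<forall>v<n. t u v + t v u = (if E u v then 1 else 0 :: real)"
    and x: "2 * (\<Sum>u<n. sqrt (\<Sum>v<n. (t u v)\<^sup>2)) \<le> x" unfolding star_cover_def by blast
  have "energy n E \<le> 2 * (\<Sum>u<n. sqrt (\<Sum>v<n. (t u v)\<^sup>2))"
    by (rule energy_le_star_cover) (use t assms(1) in \<open>auto simp: simple_graph_def\<close>)
  then show ?thesis using x by simp
qed

lemma energy_lb_energy:
  assumes simple: "simple_graph n E" and lb: "energy_lb {0..<n} (edge_rel E) x"
  shows "x \<le> energy n E"
proof -
  from lb obtain B where B: "contraction_on {..<n} B" "x \<le> (\<Sum>(u, v)\<in>edge_rel E. B u v)"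
    unfolding energy_lb_def lessThan_atLeast0 by blast
  have E: "\<And>u v. E u v \<Longrightarrow> u < n \<and> v < n \<and> E v u" using simple by (auto simp: simple_graph_def)
  have "(\<Sum>(u, v)\<in>edge_rel E. B u v) = (\<Sum>(u, v)\<in>{..<n} \<times> {..<n}. if E u v then B u v else 0)"
    by (rule sum.mono_neutral_cong_left) (use E in \<open>auto split: if_splits\<close>)
  also have "\<dots> = (\<Sum>u<n. \<Sum>v<n. if E u v then B u v else 0)"
    by (simp add: sum.cartesian_product)
  also have "\<dots> \<le> energy n E"
    by (rule energy_ge_contraction[OF _ B(1)]) (use E in blast)
  finally show ?thesis using B(2) by simp
qed

lemma hypoenergetic_exceptional:
  assumes T: "is_tree n E" and h: "hypoenergetic n E" and \<Delta>: "max_degree n E \<le> 3"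
  shows "exceptional {0..<n} (edge_rel E)"
proof -
  from is_tree_star[OF T \<Delta>] obtain c X Y Z where d: "star_distinct c X Y Z"
    and V: "star_verts c X Y Z = {0..<n}" and R: "star_edges c X Y Z = edge_rel E" by blast
  have "simple_graph n E" using T by (simp add: is_tree_def)
  then have "\<not> energy_lb {0..<n} (edge_rel E) n"
    using energy_lb_energy h by (fastforce simp: hypoenergetic_def)
  then show ?thesis using star_good[OF d] by (simp add: V R)
qed

lemma star_tree_hypoenergetic:
  assumes "star_tree n E \<Delta> x" "x < n"
  shows "is_tree n E" "hypoenergetic n E" "max_degree n E \<le> \<Delta>"
proof -
  have "simple_graph n E" "connected_graph n E" "energy n E \<le> x"
    using assms(1) star_cover_energy by (auto simp: star_tree_def is_tree_def)
  then show "hypoenergetic n E" using assms(2) by (simp add: hypoenergetic_def)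
  show "is_tree n E" using assms(1) by (simp add: star_tree_def)
  show "max_degree n E \<le> \<Delta>" using star_tree_max_degree assms(1) .
qed

theorem theorem1p3:
  shows "(\<forall>n. (\<exists>E. is_tree n E \<and> hypoenergetic n E \<and> max_degree n E \<le> 3)
              \<longleftrightarrow> n \<in> {1, 3, 4, 7})
       \<and> (\<forall>n \<in> {1, 3, 4, 7}. \<exists>E. is_tree n E \<and> hypoenergetic n E \<and> max_degree n E \<le> 3 \<and>
              (\<forall>E'. is_tree n E' \<and> hypoenergetic n E' \<and> max_degree n E' \<le> 3 \<longrightarrow> graph_iso n E E'))
       \<and> (\<forall>\<Delta> n. 4 \<le> \<Delta> \<and> \<Delta> + 1 \<le> n \<longrightarrow>
              (\<exists>E. is_tree n E \<and> hypoenergetic n E \<and> max_degree n E = \<Delta>))"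
proof (intro conjI)
  have unique: "\<exists>E. is_tree n E \<and> hypoenergetic n E \<and> max_degree n E \<le> 3 \<and>
      (\<forall>E'. is_tree n E' \<and> hypoenergetic n E' \<and> max_degree n E' \<le> 3 \<longrightarrow> graph_iso n E E')"
    if n: "n \<in> {1, 3, 4, 7}" for n
  proof -
    from star_tree_exceptional[OF n] obtain E x where E: "star_tree n E 3 x" "x < n"
      "exceptional {0..<n} (edge_rel E)" by blast
    note T = star_tree_hypoenergetic[OF E(1,2)]
    have "graph_iso n E E'" if "is_tree n E'" "hypoenergetic n E'" "max_degree n E' \<le> 3" for E'
      using exceptional_iso[OF E(3) hypoenergetic_exceptional[OF that]] T(1) by (simp add: is_tree_def)
    then show ?thesis using T by blast
  qed
  then show "\<forall>n\<in>{1, 3, 4, 7}. \<exists>E. is_tree n E \<and> hypoenergetic n E \<and> max_degree n E \<le> 3 \<and>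
      (\<forall>E'. is_tree n E' \<and> hypoenergetic n E' \<and> max_degree n E' \<le> 3 \<longrightarrow> graph_iso n E E')"
    by blast
  show "\<forall>n. (\<exists>E. is_tree n E \<and> hypoenergetic n E \<and> max_degree n E \<le> 3) \<longleftrightarrow> n \<in> {1, 3, 4, 7}"
  proof (intro allI iffI)
    fix n assume "\<exists>E. is_tree n E \<and> hypoenergetic n E \<and> max_degree n E \<le> 3"
    then obtain E where "exceptional {0..<n} (edge_rel E)" using hypoenergetic_exceptional by blast
    from exceptional_card[OF this] show "n \<in> {1, 3, 4, 7}" by simp
  next
    fix n :: nat assume "n \<in> {1, 3, 4, 7}"
    from unique[OF this] show "\<exists>E. is_tree n E \<and> hypoenergetic n E \<and> max_degree n E \<le> 3" by blast
  qed
  show "\<forall>\<Delta> n. 4 \<le> \<Delta> \<and> \<Delta> + 1 \<le> n \<longrightarrow>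
      (\<exists>E. is_tree n E \<and> hypoenergetic n E \<and> max_degree n E = \<Delta>)"
  proof (intro allI impI)
    fix \<Delta> n :: nat assume "4 \<le> \<Delta> \<and> \<Delta> + 1 \<le> n"
    then obtain E x v where E: "star_tree n E \<Delta> x" "v < n" "Defs.degree n E v = \<Delta>" "x < n"
      using star_tree_exists by blast
    note T = star_tree_hypoenergetic[OF E(1,4)]
    have "max_degree n E = \<Delta>" using T(3) degree_le_max_degree[OF E(2), of E] E(3) by simp
    then show "\<exists>E. is_tree n E \<and> hypoenergetic n E \<and> max_degree n E = \<Delta>" using T by blast
  qed
qed

end
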